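(* Let $1\le p,q\le\infty$. (a) If $2<p,q<\infty$, then the norm of the projective tensor product $\ell_p\hat{\otimes}_\pi\ell_q$ is strongly subdifferentiable. (b) If $p^{-1}+q^{-1}\ge 1$, or if one of $p$ and $q$ is $1$ or $\infty$, then the norm of $\ell_p\hat{\otimes}_\pi\ell_q$ is not strongly subdifferentiable.
   Context: Scalars are $\mathbb{K}=\mathbb{R}$ or $\mathbb{C}$; $\ell_p$ is the usual space of $p$-summable (bounded, if $p=\infty$) scalar sequences; $1/\infty=0$. $\hat{\otimes}_\pi$ denotes the completed projective tensor product of Banach spaces. The norm of a Banach space $X$ is strongly subdifferentiable (SSD) at $x\in S_X$ (the unit sphere) if the one-sided limit $\lim_{t\to0^+}\frac{\|x+th\|-\|x\|}{t}$ exists uniformly for $h$ in the closed unit ball $B_X$; the norm of $X$ is strongly subdifferentiable if this holds at every $x\in S_X$. *)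

theory Defs
  imports "HOL-Analysis.Analysis"
begin

text \<open>
  Normed spaces are records with an explicit carrier, since the exponent of a sequence space is a
  value and the spaces below depend on it. The operations and the norm are only meaningful on
  \<open>points\<close>. The scalars are a type, to be instantiated with the reals or the complex numbers.
\<close>

record ('k, 'v) nspace =
  points :: "'v set"
  vadd :: "'v \<Rightarrow> 'v \<Rightarrow> 'v"
  smul :: "'k \<Rightarrow> 'v \<Rightarrow> 'v"
  nrm :: "'v \<Rightarrow> real"

definition vdist :: "('k::real_normed_field, 'v) nspace \<Rightarrow> 'v \<Rightarrow> 'v \<Rightarrow> real" where
  "vdist V u v = nrm V (vadd V u (smul V (- 1) v))"

definition ell :: "'k::real_normed_field itself \<Rightarrow> ereal \<Rightarrow> ('k, nat \<Rightarrow> 'k) nspace" where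
  "ell K p =
    \<lparr>points = {x. if p = \<infinity> then bounded (range x)
                   else summable (\<lambda>n. norm (x n) powr real_of_ereal p)},
     vadd = (\<lambda>x y n. x n + y n),
     smul = (\<lambda>a x n. a * x n),
     nrm = (\<lambda>x. if p = \<infinity> then (SUP n. norm (x n))
                 else (\<Sum>n. norm (x n) powr real_of_ereal p) powr (1 / real_of_ereal p))\<rparr>"

text \<open>
  The algebraic tensor product is the span of the evaluations \<open>B \<mapsto> B x y\<close> in the algebraic dual of
  the space of all (not necessarily bounded) bilinear forms. A form is a total function which is
  bilinear on the carriers; its values elsewhere play no role. Scalar coefficients are absorbed in
  the first factor, so the finite sums of elementary tensors already form the span.
\<close>

definition bilinear_forms ::
  "('k::real_normed_field, 'v) nspace \<Rightarrow> ('k, 'w) nspace \<Rightarrow> ('v \<Rightarrow> 'w \<Rightarrow> 'k) set" where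
  "bilinear_forms X Y = {B.
     (\<forall>x\<in>points X. \<forall>x'\<in>points X. \<forall>y\<in>points Y. B (vadd X x x') y = B x y + B x' y) \<and>
     (\<forall>x\<in>points X. \<forall>y\<in>points Y. \<forall>y'\<in>points Y. B x (vadd Y y y') = B x y + B x y') \<and>
     (\<forall>a. \<forall>x\<in>points X. \<forall>y\<in>points Y. B (smul X a x) y = a * B x y) \<and>
     (\<forall>a. \<forall>x\<in>points X. \<forall>y\<in>points Y. B x (smul Y a y) = a * B x y)}"

definition elem_tensor ::
  "('k::real_normed_field, 'v) nspace \<Rightarrow> ('k, 'w) nspace \<Rightarrow> 'v \<Rightarrow> 'w \<Rightarrow> ('v \<Rightarrow> 'w \<Rightarrow> 'k) \<Rightarrow> 'k" where
  "elem_tensor X Y x y = (\<lambda>B. if B \<in> bilinear_forms X Y then B x y else 0)"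

definition tensor_rep ::
  "('k::real_normed_field, 'v) nspace \<Rightarrow> ('k, 'w) nspace \<Rightarrow> nat \<Rightarrow> (nat \<Rightarrow> 'v) \<Rightarrow> (nat \<Rightarrow> 'w) \<Rightarrow>
    (('v \<Rightarrow> 'w \<Rightarrow> 'k) \<Rightarrow> 'k) \<Rightarrow> bool" where
  "tensor_rep X Y n x y u \<longleftrightarrow>
     (\<forall>i<n. x i \<in> points X \<and> y i \<in> points Y) \<and>
     u = (\<lambda>B. \<Sum>i<n. elem_tensor X Y (x i) (y i) B)"

definition alg_proj_tensor ::
  "('k::real_normed_field, 'v) nspace \<Rightarrow> ('k, 'w) nspace \<Rightarrow>
    ('k, ('v \<Rightarrow> 'w \<Rightarrow> 'k) \<Rightarrow> 'k) nspace" where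
  "alg_proj_tensor X Y =
    \<lparr>points = {u. \<exists>n x y. tensor_rep X Y n x y u},
     vadd = (\<lambda>u v B. u B + v B),
     smul = (\<lambda>a u B. a * u B),
     nrm = (\<lambda>u. Inf {\<Sum>i<n. nrm X (x i) * nrm Y (y i) |n x y. tensor_rep X Y n x y u})\<rparr>"

text \<open>The completion consists of the classes of Cauchy sequences modulo null sequences.\<close>

definition cauchy_seqs :: "('k::real_normed_field, 'v) nspace \<Rightarrow> (nat \<Rightarrow> 'v) set" where
  "cauchy_seqs V = {s. range s \<subseteq> points V \<and>
     (\<forall>e>0. \<exists>N. \<forall>m\<ge>N. \<forall>n\<ge>N. vdist V (s m) (s n) < e)}"

definition cauchy_rel :: "('k::real_normed_field, 'v) nspace \<Rightarrow> ((nat \<Rightarrow> 'v) \<times> (nat \<Rightarrow> 'v)) set" where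
  "cauchy_rel V = {(s, t). s \<in> cauchy_seqs V \<and> t \<in> cauchy_seqs V \<and>
     (\<lambda>n. vdist V (s n) (t n)) \<longlonglongrightarrow> 0}"

definition completion ::
  "('k::real_normed_field, 'v) nspace \<Rightarrow> ('k, (nat \<Rightarrow> 'v) set) nspace" where
  "completion V =
    \<lparr>points = cauchy_seqs V // cauchy_rel V,
     vadd = (\<lambda>P Q. \<Union>s\<in>P. \<Union>t\<in>Q. cauchy_rel V `` {\<lambda>n. vadd V (s n) (t n)}),
     smul = (\<lambda>a P. \<Union>s\<in>P. cauchy_rel V `` {\<lambda>n. smul V a (s n)}),
     nrm = (\<lambda>P. the_elem ((\<lambda>s. lim (\<lambda>n. nrm V (s n))) ` P))\<rparr>"

definition proj_tensor ::
  "('k::real_normed_field, 'v) nspace \<Rightarrow> ('k, 'w) nspace \<Rightarrow>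
    ('k, (nat \<Rightarrow> ('v \<Rightarrow> 'w \<Rightarrow> 'k) \<Rightarrow> 'k) set) nspace" where
  "proj_tensor X Y = completion (alg_proj_tensor X Y)"

definition ssd_at :: "('k::real_normed_field, 'v) nspace \<Rightarrow> 'v \<Rightarrow> bool" where
  "ssd_at V x \<longleftrightarrow> (\<exists>L. uniform_limit {h \<in> points V. nrm V h \<le> 1}
     (\<lambda>t h. (nrm V (vadd V x (smul V (of_real t) h)) - nrm V x) / t) L (at_right 0))"

definition strongly_subdifferentiable :: "('k::real_normed_field, 'v) nspace \<Rightarrow> bool" where
  "strongly_subdifferentiable V \<longleftrightarrow> (\<forall>x\<in>points V. nrm V x = 1 \<longrightarrow> ssd_at V x)"

end

(* A point s of the unit sphere is a point of strong subdifferentiability if bilinear forms of norm at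
   most one whose values at s tend to the norm of s converge in norm, along a subsequence, to a form
   attaining it: the derivative in direction h is then the largest value at h of such a form.
   Pointwise convergence along a subsequence is compactness, and for 2 < p, q it improves to norm
   convergence: if B has norm one and B x y is almost 1 with y of finite support, then perturbing x by
   a u and y by b v, with v disjoint from y, shows that a b B u v is at most of order a^2 + b^q, hence
   small compared with a b for suitable a and b. So such forms are determined, up to a small error, by
   finitely many coordinates.

   In the negative cases the tensor product contains an isometric copy of ell_infinity (tensored with
   a unit vector) or, by Hoelder's inequality, of ell_1 (on the diagonal), and neither norm is
   strongly subdifferentiable. *)

theory Submission
  imports Defs "HOL-Library.Function_Algebras" "HOL-Complex_Analysis.Great_Picard"
begin

section \<open>The Hahn--Banach theorem for sublinear functionals\<close>

text \<open>A tensor is an evaluation functional on bilinear forms, so duality is built in: a linear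
  functional \<open>f\<close> on tensors gives the form with entries
  \<open>f (elem_tensor X Y x y)\<close>, and its value at a tensor \<open>u\<close> is
  \<open>u B\<close>. Functions are made a real vector space here so that carriers are subspaces of
  it and Hahn-Banach applies to the projective norm. For a point of the completion this yields only
  forms that almost attain the norm; exact attainment comes from compactness. The obstacle is
  uniformity in the direction h: pointwise convergence of forms handles one fixed h, whereas a
  sequence of directions calls for convergence in norm. There the choice
  \<open>a = \<kappa> * b\<close> with small \<kappa> makes a^2 small against a b, and a small b
  then makes b^q small against a b, which is where q > 2 enters. This controls tails in the second
  variable; exchanging the factors controls tails in the first and uses p > 2. Only a finite block
  of entries is left, and it converges entrywise.\<close>

instantiation "fun" :: (type, real_vector) real_vector
begin

definition "scaleR r f = (\<lambda>x. r *\<^sub>R f x)"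

instance
  by standard (simp_all add: scaleR_fun_def fun_eq_iff scaleR_add_right scaleR_add_left)

end

lemma scaleR_fun_apply [simp]: "(r *\<^sub>R f) x = r *\<^sub>R f x"
  by (simp add: scaleR_fun_def)

definition sublinear_on :: "'v::real_vector set \<Rightarrow> ('v \<Rightarrow> real) \<Rightarrow> bool" where
  "sublinear_on S g \<longleftrightarrow>
     (\<forall>u\<in>S. \<forall>v\<in>S. g (u + v) \<le> g u + g v) \<and> (\<forall>r\<ge>0. \<forall>u\<in>S. g (r *\<^sub>R u) = r * g u)"

lemma sublinear_on_0:
  assumes "subspace S" "sublinear_on S g"
  shows "g 0 = 0"
proof -
  have "g (0 *\<^sub>R 0) = 0 * g 0"
    using assms subspace_0 unfolding sublinear_on_def by blast
  then show ?thesis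
    by simp
qed

lemma sublinear_on_minus:
  assumes "subspace S" "sublinear_on S g" "u \<in> S"
  shows "- g (- u) \<le> g u"
proof -
  have "g (u + - u) \<le> g u + g (- u)"
    using assms subspace_neg unfolding sublinear_on_def by blast
  then show ?thesis
    using sublinear_on_0[OF assms(1,2)] by simp
qed

text \<open>The infimum over the ray in direction \<open>v\<close> lowers \<open>g\<close> until it
  is linear along \<open>v\<close>. The parameter 0 shows that it does not exceed \<open>g\<close>;
  the parameter 1 gives the last inequality, which at \<open>- v\<close> forces the value down to
  \<open>- g v\<close>. Homogeneity allows the ray parameter to be rescaled.\<close>

lemma sublinear_on_shift:
  assumes S: "subspace S" and g: "sublinear_on S g" and v: "v \<in> S"
  obtains g' where "sublinear_on S g'" "\<And>u. u \<in> S \<Longrightarrow> g' u \<le> g u"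
    "\<And>u. u \<in> S \<Longrightarrow> g' u \<le> g (u + v) - g v"
proof
  define g' where "g' = (\<lambda>u. INF t\<in>{0..}. g (u + t *\<^sub>R v) - t * g v)"
  have sub: "g (x + y) \<le> g x + g y" if "x \<in> S" "y \<in> S" for x y
    using g that by (auto simp: sublinear_on_def)
  have hom: "g (r *\<^sub>R x) = r * g x" if "x \<in> S" "0 \<le> r" for x r
    using g that by (auto simp: sublinear_on_def)
  have mem: "x + t *\<^sub>R v \<in> S" if "x \<in> S" for x t
    using S v that by (simp add: subspace_add subspace_scale)
  have bdd: "bdd_below ((\<lambda>t. g (u + t *\<^sub>R v) - t * g v) ` {0..})" if u: "u \<in> S" for u
  proof (rule bdd_belowI2)
    fix t :: real assume "t \<in> {0..}"
    then have "t * g v = g (t *\<^sub>R v)"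
      using hom v by simp
    also have "\<dots> \<le> g (u + t *\<^sub>R v) + g (- u)"
      using sub[OF mem[OF u, of t], of "- u"] subspace_neg[OF S u] by simp
    finally show "- g (- u) \<le> g (u + t *\<^sub>R v) - t * g v"
      by simp
  qed
  have le: "g' u \<le> g (u + t *\<^sub>R v) - t * g v" if "u \<in> S" "0 \<le> t" for u t
    unfolding g'_def by (rule cINF_lower[OF bdd[OF that(1)]]) (use that in auto)
  show "g' u \<le> g u" if "u \<in> S" for u
    using le[OF that, of 0] by simp
  show "g' u \<le> g (u + v) - g v" if "u \<in> S" for u
    using le[OF that, of 1] by simp
  have add: "g' (x + y) \<le> g' x + g' y" if x: "x \<in> S" and y: "y \<in> S" for x y
  proof -
    have "g' (x + y) - (g (x + s *\<^sub>R v) - s * g v) \<le> g (y + t *\<^sub>R v) - t * g v"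
      if "0 \<le> s" "0 \<le> t" for s t
    proof -
      have "g' (x + y) \<le> g ((x + y) + (s + t) *\<^sub>R v) - (s + t) * g v"
        using le[of "x + y" "s + t"] x y S that by (simp add: subspace_add)
      also have "(x + y) + (s + t) *\<^sub>R v = (x + s *\<^sub>R v) + (y + t *\<^sub>R v)"
        by (simp add: scaleR_add_left)
      also have "g \<dots> \<le> g (x + s *\<^sub>R v) + g (y + t *\<^sub>R v)"
        by (rule sub[OF mem[OF x] mem[OF y]])
      finally show ?thesis
        by (simp add: algebra_simps)
    qed
    then have "g' (x + y) - (g (x + s *\<^sub>R v) - s * g v) \<le> g' y" if "0 \<le> s" for s
      unfolding g'_def[THEN fun_cong, of y] using that by (intro cINF_greatest) auto
    then have "g' (x + y) - g' y \<le> g (x + s *\<^sub>R v) - s * g v" if "0 \<le> s" for s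
      using that by (simp add: algebra_simps)
    then have "g' (x + y) - g' y \<le> g' x"
      unfolding g'_def[THEN fun_cong, of x] by (intro cINF_greatest) auto
    then show ?thesis
      by simp
  qed
  have le_hom: "g' (r *\<^sub>R x) \<le> r * g' x" if x: "x \<in> S" and r: "0 < r" for x r
  proof -
    have "g' (r *\<^sub>R x) / r \<le> g (x + t *\<^sub>R v) - t * g v" if t: "0 \<le> t" for t
    proof -
      have "g' (r *\<^sub>R x) \<le> g (r *\<^sub>R x + (r * t) *\<^sub>R v) - (r * t) * g v"
        using le[of "r *\<^sub>R x" "r * t"] S x r t by (simp add: subspace_scale)
      also have "r *\<^sub>R x + (r * t) *\<^sub>R v = r *\<^sub>R (x + t *\<^sub>R v)"
        by (simp add: scaleR_add_right)
      also have "g \<dots> = r * g (x + t *\<^sub>R v)"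
        using hom[OF mem[OF x]] r by simp
      finally show ?thesis
        using r by (simp add: field_simps)
    qed
    then have "g' (r *\<^sub>R x) / r \<le> g' x"
      unfolding g'_def[THEN fun_cong, of x] by (intro cINF_greatest) auto
    then show ?thesis
      using r by (simp add: field_simps)
  qed
  have "g' (r *\<^sub>R x) = r * g' x" if x: "x \<in> S" and "0 < r" for x r
  proof (rule antisym)
    show "g' (r *\<^sub>R x) \<le> r * g' x"
      by (rule le_hom[OF that])
    have "g' (inverse r *\<^sub>R r *\<^sub>R x) \<le> inverse r * g' (r *\<^sub>R x)"
      using S that by (intro le_hom) (auto simp: subspace_scale)
    then show "r * g' x \<le> g' (r *\<^sub>R x)"
      using \<open>0 < r\<close> by (simp add: field_simps)
  qed
  moreover have "(\<lambda>t. g (0 + t *\<^sub>R v) - t * g v) ` {0..} = {0}"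
    using hom[OF v] by (auto simp: image_def)
  then have "g' 0 = 0"
    by (simp add: g'_def)
  ultimately show "sublinear_on S g'"
    unfolding sublinear_on_def using add by (auto simp: le_less)
qed

text \<open>Zorn's lemma for the reversed pointwise order: a chain is bounded by its pointwise
  infimum, which is finite because every sublinear functional below \<open>p\<close> is at least
  \<open>- p (- u)\<close> at \<open>u\<close>.\<close>

lemma minimal_sublinear:
  assumes S: "subspace S" and p: "sublinear_on S p"
  obtains m where "sublinear_on S m" "\<And>u. u \<in> S \<Longrightarrow> m u \<le> p u"
    "\<And>g u. sublinear_on S g \<Longrightarrow> (\<And>u. u \<in> S \<Longrightarrow> g u \<le> m u) \<Longrightarrow> u \<in> S \<Longrightarrow> g u = m u"
proof -
  \<comment> \<open>Total functions have values off \<open>S\<close> too; fixing them at 0 keeps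
    chains bounded below there and lets minimality concern \<open>S\<close> alone.\<close>
  define A where "A = {g. sublinear_on S g \<and> (\<forall>u\<in>S. g u \<le> p u) \<and> (\<forall>u. u \<notin> S \<longrightarrow> g u = 0)}"
  define P where "P = (\<lambda>g h :: 'a \<Rightarrow> real. \<forall>u. h u \<le> g u)"
  define restr where "restr = (\<lambda>g u. if u \<in> S then g u else 0 :: real)"
  have restr: "restr g \<in> A" if "sublinear_on S g" "\<And>u. u \<in> S \<Longrightarrow> g u \<le> p u" for g
    using that S unfolding A_def restr_def sublinear_on_def
    by (auto simp: subspace_add subspace_scale)
  have "\<exists>m\<in>A. \<forall>g\<in>A. P m g \<longrightarrow> g = m"
  proof (rule predicate_Zorn)
    show "partial_order_on A (relation_of P A)"
    proof (rule partial_order_on_relation_ofI)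
      show "P f h" if "P f g" "P g h" for f g h
        unfolding P_def
      proof
        fix u show "h u \<le> f u"
          using that[unfolded P_def, THEN spec, of u] by linarith
      qed
      show "f = g" if "P f g" "P g f" for f g
        using that by (simp add: P_def fun_eq_iff eq_iff)
    qed (simp add: P_def)
  next
    fix C assume C: "C \<in> Chains (relation_of P A)"
    then have CA: "C \<subseteq> A"
      by (auto simp: Chains_def relation_of_def)
    show "\<exists>h\<in>A. \<forall>g\<in>C. P g h"
    proof (cases "C = {}")
      case True
      then show ?thesis
        using restr[OF p] by auto
    next
      case False
      define h where "h = (\<lambda>u. INF g\<in>C. g u)"
      have sub: "g (x + y) \<le> g x + g y" if "g \<in> C" "x \<in> S" "y \<in> S" for g x y
        using CA that by (auto simp: A_def sublinear_on_def)
      have hom: "g (r *\<^sub>R x) = r * g x" if "g \<in> C" "x \<in> S" "0 \<le> r" for g x r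
        using CA that by (auto simp: A_def sublinear_on_def)
      have bdd: "bdd_below ((\<lambda>g. g u) ` C)" for u
      proof (rule bdd_belowI2)
        fix g assume g: "g \<in> C"
        show "(if u \<in> S then - p (- u) else 0) \<le> g u"
        proof (cases "u \<in> S")
          case True
          have "sublinear_on S g" and "g (- u) \<le> p (- u)"
            using CA g subspace_neg[OF S True] by (auto simp: A_def)
          then show ?thesis
            using sublinear_on_minus[OF S _ True, of g] True by simp
        qed (use CA g in \<open>auto simp: A_def\<close>)
      qed
      have le: "h u \<le> g u" if "g \<in> C" for g u
        unfolding h_def by (rule cINF_lower[OF bdd that])
      have add: "h (x + y) \<le> h x + h y" if x: "x \<in> S" and y: "y \<in> S" for x y
      proof -
        have "h (x + y) - g1 x \<le> g2 y" if g: "g1 \<in> C" "g2 \<in> C" for g1 g2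
        proof -
          \<comment> \<open>The smaller of two members of the chain serves for both points, which
            makes the infimum subadditive.\<close>
          have "P g1 g2 \<or> P g2 g1"
            using C g by (auto simp: Chains_def relation_of_def)
          then obtain g where "g \<in> C" "g x \<le> g1 x" "g y \<le> g2 y"
            using g by (auto simp: P_def)
          then show ?thesis
            using le[of g "x + y"] sub[of g x y] x y by simp
        qed
        then have "h (x + y) - g1 x \<le> h y" if "g1 \<in> C" for g1
          unfolding h_def[THEN fun_cong, of y] using that False by (intro cINF_greatest) auto
        then have "h (x + y) - h y \<le> g1 x" if "g1 \<in> C" for g1
          using that by (simp add: algebra_simps)
        then have "h (x + y) - h y \<le> h x"
          unfolding h_def[THEN fun_cong, of x] using False by (intro cINF_greatest) auto
        then show ?thesis
          by simp
      qed
      have hom_h: "h (r *\<^sub>R x) = r * h x" if x: "x \<in> S" and r: "0 \<le> r" for x r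
      proof (cases "r = 0")
        case True
        have "g 0 = 0" if "g \<in> C" for g
          using hom[OF that x, of 0] by simp
        then have "(\<lambda>g. g 0) ` C = {0}"
          using False by force
        then show ?thesis
          using True by (simp add: h_def)
      next
        case r0: False
        show ?thesis
        proof (rule antisym)
          have "h (r *\<^sub>R x) / r \<le> g x" if "g \<in> C" for g
            using le[OF that, of "r *\<^sub>R x"] hom[OF that x r] r r0 by (simp add: field_simps)
          then have "h (r *\<^sub>R x) / r \<le> h x"
            unfolding h_def[THEN fun_cong, of x] using False by (intro cINF_greatest) auto
          then show "h (r *\<^sub>R x) \<le> r * h x"
            using r r0 by (simp add: field_simps)
          show "r * h x \<le> h (r *\<^sub>R x)"
            unfolding h_def[THEN fun_cong, of "r *\<^sub>R x"] using False
          proof (rule cINF_greatest)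
            fix g assume "g \<in> C"
            then show "r * h x \<le> g (r *\<^sub>R x)"
              using le[of g x] hom[of g x r] x r by (simp add: mult_left_mono)
          qed
        qed
      qed
      obtain g0 where g0: "g0 \<in> C"
        using False by blast
      have "h u \<le> p u" if "u \<in> S" for u
        using le[OF g0, of u] g0 CA that by (fastforce simp: A_def)
      moreover have "h u = 0" if "u \<notin> S" for u
      proof -
        have "g u = 0" if "g \<in> C" for g
          using CA that \<open>u \<notin> S\<close> by (auto simp: A_def)
        then have "(\<lambda>g. g u) ` C = {0}"
          using False by force
        then show ?thesis
          by (simp add: h_def)
      qed
      ultimately have "h \<in> A"
        unfolding A_def sublinear_on_def using add hom_h by auto
      then show ?thesis
        using le by (auto simp: P_def)
    qed
  qed
  then obtain m where m: "m \<in> A" and min: "\<And>g. g \<in> A \<Longrightarrow> P m g \<Longrightarrow> g = m"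
    by blast
  show ?thesis
  proof
    show "sublinear_on S m" and "\<And>u. u \<in> S \<Longrightarrow> m u \<le> p u"
      using m by (auto simp: A_def)
    fix g u assume g: "sublinear_on S g" "\<And>u. u \<in> S \<Longrightarrow> g u \<le> m u" and u: "u \<in> S"
    have "g u \<le> p u" if "u \<in> S" for u
    proof -
      have "m u \<le> p u"
        using m that by (simp add: A_def)
      then show ?thesis
        using g(2)[OF that] by linarith
    qed
    then have "restr g \<in> A"
      by (rule restr[OF g(1)])
    moreover have "P m (restr g)"
      using g m by (auto simp: P_def restr_def A_def)
    ultimately have "restr g = m"
      by (rule min)
    then show "g u = m u"
      using u by (auto simp: restr_def)
  qed
qed

text \<open>A minimal sublinear functional does not decrease under \<open>sublinear_on_shift\<close>, which makes it
  additive.\<close>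

theorem Hahn_Banach_sublinear:
  assumes S: "subspace S" and p: "sublinear_on S p" and w: "w \<in> S"
  obtains f where "\<And>u v. u \<in> S \<Longrightarrow> v \<in> S \<Longrightarrow> f (u + v) = f u + f v"
    "\<And>r u. u \<in> S \<Longrightarrow> f (r *\<^sub>R u) = r * f u"
    "\<And>u. u \<in> S \<Longrightarrow> f u \<le> p u" "f w = p w"
proof -
  \<comment> \<open>Lowering \<open>p\<close> along \<open>w\<close> first gives
    \<open>p' (- w) \<le> - p w\<close>, so that a linear functional below \<open>p'\<close> has
    value at least \<open>p w\<close> at \<open>w\<close>.\<close>
  obtain p' where p': "sublinear_on S p'" "\<And>u. u \<in> S \<Longrightarrow> p' u \<le> p u"
      and p'w: "\<And>u. u \<in> S \<Longrightarrow> p' u \<le> p (u + w) - p w"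
    using sublinear_on_shift[OF S p w] by blast
  obtain m where m: "sublinear_on S m" and mp': "\<And>u. u \<in> S \<Longrightarrow> m u \<le> p' u"
      and min: "\<And>g u. sublinear_on S g \<Longrightarrow> (\<And>u. u \<in> S \<Longrightarrow> g u \<le> m u) \<Longrightarrow> u \<in> S \<Longrightarrow> g u = m u"
    by (rule minimal_sublinear[OF S p'(1)]) (assumption | rule refl | blast)+
  have add: "m (u + v) = m u + m v" if u: "u \<in> S" and v: "v \<in> S" for u v
  proof (rule antisym)
    show "m (u + v) \<le> m u + m v"
      using m u v by (auto simp: sublinear_on_def)
    obtain g where g: "sublinear_on S g" "\<And>u. u \<in> S \<Longrightarrow> g u \<le> m u"
        "\<And>u. u \<in> S \<Longrightarrow> g u \<le> m (u + v) - m v"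
      using sublinear_on_shift[OF S m v] by blast
    have "m u = g u"
      using min[OF g(1,2) u] by simp
    also have "\<dots> \<le> m (u + v) - m v"
      by (rule g(3)[OF u])
    finally show "m u + m v \<le> m (u + v)"
      by simp
  qed
  have m0: "m 0 = 0"
    by (rule sublinear_on_0[OF S m])
  have neg: "m (- u) = - m u" if "u \<in> S" for u
    using add[of u "- u"] subspace_neg[OF S that] that m0 by simp
  have hom: "m (r *\<^sub>R u) = r * m u" if u: "u \<in> S" for r u
  proof (cases "0 \<le> r")
    case False
    have "m (s *\<^sub>R u) = s * m u" if "0 \<le> s" for s
      using m u that unfolding sublinear_on_def by blast
    from this[of "- r"] False have "m ((- r) *\<^sub>R u) = - r * m u"
      by simp
    then show ?thesis
      using neg[of "r *\<^sub>R u"] S u by (simp add: subspace_scale)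
  qed (use m u in \<open>simp add: sublinear_on_def\<close>)
  show ?thesis
  proof
    show "m u \<le> p u" if "u \<in> S" for u
      using mp'[OF that] p'(2)[OF that] by simp
    have "- m w = m (- w)"
      using neg[OF w] by simp
    also have "\<dots> \<le> p (- w + w) - p w"
      using mp'[of "- w"] p'w[of "- w"] subspace_neg[OF S w] by simp
    finally have "p w \<le> m w"
      using sublinear_on_0[OF S p] by simp
    then show "m w = p w"
      using mp'[OF w] p'(2)[OF w] by simp
  qed (auto simp: add hom)
qed

section \<open>Strong subdifferentiability in a completion\<close>

text \<open>The real structure of the record is identified with that of the ambient type, which
  gives access to \<open>subspace\<close> and real scaling; difference quotients involve real
  multiples of directions only. A seminorm is the natural notion because the completion identifies
  points at distance zero.\<close>

locale seminormed_space =
  fixes V :: "('k::real_normed_field, 'v::real_vector) nspace"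
  assumes subspace_points: "subspace (points V)"
    and vadd_eq: "vadd V u v = u + v"
    and smul_of_real: "smul V (of_real r) u = r *\<^sub>R u"
    and nrm_triangle: "u \<in> points V \<Longrightarrow> v \<in> points V \<Longrightarrow> nrm V (u + v) \<le> nrm V u + nrm V v"
    and nrm_scaleR: "u \<in> points V \<Longrightarrow> nrm V (r *\<^sub>R u) = \<bar>r\<bar> * nrm V u"
begin

lemma sublinear_on_nrm: "sublinear_on (points V) (nrm V)"
  by (simp add: sublinear_on_def nrm_triangle nrm_scaleR)

lemma nrm_nonneg:
  assumes "u \<in> points V"
  shows "0 \<le> nrm V u"
  using sublinear_on_minus[OF subspace_points sublinear_on_nrm assms]
    nrm_scaleR[OF assms, of "- 1"] by simp

lemma vdist_eq: "vdist V u v = nrm V (u - v)"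
  using smul_of_real[of "- 1" v] by (simp add: vdist_def vadd_eq)

lemma nrm_minus_commute:
  assumes "u \<in> points V" "v \<in> points V"
  shows "nrm V (u - v) = nrm V (v - u)"
  using nrm_scaleR[OF subspace_diff[OF subspace_points assms], of "- 1"] by simp

lemma nrm_diff_triangle:
  assumes "u \<in> points V" "v \<in> points V" "w \<in> points V"
  shows "nrm V (u - w) \<le> nrm V (u - v) + nrm V (v - w)"
  using nrm_triangle[of "u - v" "v - w"] assms by (simp add: subspace_diff subspace_points)

lemma nrm_diff_bound:
  assumes "u \<in> points V" "v \<in> points V"
  shows "\<bar>nrm V u - nrm V v\<bar> \<le> nrm V (u - v)"
  using nrm_triangle[of "u - v" v] nrm_triangle[of "v - u" u] assms nrm_minus_commute[OF assms]
  by (simp add: subspace_diff subspace_points)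

lemma cauchy_seqs_iff:
  "s \<in> cauchy_seqs V \<longleftrightarrow>
     (\<forall>n. s n \<in> points V) \<and> (\<forall>e>0. \<exists>N. \<forall>m\<ge>N. \<forall>n\<ge>N. nrm V (s m - s n) < e)"
  by (auto simp: cauchy_seqs_def vdist_eq)

lemma cauchy_seqs_points: "s \<in> cauchy_seqs V \<Longrightarrow> s n \<in> points V"
  by (simp add: cauchy_seqs_iff)

lemma cauchy_seqs_const: "u \<in> points V \<Longrightarrow> (\<lambda>n. u) \<in> cauchy_seqs V"
  using nrm_scaleR[OF subspace_0[OF subspace_points], of 0] by (simp add: cauchy_seqs_iff)

lemma points_add_scaleR: "u \<in> points V \<Longrightarrow> v \<in> points V \<Longrightarrow> u + r *\<^sub>R v \<in> points V"
  by (simp add: subspace_points subspace_add subspace_scale)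

lemma nrm_add_scaleR_le:
  assumes "u \<in> points V" "v \<in> points V"
  shows "nrm V (u + r *\<^sub>R v) \<le> nrm V u + \<bar>r\<bar> * nrm V v"
  using nrm_triangle[of u "r *\<^sub>R v"] assms
  by (simp add: nrm_scaleR subspace_points subspace_scale)

lemma cauchy_seqs_add_scaleR:
  assumes s: "s \<in> cauchy_seqs V" and t: "t \<in> cauchy_seqs V"
  shows "(\<lambda>n. s n + r *\<^sub>R t n) \<in> cauchy_seqs V"
proof -
  have "\<exists>N. \<forall>m\<ge>N. \<forall>n\<ge>N. nrm V ((s m + r *\<^sub>R t m) - (s n + r *\<^sub>R t n)) < e" if "0 < e" for e
  proof -
    obtain N1 where N1: "\<And>m n. N1 \<le> m \<Longrightarrow> N1 \<le> n \<Longrightarrow> nrm V (s m - s n) < e / 2"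
      using s \<open>0 < e\<close> unfolding cauchy_seqs_iff by (meson half_gt_zero)
    have "0 < e / (2 * (\<bar>r\<bar> + 1))"
      using \<open>0 < e\<close> by simp
    then obtain N2 where N2: "\<And>m n. N2 \<le> m \<Longrightarrow> N2 \<le> n \<Longrightarrow> nrm V (t m - t n) < e / (2 * (\<bar>r\<bar> + 1))"
      using t unfolding cauchy_seqs_iff by meson
    have "nrm V ((s m + r *\<^sub>R t m) - (s n + r *\<^sub>R t n)) < e"
      if "max N1 N2 \<le> m" "max N1 N2 \<le> n" for m n
    proof -
      have pts: "s m - s n \<in> points V" "t m - t n \<in> points V"
        using s t by (simp_all add: cauchy_seqs_points subspace_diff subspace_points)
      have eq: "(s m + r *\<^sub>R t m) - (s n + r *\<^sub>R t n) = (s m - s n) + r *\<^sub>R (t m - t n)"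
        by (simp add: scaleR_diff_right)
      have "\<bar>r\<bar> * nrm V (t m - t n) \<le> (\<bar>r\<bar> + 1) * (e / (2 * (\<bar>r\<bar> + 1)))"
        using N2[of m n] that nrm_nonneg[OF pts(2)] by (intro mult_mono) auto
      moreover have "(\<bar>r\<bar> + 1) * (e / (2 * (\<bar>r\<bar> + 1))) = e / 2"
        using abs_ge_zero[of r] by (simp add: field_simps)
      ultimately show ?thesis
        unfolding eq using nrm_add_scaleR_le[OF pts, of r] N1[of m n] that by simp
    qed
    then show ?thesis
      by blast
  qed
  then show ?thesis
    using s t by (auto simp: cauchy_seqs_iff points_add_scaleR)
qed

definition lim_nrm :: "(nat \<Rightarrow> 'v) \<Rightarrow> real" where
  "lim_nrm s = lim (\<lambda>n. nrm V (s n))"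

lemma tendsto_lim_nrm:
  assumes "s \<in> cauchy_seqs V"
  shows "(\<lambda>n. nrm V (s n)) \<longlonglongrightarrow> lim_nrm s"
proof -
  have "Cauchy (\<lambda>n. nrm V (s n))"
    unfolding Cauchy_def dist_real_def
  proof (intro allI impI)
    fix e :: real assume "0 < e"
    then obtain N where "\<And>m n. N \<le> m \<Longrightarrow> N \<le> n \<Longrightarrow> nrm V (s m - s n) < e"
      using assms unfolding cauchy_seqs_iff by meson
    moreover have "\<bar>nrm V (s m) - nrm V (s n)\<bar> \<le> nrm V (s m - s n)" for m n
      using assms by (intro nrm_diff_bound cauchy_seqs_points)
    ultimately show "\<exists>N. \<forall>m\<ge>N. \<forall>n\<ge>N. \<bar>nrm V (s m) - nrm V (s n)\<bar> < e"
      by (meson order.strict_trans1)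
  qed
  then show ?thesis
    unfolding lim_nrm_def by (simp add: Cauchy_convergent convergent_LIMSEQ_iff[symmetric])
qed

lemma lim_nrm_eqI:
  assumes "\<And>n. n \<ge> m \<Longrightarrow> nrm V (s n) = c"
  shows "lim_nrm s = c"
proof -
  have "\<forall>\<^sub>F n in sequentially. c = nrm V (s n)"
    using assms by (auto simp: eventually_sequentially)
  then have "(\<lambda>n. nrm V (s n)) \<longlonglongrightarrow> c"
    by (rule Lim_transform_eventually[OF tendsto_const])
  then show ?thesis
    unfolding lim_nrm_def by (rule limI)
qed

lemma cauchy_rel_iff:
  "(s, t) \<in> cauchy_rel V \<longleftrightarrow>
     s \<in> cauchy_seqs V \<and> t \<in> cauchy_seqs V \<and> (\<lambda>n. nrm V (s n - t n)) \<longlonglongrightarrow> 0"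
  by (simp add: cauchy_rel_def vdist_eq)

lemma equiv_cauchy_rel: "equiv (cauchy_seqs V) (cauchy_rel V)"
proof (rule equivI)
  show "cauchy_rel V \<subseteq> cauchy_seqs V \<times> cauchy_seqs V"
    by (auto simp: cauchy_rel_iff)
  show "refl_on (cauchy_seqs V) (cauchy_rel V)"
    using nrm_scaleR[OF subspace_0[OF subspace_points], of 0]
    by (auto simp: refl_on_def cauchy_rel_iff)
  show "sym (cauchy_rel V)"
    unfolding sym_def cauchy_rel_iff using nrm_minus_commute cauchy_seqs_points by simp
  show "trans (cauchy_rel V)"
    unfolding trans_def cauchy_rel_iff
  proof (intro allI impI, elim conjE, intro conjI)
    fix r s t
    assume r: "r \<in> cauchy_seqs V" and s: "s \<in> cauchy_seqs V" and t: "t \<in> cauchy_seqs V"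
      and rs: "(\<lambda>n. nrm V (r n - s n)) \<longlonglongrightarrow> 0" and st: "(\<lambda>n. nrm V (s n - t n)) \<longlonglongrightarrow> 0"
    have "(\<lambda>n. nrm V (r n - s n) + nrm V (s n - t n)) \<longlonglongrightarrow> 0"
      using tendsto_add[OF rs st] by simp
    then show "(\<lambda>n. nrm V (r n - t n)) \<longlonglongrightarrow> 0"
    proof (rule tendsto_sandwich[OF _ _ tendsto_const, rotated 2])
      show "\<forall>\<^sub>F n in sequentially. 0 \<le> nrm V (r n - t n)"
        using r t by (simp add: cauchy_seqs_points nrm_nonneg subspace_diff subspace_points)
      show "\<forall>\<^sub>F n in sequentially. nrm V (r n - t n) \<le> nrm V (r n - s n) + nrm V (s n - t n)"
        using r s t by (simp add: cauchy_seqs_points nrm_diff_triangle)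
    qed
  qed
qed

abbreviation cauchy_class :: "(nat \<Rightarrow> 'v) \<Rightarrow> (nat \<Rightarrow> 'v) set" where
  "cauchy_class s \<equiv> cauchy_rel V `` {s}"

lemma points_completion: "points (completion V) = cauchy_class ` cauchy_seqs V"
  by (auto simp: completion_def quotient_def)

lemma cauchy_class_self: "s \<in> cauchy_seqs V \<Longrightarrow> s \<in> cauchy_class s"
  by (rule equiv_class_self[OF equiv_cauchy_rel])

lemma cauchy_class_sym: "t \<in> cauchy_class s \<Longrightarrow> (t, s) \<in> cauchy_rel V"
  using equiv_cauchy_rel unfolding equiv_def sym_def by blast

lemma cauchy_class_eqI: "(s, t) \<in> cauchy_rel V \<Longrightarrow> cauchy_class s = cauchy_class t"
  by (rule equiv_class_eq[OF equiv_cauchy_rel])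

lemma lim_nrm_cong:
  assumes st: "(s, t) \<in> cauchy_rel V"
  shows "lim_nrm s = lim_nrm t"
proof -
  have s: "s \<in> cauchy_seqs V" and t: "t \<in> cauchy_seqs V"
      and d: "(\<lambda>n. nrm V (s n - t n)) \<longlonglongrightarrow> 0"
    using st by (auto simp: cauchy_rel_iff)
  have "(\<lambda>n. nrm V (s n) - nrm V (t n)) \<longlonglongrightarrow> 0"
  proof (rule Lim_null_comparison[OF _ d])
    show "\<forall>\<^sub>F n in sequentially. norm (nrm V (s n) - nrm V (t n)) \<le> nrm V (s n - t n)"
      using s t by (simp add: cauchy_seqs_points nrm_diff_bound)
  qed
  moreover have "(\<lambda>n. nrm V (s n) - nrm V (t n)) \<longlonglongrightarrow> lim_nrm s - lim_nrm t"
    using s t by (intro tendsto_diff tendsto_lim_nrm)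
  ultimately show ?thesis
    using LIMSEQ_unique by fastforce
qed

lemma nrm_cauchy_class:
  assumes "s \<in> cauchy_seqs V"
  shows "nrm (completion V) (cauchy_class s) = lim_nrm s"
proof -
  have "(\<lambda>s. lim (\<lambda>n. nrm V (s n))) ` cauchy_class s = {lim_nrm s}"
    unfolding lim_nrm_def[symmetric]
  proof (intro subset_antisym subsetI)
    fix c assume "c \<in> lim_nrm ` cauchy_class s"
    then obtain t where "(s, t) \<in> cauchy_rel V" "c = lim_nrm t"
      by blast
    then show "c \<in> {lim_nrm s}"
      using lim_nrm_cong by simp
  next
    fix c assume "c \<in> {lim_nrm s}"
    then show "c \<in> lim_nrm ` cauchy_class s"
      using cauchy_class_self[OF assms] by blast
  qed
  then show ?thesis
    by (simp add: completion_def)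
qed

text \<open>One statement covers both operations on classes: sums are the case \<open>r = 1\<close>,
  multiples the case where the first sequence is zero.\<close>

lemma cauchy_rel_add_scaleR:
  assumes "(s, s') \<in> cauchy_rel V" "(t, t') \<in> cauchy_rel V"
  shows "((\<lambda>n. s n + r *\<^sub>R t n), (\<lambda>n. s' n + r *\<^sub>R t' n)) \<in> cauchy_rel V"
proof -
  have s: "s \<in> cauchy_seqs V" "s' \<in> cauchy_seqs V" and ds: "(\<lambda>n. nrm V (s n - s' n)) \<longlonglongrightarrow> 0"
    and t: "t \<in> cauchy_seqs V" "t' \<in> cauchy_seqs V" and dt: "(\<lambda>n. nrm V (t n - t' n)) \<longlonglongrightarrow> 0"
    using assms by (auto simp: cauchy_rel_iff)
  have lim: "(\<lambda>n. nrm V (s n - s' n) + \<bar>r\<bar> * nrm V (t n - t' n)) \<longlonglongrightarrow> 0"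
    using tendsto_add[OF ds tendsto_mult_left[OF dt, of "\<bar>r\<bar>"]] by simp
  have le: "norm (nrm V ((s n + r *\<^sub>R t n) - (s' n + r *\<^sub>R t' n)))
      \<le> nrm V (s n - s' n) + \<bar>r\<bar> * nrm V (t n - t' n)" for n
  proof -
    have pts: "s n - s' n \<in> points V" "t n - t' n \<in> points V"
      using s t by (simp_all add: cauchy_seqs_points subspace_diff subspace_points)
    have eq: "(s n + r *\<^sub>R t n) - (s' n + r *\<^sub>R t' n) = (s n - s' n) + r *\<^sub>R (t n - t' n)"
      by (simp add: scaleR_diff_right)
    show ?thesis
      unfolding eq
      using nrm_add_scaleR_le[OF pts, of r] nrm_nonneg[OF points_add_scaleR[OF pts, of r]] by simp
  qed
  have "(\<lambda>n. nrm V ((s n + r *\<^sub>R t n) - (s' n + r *\<^sub>R t' n))) \<longlonglongrightarrow> 0"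
    by (rule Lim_null_comparison[OF always_eventually lim]) (use le in blast)
  then show ?thesis
    using s t by (simp add: cauchy_rel_iff cauchy_seqs_add_scaleR)
qed

lemma smul_cauchy_class:
  assumes s: "s \<in> cauchy_seqs V"
  shows "smul (completion V) (of_real r) (cauchy_class s) = cauchy_class (\<lambda>n. r *\<^sub>R s n)"
proof -
  have zero: "(\<lambda>n. 0) \<in> cauchy_seqs V"
    by (simp add: cauchy_seqs_const subspace_0 subspace_points)
  have "cauchy_class (\<lambda>n. r *\<^sub>R t n) = cauchy_class (\<lambda>n. r *\<^sub>R s n)" if "t \<in> cauchy_class s" for t
  proof (rule cauchy_class_eqI)
    have "(t, s) \<in> cauchy_rel V"
      by (rule cauchy_class_sym[OF that])
    from cauchy_rel_add_scaleR[OF _ this, of "\<lambda>n. 0" "\<lambda>n. 0" r]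
    show "(\<lambda>n. r *\<^sub>R t n, \<lambda>n. r *\<^sub>R s n) \<in> cauchy_rel V"
      using cauchy_class_self[OF zero] by simp
  qed
  then have "(\<Union>t\<in>cauchy_class s. cauchy_class (\<lambda>n. r *\<^sub>R t n))
      = (\<Union>t\<in>cauchy_class s. cauchy_class (\<lambda>n. r *\<^sub>R s n))"
    by blast
  also have "\<dots> = cauchy_class (\<lambda>n. r *\<^sub>R s n)"
    using cauchy_class_self[OF s] by blast
  finally show ?thesis
    by (simp add: completion_def smul_of_real)
qed

lemma vadd_cauchy_class:
  assumes s: "s \<in> cauchy_seqs V" and t: "t \<in> cauchy_seqs V"
  shows "vadd (completion V) (cauchy_class s) (cauchy_class t) = cauchy_class (\<lambda>n. s n + t n)"
proof -
  have "cauchy_class (\<lambda>n. s' n + t' n) = cauchy_class (\<lambda>n. s n + t n)"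
    if "s' \<in> cauchy_class s" "t' \<in> cauchy_class t" for s' t'
  proof (rule cauchy_class_eqI)
    have "(s', s) \<in> cauchy_rel V" "(t', t) \<in> cauchy_rel V"
      using that cauchy_class_sym by blast+
    from cauchy_rel_add_scaleR[OF this, of 1]
    show "(\<lambda>n. s' n + t' n, \<lambda>n. s n + t n) \<in> cauchy_rel V"
      by simp
  qed
  then have "(\<Union>s'\<in>cauchy_class s. \<Union>t'\<in>cauchy_class t. cauchy_class (\<lambda>n. s' n + t' n))
      = (\<Union>s'\<in>cauchy_class s. \<Union>t'\<in>cauchy_class t. cauchy_class (\<lambda>n. s n + t n))"
    by blast
  also have "\<dots> = cauchy_class (\<lambda>n. s n + t n)"
    using cauchy_class_self[OF s] cauchy_class_self[OF t] by blast
  finally show ?thesis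
    by (simp add: completion_def vadd_eq)
qed

text \<open>Difference quotients depend only on the classes, so the uniform limit over the unit ball
  of the completion can be tested on representing sequences. The later arguments speak of Cauchy
  sequences only.\<close>

lemma ssd_at_cauchy_class_iff:
  assumes s: "s \<in> cauchy_seqs V"
  shows "ssd_at (completion V) (cauchy_class s) \<longleftrightarrow>
    (\<exists>L. \<forall>e>0. \<exists>d>0. \<forall>t. 0 < t \<and> t < d \<longrightarrow> (\<forall>h\<in>cauchy_seqs V. lim_nrm h \<le> 1 \<longrightarrow>
      \<bar>(lim_nrm (\<lambda>n. s n + t *\<^sub>R h n) - lim_nrm s) / t - L h\<bar> < e))" (is "?l \<longleftrightarrow> ?r")
proof
  have add: "vadd (completion V) (cauchy_class s) (smul (completion V) (of_real t) (cauchy_class h))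
      = cauchy_class (\<lambda>n. s n + t *\<^sub>R h n)" if h: "h \<in> cauchy_seqs V" for t h
  proof -
    have "(\<lambda>n. t *\<^sub>R h n) \<in> cauchy_seqs V"
      using cauchy_seqs_add_scaleR[OF cauchy_seqs_const[OF subspace_0[OF subspace_points]] h, of t]
      by simp
    then show ?thesis
      using h s by (simp add: smul_cauchy_class vadd_cauchy_class)
  qed
  define q where "q t h = (lim_nrm (\<lambda>n. s n + t *\<^sub>R h n) - lim_nrm s) / t" for t h
  have quot: "(nrm (completion V) (vadd (completion V) (cauchy_class s)
        (smul (completion V) (of_real t) (cauchy_class h))) - nrm (completion V) (cauchy_class s)) / t
      = q t h" if "h \<in> cauchy_seqs V" for t h
    using that s by (simp add: add nrm_cauchy_class cauchy_seqs_add_scaleR q_def)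
  { assume ?l
    then obtain L where L: "uniform_limit {h \<in> points (completion V). nrm (completion V) h \<le> 1}
       (\<lambda>t h. (nrm (completion V) (vadd (completion V) (cauchy_class s)
          (smul (completion V) (of_real t) h)) - nrm (completion V) (cauchy_class s)) / t) L (at_right 0)"
      unfolding ssd_at_def by blast
    show ?r
    proof (intro exI[of _ "\<lambda>h. L (cauchy_class h)"] allI impI)
      fix e :: real assume "0 < e"
      from uniform_limitD[OF L this] obtain d where "d > 0" and
        d: "\<And>t P. 0 < t \<Longrightarrow> t < d \<Longrightarrow> P \<in> points (completion V) \<Longrightarrow> nrm (completion V) P \<le> 1 \<Longrightarrow>
          dist ((nrm (completion V) (vadd (completion V) (cauchy_class s)
          (smul (completion V) (of_real t) P)) - nrm (completion V) (cauchy_class s)) / t) (L P) < e"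
        unfolding eventually_at_right_field by auto
      have "\<bar>q t h - L (cauchy_class h)\<bar> < e"
        if "0 < t" "t < d" "h \<in> cauchy_seqs V" "lim_nrm h \<le> 1" for t h
        using d[of t "cauchy_class h"] that quot[OF that(3)]
        by (simp add: points_completion nrm_cauchy_class dist_real_def)
      with \<open>d > 0\<close> show "\<exists>d>0. \<forall>t. 0 < t \<and> t < d \<longrightarrow> (\<forall>h\<in>cauchy_seqs V. lim_nrm h \<le> 1 \<longrightarrow>
          \<bar>(lim_nrm (\<lambda>n. s n + t *\<^sub>R h n) - lim_nrm s) / t - L (cauchy_class h)\<bar> < e)"
        unfolding q_def by blast
    qed
  }
  assume ?r
  then obtain L where L: "\<forall>e>0. \<exists>d>0. \<forall>t. 0 < t \<and> t < d \<longrightarrow> (\<forall>h\<in>cauchy_seqs V. lim_nrm h \<le> 1 \<longrightarrow>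
      \<bar>q t h - L h\<bar> < e)"
    unfolding q_def by blast
  \<comment> \<open>\<open>L\<close> is given on sequences and might depend on the representative;
    on classes its value is read off at a chosen one.\<close>
  define rep where "rep P = (SOME h. h \<in> cauchy_seqs V \<and> cauchy_class h = P)" for P
  have rep: "rep P \<in> cauchy_seqs V \<and> cauchy_class (rep P) = P" if "P \<in> points (completion V)" for P
  proof -
    from that obtain h where "P = cauchy_class h" "h \<in> cauchy_seqs V"
      unfolding points_completion by (rule imageE)
    then have "\<exists>h. h \<in> cauchy_seqs V \<and> cauchy_class h = P"
      by (intro exI[of _ h]) simp
    then show ?thesis
      unfolding rep_def by (rule someI_ex)
  qed
  show ?l
    unfolding ssd_at_def
  proof (intro exI uniform_limitI)
    fix e :: real assume "0 < e"
    with L have "\<exists>d>0. \<forall>t. 0 < t \<and> t < d \<longrightarrow> (\<forall>h\<in>cauchy_seqs V. lim_nrm h \<le> 1 \<longrightarrow>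
        \<bar>q t h - L h\<bar> < e)"
      by (elim allE[of _ e] impE)
    then obtain d where "d > 0" and d: "\<forall>t. 0 < t \<and> t < d \<longrightarrow> (\<forall>h\<in>cauchy_seqs V.
        lim_nrm h \<le> 1 \<longrightarrow> \<bar>q t h - L h\<bar> < e)"
      by (elim exE conjE)
    show "\<forall>\<^sub>F t in at_right 0. \<forall>P\<in>{P \<in> points (completion V). nrm (completion V) P \<le> 1}.
        dist ((nrm (completion V) (vadd (completion V) (cauchy_class s)
          (smul (completion V) (of_real t) P)) - nrm (completion V) (cauchy_class s)) / t)
          (L (rep P)) < e"
      unfolding eventually_at_right_field
    proof (intro exI[of _ d] conjI allI impI ballI)
      fix t P assume "0 < t" "t < d" and "P \<in> {P \<in> points (completion V). nrm (completion V) P \<le> 1}"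
      then have P: "P \<in> points (completion V)" "nrm (completion V) P \<le> 1"
        by auto
      from rep[OF P(1)] P(2) have h: "rep P \<in> cauchy_seqs V" "lim_nrm (rep P) \<le> 1"
        using nrm_cauchy_class[of "rep P"] by auto
      show "dist ((nrm (completion V) (vadd (completion V) (cauchy_class s)
          (smul (completion V) (of_real t) P)) - nrm (completion V) (cauchy_class s)) / t)
          (L (rep P)) < e"
        using d[rule_format, OF conjI[OF \<open>0 < t\<close> \<open>t < d\<close>] h] quot[OF h(1), of t] rep[OF P(1)] by (simp add: dist_real_def)
    qed (rule \<open>d > 0\<close>)
  qed
qed

end

section \<open>The projective norm\<close>

text \<open>The ball of radius \<open>C\<close> in the space of bounded bilinear forms, which is the
  dual of the projective tensor product.\<close>

definition forms_le ::
  "('k::real_normed_field, 'v) nspace \<Rightarrow> ('k, 'w) nspace \<Rightarrow> real \<Rightarrow> ('v \<Rightarrow> 'w \<Rightarrow> 'k) set" where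
  "forms_le X Y C = {B \<in> bilinear_forms X Y.
     \<forall>x\<in>points X. \<forall>y\<in>points Y. norm (B x y) \<le> C * (nrm X x * nrm Y y)}"

lemma sum_lessThan_add:
  fixes f :: "nat \<Rightarrow> 'a::comm_monoid_add"
  shows "(\<Sum>i<n + m. f i) = (\<Sum>i<n. f i) + (\<Sum>i<m. f (n + i))"
  by (induction m) (simp_all add: add.assoc)

lemma diff_bilinear_forms:
  assumes "B \<in> bilinear_forms X Y" "B' \<in> bilinear_forms X Y"
  shows "(\<lambda>x y. B x y - B' x y) \<in> bilinear_forms X Y"
  using assms unfolding bilinear_forms_def by (simp add: algebra_simps)

text \<open>Tensors are added by concatenating representations, which yields the triangle inequality
  of the projective norm by itself. The factors contribute positivity of the costs, and the first
  one absorbs the scalars.\<close>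

locale homogeneous_pair =
  fixes X :: "('k::real_normed_field, 'v) nspace" and Y :: "('k, 'w) nspace"
  assumes nrm_X_nonneg: "x \<in> points X \<Longrightarrow> 0 \<le> nrm X x"
    and nrm_Y_nonneg: "y \<in> points Y \<Longrightarrow> 0 \<le> nrm Y y"
    and smul_X: "x \<in> points X \<Longrightarrow> smul X a x \<in> points X"
    and nrm_smul_X: "x \<in> points X \<Longrightarrow> nrm X (smul X a x) = norm a * nrm X x"
begin

abbreviation T :: "('k, ('v \<Rightarrow> 'w \<Rightarrow> 'k) \<Rightarrow> 'k) nspace" where
  "T \<equiv> alg_proj_tensor X Y"

lemma points_T: "u \<in> points T \<longleftrightarrow> (\<exists>n x y. tensor_rep X Y n x y u)"
  by (simp add: alg_proj_tensor_def)

lemma tensor_rep_zero: "tensor_rep X Y 0 x y 0"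
  by (simp add: tensor_rep_def fun_eq_iff)

lemma tensor_rep_elem:
  "a \<in> points X \<Longrightarrow> b \<in> points Y \<Longrightarrow>
    tensor_rep X Y 1 (\<lambda>_. a) (\<lambda>_. b) (elem_tensor X Y a b)"
  by (simp add: tensor_rep_def)

lemma tensor_rep_add:
  assumes u: "tensor_rep X Y n x y u" and v: "tensor_rep X Y m x' y' v"
  obtains k x'' y'' where "tensor_rep X Y k x'' y'' (u + v)"
    "(\<Sum>i<k. nrm X (x'' i) * nrm Y (y'' i))
      = (\<Sum>i<n. nrm X (x i) * nrm Y (y i)) + (\<Sum>i<m. nrm X (x' i) * nrm Y (y' i))"
proof
  let ?x = "\<lambda>i. if i < n then x i else x' (i - n)"
  let ?y = "\<lambda>i. if i < n then y i else y' (i - n)"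
  show "tensor_rep X Y (n + m) ?x ?y (u + v)"
    using u v by (auto simp: tensor_rep_def fun_eq_iff sum_lessThan_add)
  show "(\<Sum>i<n + m. nrm X (?x i) * nrm Y (?y i))
      = (\<Sum>i<n. nrm X (x i) * nrm Y (y i)) + (\<Sum>i<m. nrm X (x' i) * nrm Y (y' i))"
    by (simp add: sum_lessThan_add)
qed

lemma elem_tensor_smul_left:
  "x \<in> points X \<Longrightarrow> y \<in> points Y \<Longrightarrow>
    elem_tensor X Y (smul X a x) y = (\<lambda>B. a * elem_tensor X Y x y B)"
  by (auto simp: elem_tensor_def bilinear_forms_def fun_eq_iff)

lemma tensor_rep_smul:
  assumes "tensor_rep X Y n x y u"
  shows "tensor_rep X Y n (\<lambda>i. smul X a (x i)) y (\<lambda>B. a * u B)"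
proof -
  have xy: "x i \<in> points X" "y i \<in> points Y" if "i < n" for i
    using assms that by (auto simp: tensor_rep_def)
  have "a * u B = (\<Sum>i<n. elem_tensor X Y (smul X a (x i)) (y i) B)" for B
    using assms xy by (simp add: tensor_rep_def elem_tensor_smul_left sum_distrib_left)
  then show ?thesis
    using xy by (auto simp: tensor_rep_def smul_X)
qed

definition costs :: "(('v \<Rightarrow> 'w \<Rightarrow> 'k) \<Rightarrow> 'k) \<Rightarrow> real set" where
  "costs u = {\<Sum>i<n. nrm X (x i) * nrm Y (y i) |n x y. tensor_rep X Y n x y u}"

lemma nrm_T: "nrm T u = Inf (costs u)"
  by (simp add: alg_proj_tensor_def costs_def)

lemma cost_nonneg:
  "tensor_rep X Y n x y u \<Longrightarrow> 0 \<le> (\<Sum>i<n. nrm X (x i) * nrm Y (y i))"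
  by (auto simp: tensor_rep_def intro!: sum_nonneg mult_nonneg_nonneg nrm_X_nonneg nrm_Y_nonneg)

lemma bdd_below_costs: "bdd_below (costs u)"
  by (rule bdd_belowI[of _ 0]) (auto simp: costs_def cost_nonneg)

lemma nrm_T_le:
  "tensor_rep X Y n x y u \<Longrightarrow> nrm T u \<le> (\<Sum>i<n. nrm X (x i) * nrm Y (y i))"
  unfolding nrm_T by (rule cInf_lower[OF _ bdd_below_costs]) (auto simp: costs_def)

lemma nrm_T_greatest:
  assumes "u \<in> points T"
    and "\<And>n x y. tensor_rep X Y n x y u \<Longrightarrow> c \<le> (\<Sum>i<n. nrm X (x i) * nrm Y (y i))"
  shows "c \<le> nrm T u"
  unfolding nrm_T using assms by (intro cInf_greatest) (auto simp: costs_def points_T)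

lemma nrm_T_elem_le:
  "a \<in> points X \<Longrightarrow> b \<in> points Y \<Longrightarrow> nrm T (elem_tensor X Y a b) \<le> nrm X a * nrm Y b"
  using nrm_T_le[OF tensor_rep_elem] by simp

lemma elem_tensor_points:
  "a \<in> points X \<Longrightarrow> b \<in> points Y \<Longrightarrow> elem_tensor X Y a b \<in> points T"
  unfolding points_T using tensor_rep_elem by blast

lemma zero_points_T: "0 \<in> points T"
  unfolding points_T using tensor_rep_zero by blast

lemma add_points_T: "u \<in> points T \<Longrightarrow> v \<in> points T \<Longrightarrow> u + v \<in> points T"
  unfolding points_T by (elim exE) (rule tensor_rep_add, assumption+, blast)

lemma smul_points_T: "u \<in> points T \<Longrightarrow> (\<lambda>B. a * u B) \<in> points T"
  unfolding points_T using tensor_rep_smul by blast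

lemma scaleR_eq_smul: "r *\<^sub>R u = (\<lambda>B. of_real r * u B :: 'k)"
  by (simp add: fun_eq_iff scaleR_conv_of_real)

lemma scaleR_points_T: "u \<in> points T \<Longrightarrow> r *\<^sub>R u \<in> points T"
  unfolding scaleR_eq_smul by (rule smul_points_T)

lemma subspace_T: "subspace (points T)"
  by (simp add: subspace_def zero_points_T add_points_T scaleR_points_T)

lemma nrm_T_nonneg: "u \<in> points T \<Longrightarrow> 0 \<le> nrm T u"
  by (intro nrm_T_greatest cost_nonneg)

lemma nrm_T_add:
  assumes u: "u \<in> points T" and v: "v \<in> points T"
  shows "nrm T (u + v) \<le> nrm T u + nrm T v"
proof -
  have "nrm T (u + v) - (\<Sum>i<n. nrm X (x i) * nrm Y (y i)) \<le> nrm T v"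
    if "tensor_rep X Y n x y u" for n x y
  proof (rule nrm_T_greatest[OF v])
    fix m x' y' assume "tensor_rep X Y m x' y' v"
    from tensor_rep_add[OF that this] obtain k x'' y'' where "tensor_rep X Y k x'' y'' (u + v)"
      "(\<Sum>i<k. nrm X (x'' i) * nrm Y (y'' i))
        = (\<Sum>i<n. nrm X (x i) * nrm Y (y i)) + (\<Sum>i<m. nrm X (x' i) * nrm Y (y' i))" .
    then show "nrm T (u + v) - (\<Sum>i<n. nrm X (x i) * nrm Y (y i)) \<le> (\<Sum>i<m. nrm X (x' i) * nrm Y (y' i))"
      using nrm_T_le by fastforce
  qed
  then have "nrm T (u + v) - nrm T v \<le> nrm T u"
    by (intro nrm_T_greatest[OF u]) (simp add: algebra_simps)
  then show ?thesis
    by simp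
qed

lemma nrm_T_smul_le:
  assumes u: "u \<in> points T" and a: "a \<noteq> 0"
  shows "nrm T (\<lambda>B. a * u B) \<le> norm a * nrm T u"
proof -
  have "nrm T (\<lambda>B. a * u B) / norm a \<le> nrm T u"
  proof (rule nrm_T_greatest[OF u])
    fix n x y assume r: "tensor_rep X Y n x y u"
    then have "nrm T (\<lambda>B. a * u B) \<le> (\<Sum>i<n. nrm X (smul X a (x i)) * nrm Y (y i))"
      by (intro nrm_T_le tensor_rep_smul)
    also have "\<dots> = norm a * (\<Sum>i<n. nrm X (x i) * nrm Y (y i))"
      using r by (simp add: tensor_rep_def nrm_smul_X sum_distrib_left mult.assoc)
    finally show "nrm T (\<lambda>B. a * u B) / norm a \<le> (\<Sum>i<n. nrm X (x i) * nrm Y (y i))"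
      using a by (simp add: field_simps)
  qed
  then show ?thesis
    using a by (simp add: field_simps)
qed

lemma nrm_T_zero: "nrm T 0 = 0"
  using nrm_T_le[OF tensor_rep_zero] nrm_T_nonneg[OF zero_points_T] by simp

lemma nrm_T_smul:
  assumes u: "u \<in> points T"
  shows "nrm T (\<lambda>B. a * u B) = norm a * nrm T u"
proof (cases "a = 0")
  case True
  then show ?thesis
    using nrm_T_zero by (simp add: zero_fun_def)
next
  case False
  have "nrm T (\<lambda>B. inverse a * (a * u B)) \<le> norm (inverse a) * nrm T (\<lambda>B. a * u B)"
    using False by (intro nrm_T_smul_le smul_points_T[OF u]) simp
  moreover have "(\<lambda>B. inverse a * (a * u B)) = u"
    using False by (simp add: fun_eq_iff mult.assoc[symmetric])
  ultimately have "nrm T u \<le> nrm T (\<lambda>B. a * u B) / norm a"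
    using False by (simp add: inverse_eq_divide norm_divide)
  then have "norm a * nrm T u \<le> nrm T (\<lambda>B. a * u B)"
    using False by (simp add: field_simps)
  then show ?thesis
    using nrm_T_smul_le[OF u False] by simp
qed

sublocale seminormed_space T
proof
  show "vadd T u v = u + v" for u v
    by (simp add: alg_proj_tensor_def fun_eq_iff)
  show "smul T (of_real r) u = r *\<^sub>R u" for r u
    by (simp add: alg_proj_tensor_def scaleR_eq_smul)
  show "nrm T (r *\<^sub>R u) = \<bar>r\<bar> * nrm T u" if "u \<in> points T" for r u
    unfolding scaleR_eq_smul using nrm_T_smul[OF that, of "of_real r"] by simp
qed (simp_all add: subspace_T nrm_T_add)

lemma point_eval:
  assumes "tensor_rep X Y n x y u" "B \<in> bilinear_forms X Y"
  shows "u B = (\<Sum>i<n. B (x i) (y i))"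
  using assms by (simp add: tensor_rep_def elem_tensor_def)

text \<open>The easy half of duality: each representation bounds \<open>norm (u B)\<close> by
  \<open>C\<close> times its cost, and the norm is the infimum of the costs.\<close>

lemma norm_point_le:
  assumes u: "u \<in> points T" and B: "B \<in> forms_le X Y C" and C: "0 \<le> C"
  shows "norm (u B) \<le> C * nrm T u"
\<comment> \<open>The bound 0 cannot be divided by; every summand vanishes in that case.\<close>
proof (cases "C = 0")
  case True
  obtain n x y where r: "tensor_rep X Y n x y u"
    using u by (auto simp: points_T)
  then have "norm (B (x i) (y i)) \<le> 0" if "i < n" for i
    using B that True by (auto simp: forms_le_def tensor_rep_def)
  then have "u B = 0"
    using point_eval[OF r] B by (simp add: forms_le_def)
  then show ?thesis
    using True by simp
next
  case False
  have "norm (u B) / C \<le> nrm T u"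
  proof (rule nrm_T_greatest[OF u])
    fix n x y assume r: "tensor_rep X Y n x y u"
    have "norm (u B) = norm (\<Sum>i<n. B (x i) (y i))"
      using point_eval[OF r] B by (simp add: forms_le_def)
    also have "\<dots> \<le> (\<Sum>i<n. C * (nrm X (x i) * nrm Y (y i)))"
      using r B by (intro sum_norm_le) (auto simp: tensor_rep_def forms_le_def)
    finally show "norm (u B) / C \<le> (\<Sum>i<n. nrm X (x i) * nrm Y (y i))"
      using False C by (simp add: sum_distrib_left[symmetric] field_simps)
  qed
  then show ?thesis
    using False C by (simp add: field_simps)
qed

text \<open>A tensor is a finite sum of evaluations, hence additive in the form. This is what
  compares two forms at one tensor.\<close>

lemma point_diff_form:
  assumes u: "u \<in> points T" and B: "B \<in> bilinear_forms X Y" "B' \<in> bilinear_forms X Y"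
  shows "u (\<lambda>x y. B x y - B' x y) = u B - u B'"
proof -
  obtain n x y where r: "tensor_rep X Y n x y u"
    using u by (auto simp: points_T)
  show ?thesis
    using point_eval[OF r] B diff_bilinear_forms[OF B] by (simp add: sum_subtractf)
qed

lemma elem_tensor_vadd_left:
  "x \<in> points X \<Longrightarrow> x' \<in> points X \<Longrightarrow> y \<in> points Y \<Longrightarrow>
    elem_tensor X Y (vadd X x x') y = elem_tensor X Y x y + elem_tensor X Y x' y"
  by (auto simp: elem_tensor_def bilinear_forms_def fun_eq_iff)

lemma elem_tensor_vadd_right:
  "x \<in> points X \<Longrightarrow> y \<in> points Y \<Longrightarrow> y' \<in> points Y \<Longrightarrow>
    elem_tensor X Y x (vadd Y y y') = elem_tensor X Y x y + elem_tensor X Y x y'"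
  by (auto simp: elem_tensor_def bilinear_forms_def fun_eq_iff)

lemma elem_tensor_smul_right:
  "x \<in> points X \<Longrightarrow> y \<in> points Y \<Longrightarrow>
    elem_tensor X Y x (smul Y a y) = (\<lambda>B. a * elem_tensor X Y x y B)"
  by (auto simp: elem_tensor_def bilinear_forms_def fun_eq_iff)

end

section \<open>Duality with bounded bilinear forms\<close>

text \<open>The real and the complex scalars are treated at once: \<open>J\<close> is \<open>0\<close> for the former and the
  imaginary unit for the latter, and \<open>1 \<bullet> z\<close> is the real part of \<open>z\<close>.\<close>

locale scalar_unit =
  fixes J :: "'k::{real_normed_field, euclidean_space}"
  assumes J_cases: "J = 0 \<or> J * J = - 1"
    and inner_J: "1 \<bullet> (J * of_real b) = 0"
    and scalar_cases: "\<exists>a b. z = of_real a + J * of_real b"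

lemma inner_one_of_real [simp]:
  "(1::'k::{real_normed_field, euclidean_space}) \<bullet> of_real a = a"
  by (simp add: of_real_def inner_scaleR_right power2_norm_eq_inner[symmetric])

lemma inner_one_le: "(1::'k::{real_normed_field, euclidean_space}) \<bullet> z \<le> norm z"
  using norm_cauchy_schwarz[of 1 z] by simp

lemma unimodular_rotation:
  fixes z :: "'k::real_normed_field"
  obtains c where "norm c = 1" "c * z = of_real (norm z)"
proof (cases "z = 0")
  case False
  then show ?thesis
    by (intro that[of "of_real (norm z) / z"]) (simp_all add: norm_divide)
qed (use that[of 1] in simp)

lemma norm_diff_le_via:
  fixes a b a' b' :: "'a::real_normed_vector"
  shows "norm (a - b) \<le> norm (a - a') + norm (a' - b') + norm (b - b')"
  using norm_triangle_ineq4[of "(a - a') + (a' - b')" "b - b'"]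
    norm_triangle_ineq[of "a - a'" "a' - b'"] by simp

locale scalar_pair = scalar_unit J + homogeneous_pair X Y
  for J :: "'k::{real_normed_field, euclidean_space}"
    and X :: "('k, 'v) nspace" and Y :: "('k, 'w) nspace"
begin

text \<open>Hahn-Banach gives a real functional \<open>g\<close> that attains the norm at
  \<open>w\<close>; the Bohnenblust-Sobczyk formula turns it into a scalar linear functional with
  real part \<open>g\<close>, whose values on elementary tensors are the form.\<close>

theorem exists_norming_form:
  assumes w: "w \<in> points T"
  obtains B where "B \<in> forms_le X Y 1" "1 \<bullet> w B = nrm T w"
proof -
  obtain g where add: "\<And>u v. u \<in> points T \<Longrightarrow> v \<in> points T \<Longrightarrow> g (u + v) = g u + g v"
    and scale: "\<And>r u. u \<in> points T \<Longrightarrow> g (r *\<^sub>R u) = r * g u"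
    and le: "\<And>u. u \<in> points T \<Longrightarrow> g u \<le> nrm T u" and gw: "g w = nrm T w"
    by (rule Hahn_Banach_sublinear[OF subspace_points sublinear_on_nrm w]) blast
  \<comment> \<open>For \<open>J = 0\<close> this is \<open>g\<close> itself; for the imaginary unit
    it is the complex linear functional with real part \<open>g\<close>.\<close>
  define f :: "(('v \<Rightarrow> 'w \<Rightarrow> 'k) \<Rightarrow> 'k) \<Rightarrow> 'k"
    where "f u = of_real (g u) - J * of_real (g (\<lambda>B. J * u B))" for u
  have f_add: "f (u + v) = f u + f v" if "u \<in> points T" "v \<in> points T" for u v
  proof -
    have "(\<lambda>B. J * (u + v) B) = (\<lambda>B. J * u B) + (\<lambda>B. J * v B)"
      by (simp add: fun_eq_iff algebra_simps)
    then have "g (\<lambda>B. J * (u + v) B) = g (\<lambda>B. J * u B) + g (\<lambda>B. J * v B)"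
      using add[OF smul_points_T smul_points_T] that by simp
    then show ?thesis
      using that by (simp add: f_def add algebra_simps)
  qed
  have f_scaleR: "f (r *\<^sub>R u) = of_real r * f u" if "u \<in> points T" for r u
  proof -
    have "(\<lambda>B. J * (r *\<^sub>R u) B) = r *\<^sub>R (\<lambda>B. J * u B)"
      by (simp add: fun_eq_iff)
    then have "g (\<lambda>B. J * (r *\<^sub>R u) B) = r * g (\<lambda>B. J * u B)"
      using scale[OF smul_points_T] that by simp
    then show ?thesis
      using that by (simp add: f_def scale algebra_simps)
  qed
  have f_J: "f (\<lambda>B. J * u B) = J * f u" if u: "u \<in> points T" for u
    using J_cases
  proof
    assume J: "J = 0"
    have "f (0 *\<^sub>R u) = 0"
      using f_scaleR[OF u, of 0] by simp
    then show ?thesis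
      using J by (simp add: zero_fun_def)
  next
    assume J: "J * J = - 1"
    have "(\<lambda>B. J * (J * u B)) = (- 1) *\<^sub>R u"
      using J by (simp add: fun_eq_iff mult.assoc[symmetric])
    then have "g (\<lambda>B. J * (J * u B)) = - g u"
      using scale[OF u, of "- 1"] by simp
    then show ?thesis
      using J by (simp add: f_def right_diff_distrib mult.assoc[symmetric])
  qed
  have f_smul: "f (\<lambda>B. a * u B) = a * f u" if u: "u \<in> points T" for a u
  proof -
    obtain \<alpha> \<beta> where a: "a = of_real \<alpha> + J * of_real \<beta>"
      using scalar_cases by blast
    have "(\<lambda>B. a * u B) = \<alpha> *\<^sub>R u + \<beta> *\<^sub>R (\<lambda>B. J * u B)"
      by (simp add: a fun_eq_iff scaleR_conv_of_real algebra_simps)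
    moreover have "f (\<alpha> *\<^sub>R u + \<beta> *\<^sub>R (\<lambda>B. J * u B)) = of_real \<alpha> * f u + of_real \<beta> * (J * f u)"
      by (simp add: f_add f_scaleR f_J u smul_points_T scaleR_points_T)
    ultimately show ?thesis
      by (simp add: a algebra_simps)
  qed
  have re_f: "1 \<bullet> f u = g u" for u
    by (simp add: f_def inner_diff_right inner_J)
  have f_le: "norm (f u) \<le> nrm T u" if u: "u \<in> points T" for u
  proof -
    \<comment> \<open>Rotating \<open>u\<close> makes the value of \<open>f\<close> real, where it
      agrees with \<open>g\<close> and is bounded by the norm.\<close>
    obtain c where c: "norm c = 1" "c * f u = of_real (norm (f u))"
      by (rule unimodular_rotation)
    have "norm (f u) = 1 \<bullet> f (\<lambda>B. c * u B)"
      using c by (simp add: f_smul[OF u])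
    also have "\<dots> \<le> nrm T (\<lambda>B. c * u B)"
      unfolding re_f by (intro le smul_points_T u)
    also have "\<dots> = nrm T u"
      using c nrm_T_smul[OF u] by simp
    finally show ?thesis .
  qed
  define B where "B x y = f (elem_tensor X Y x y)" for x y
  have B: "B \<in> bilinear_forms X Y"
    by (simp add: bilinear_forms_def B_def elem_tensor_vadd_left elem_tensor_vadd_right
        elem_tensor_smul_left elem_tensor_smul_right elem_tensor_points f_add f_smul)
  moreover have "norm (B x y) \<le> nrm X x * nrm Y y" if "x \<in> points X" "y \<in> points Y" for x y
    unfolding B_def using f_le[OF elem_tensor_points[OF that]] nrm_T_elem_le[OF that] by linarith
  ultimately have "B \<in> forms_le X Y 1"
    by (simp add: forms_le_def)
  moreover have "w B = f w"
  proof -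
    obtain n x y where r: "tensor_rep X Y n x y w"
      using w by (auto simp: points_T)
    then have pts: "i < n \<Longrightarrow> elem_tensor X Y (x i) (y i) \<in> points T" for i
      by (auto simp: tensor_rep_def intro: elem_tensor_points)
    have "f 0 = 0"
      using f_scaleR[OF w, of 0] by simp
    \<comment> \<open>Additivity of \<open>f\<close> is available on points only, so the induction
      also carries membership of the partial sums.\<close>
    have "(\<Sum>i<m. elem_tensor X Y (x i) (y i)) \<in> points T \<and>
        f (\<Sum>i<m. elem_tensor X Y (x i) (y i)) = (\<Sum>i<m. B (x i) (y i))" if "m \<le> n" for m
      using that
      by (induction m) (simp_all add: \<open>f 0 = 0\<close> zero_points_T add_points_T f_add pts B_def)
    moreover have "w = (\<Sum>i<n. elem_tensor X Y (x i) (y i))"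
    proof -
      have "(\<Sum>i<m. elem_tensor X Y (x i) (y i)) B = (\<Sum>i<m. elem_tensor X Y (x i) (y i) B)" for m B
        by (induction m) simp_all
      then show ?thesis
        using r by (simp add: tensor_rep_def fun_eq_iff)
    qed
    ultimately show ?thesis
      using point_eval[OF r B] by simp
  qed
  ultimately show ?thesis
    using that re_f gw by metis
qed

text \<open>The continuous extension of evaluation at \<open>B\<close> from tensors to the
  completion, computed on a representing sequence.\<close>

definition pairing :: "(nat \<Rightarrow> ('v \<Rightarrow> 'w \<Rightarrow> 'k) \<Rightarrow> 'k) \<Rightarrow> ('v \<Rightarrow> 'w \<Rightarrow> 'k) \<Rightarrow> 'k" where
  "pairing s B = lim (\<lambda>n. s n B)"

lemma norm_point_diff_le:
  assumes "u \<in> points T" "v \<in> points T" "B \<in> forms_le X Y C" "0 \<le> C"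
  shows "norm (u B - v B) \<le> C * nrm T (u - v)"
  using norm_point_le[of "u - v" B C] assms by (simp add: subspace_diff subspace_points)

lemma tendsto_pairing:
  assumes s: "s \<in> cauchy_seqs T" and B: "B \<in> forms_le X Y C" and C: "0 \<le> C"
  shows "(\<lambda>n. s n B) \<longlonglongrightarrow> pairing s B"
proof -
  have "Cauchy (\<lambda>n. s n B)"
    unfolding Cauchy_def dist_norm
  proof (intro allI impI)
    fix e :: real assume "0 < e"
    then have "0 < e / (C + 1)"
      using C by simp
    then obtain N where N: "\<And>m n. N \<le> m \<Longrightarrow> N \<le> n \<Longrightarrow> nrm T (s m - s n) < e / (C + 1)"
      using s unfolding cauchy_seqs_iff by meson
    have "norm (s m B - s n B) < e" if "N \<le> m" "N \<le> n" for m n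
    proof -
      have "norm (s m B - s n B) \<le> C * nrm T (s m - s n)"
        using s by (intro norm_point_diff_le B C) (auto simp: cauchy_seqs_points)
      also have "\<dots> \<le> (C + 1) * nrm T (s m - s n)"
        using s by (intro mult_right_mono)
          (auto simp: cauchy_seqs_points nrm_nonneg subspace_diff subspace_points)
      also have "\<dots> < e"
        using N[OF that] C by (simp add: field_simps)
      finally show ?thesis .
    qed
    then show "\<exists>N. \<forall>m\<ge>N. \<forall>n\<ge>N. norm (s m B - s n B) < e"
      by blast
  qed
  then show ?thesis
    unfolding pairing_def by (simp add: Cauchy_convergent convergent_LIMSEQ_iff[symmetric])
qed

lemma norm_pairing_le:
  assumes s: "s \<in> cauchy_seqs T" and B: "B \<in> forms_le X Y C" and C: "0 \<le> C"
  shows "norm (pairing s B) \<le> C * lim_nrm s"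
proof (rule tendsto_le)
  show "(\<lambda>n. C * nrm T (s n)) \<longlonglongrightarrow> C * lim_nrm s"
    by (intro tendsto_mult_left tendsto_lim_nrm s)
  show "(\<lambda>n. norm (s n B)) \<longlonglongrightarrow> norm (pairing s B)"
    by (intro tendsto_norm tendsto_pairing[OF s B C])
  show "\<forall>\<^sub>F n in sequentially. norm (s n B) \<le> C * nrm T (s n)"
    using norm_point_le[OF cauchy_seqs_points[OF s] B C] by simp
qed simp

lemma pairing_add_scaleR:
  assumes "s \<in> cauchy_seqs T" "t \<in> cauchy_seqs T" "B \<in> forms_le X Y C" "0 \<le> C"
  shows "pairing (\<lambda>n. s n + r *\<^sub>R t n) B = pairing s B + r *\<^sub>R pairing t B"
proof -
  have "(\<lambda>n. (s n + r *\<^sub>R t n) B) \<longlonglongrightarrow> pairing s B + r *\<^sub>R pairing t B"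
    using assms by (simp, intro tendsto_intros tendsto_pairing)
  then show ?thesis
    unfolding pairing_def[of "\<lambda>n. s n + r *\<^sub>R t n"] by (rule limI)
qed

lemma pairing_diff_form:
  assumes s: "s \<in> cauchy_seqs T" and B: "B \<in> forms_le X Y C" "B' \<in> forms_le X Y C" and C: "0 \<le> C"
  shows "pairing s (\<lambda>x y. B x y - B' x y) = pairing s B - pairing s B'"
proof -
  have "(\<lambda>n. s n B - s n B') \<longlonglongrightarrow> pairing s B - pairing s B'"
    using s B C by (intro tendsto_diff tendsto_pairing)
  moreover have "s n (\<lambda>x y. B x y - B' x y) = s n B - s n B'" for n
    using B by (intro point_diff_form cauchy_seqs_points[OF s]) (auto simp: forms_le_def)
  ultimately show ?thesis
    unfolding pairing_def[of s "\<lambda>x y. B x y - B' x y"] by (simp add: limI)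
qed

text \<open>A form attaining the norm of a late term \<open>s N\<close> loses at most the distance
  to later terms, once in the norm and once in the value.\<close>

lemma exists_almost_norming_form:
  assumes s: "s \<in> cauchy_seqs T" and e: "0 < e"
  obtains B where "B \<in> forms_le X Y 1" "lim_nrm s - e \<le> 1 \<bullet> pairing s B"
proof -
  obtain N where N: "\<And>m n. N \<le> m \<Longrightarrow> N \<le> n \<Longrightarrow> nrm T (s m - s n) < e / 2"
    using s e unfolding cauchy_seqs_iff by (meson half_gt_zero)
  obtain B where B: "B \<in> forms_le X Y 1" and eq: "1 \<bullet> s N B = nrm T (s N)"
    using exists_norming_form[OF cauchy_seqs_points[OF s]] by metis
  have "lim_nrm s - e \<le> 1 \<bullet> pairing s B"
  proof (rule tendsto_le)
    show "(\<lambda>n. nrm T (s n) - e) \<longlonglongrightarrow> lim_nrm s - e"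
      by (intro tendsto_diff tendsto_const tendsto_lim_nrm s)
    show "(\<lambda>n. 1 \<bullet> s n B) \<longlonglongrightarrow> 1 \<bullet> pairing s B"
      by (intro tendsto_inner tendsto_const tendsto_pairing[OF s B]) simp
    have "nrm T (s n) - e \<le> 1 \<bullet> s n B" if "N \<le> n" for n
    proof -
      have pts: "s n \<in> points T" "s N \<in> points T"
        using s by (simp_all add: cauchy_seqs_points)
      have "1 \<bullet> s N B - 1 \<bullet> s n B \<le> norm (s N B - s n B)"
        using inner_one_le[of "s N B - s n B"] by (simp add: inner_diff_right)
      also have "\<dots> \<le> nrm T (s N - s n)"
        using norm_point_diff_le[OF pts(2,1) B] by simp
      finally show ?thesis
        using nrm_diff_bound[OF pts] N[of n N] N[of N n] that eq by simp
    qed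
    then show "\<forall>\<^sub>F n in sequentially. nrm T (s n) - e \<le> 1 \<bullet> s n B"
      by (auto simp: eventually_sequentially)
  qed simp
  then show ?thesis
    using that B by blast
qed

lemma tendsto_point:
  assumes u: "u \<in> points T"
    and B: "\<And>n. Bn n \<in> bilinear_forms X Y" "B \<in> bilinear_forms X Y"
    and lim: "\<And>x y. x \<in> points X \<Longrightarrow> y \<in> points Y \<Longrightarrow> (\<lambda>n. Bn n x y) \<longlonglongrightarrow> B x y"
  shows "(\<lambda>n. u (Bn n)) \<longlonglongrightarrow> u B"
proof -
  obtain n x y where r: "tensor_rep X Y n x y u"
    using u by (auto simp: points_T)
  have "(\<lambda>m. \<Sum>i<n. Bn m (x i) (y i)) \<longlonglongrightarrow> (\<Sum>i<n. B (x i) (y i))"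
    using r by (intro tendsto_sum lim) (auto simp: tensor_rep_def)
  then show ?thesis
    using point_eval[OF r] B by simp
qed

text \<open>Forms of norm at most one are equicontinuous, so a single term \<open>s N\<close>
  approximates \<open>s\<close> for all of them; at that tensor the convergence is one of finite
  sums.\<close>

lemma tendsto_pairing_forms:
  assumes s: "s \<in> cauchy_seqs T"
    and B: "\<And>n. Bn n \<in> forms_le X Y 1" "B \<in> forms_le X Y 1"
    and lim: "\<And>x y. x \<in> points X \<Longrightarrow> y \<in> points Y \<Longrightarrow> (\<lambda>n. Bn n x y) \<longlonglongrightarrow> B x y"
  shows "(\<lambda>n. pairing s (Bn n)) \<longlonglongrightarrow> pairing s B"
proof (rule LIMSEQ_I)
  fix e :: real assume e: "0 < e"
  obtain N where N: "\<And>m n. N \<le> m \<Longrightarrow> N \<le> n \<Longrightarrow> nrm T (s m - s n) < e / 4"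
    using s e unfolding cauchy_seqs_iff by (meson zero_less_divide_iff zero_less_numeral)
  have close: "norm (pairing s B' - s N B') \<le> e / 4" if B': "B' \<in> forms_le X Y 1" for B'
  proof (rule tendsto_upperbound)
    show "(\<lambda>n. norm (s n B' - s N B')) \<longlonglongrightarrow> norm (pairing s B' - s N B')"
      using tendsto_pairing[OF s B'] by (intro tendsto_norm tendsto_diff tendsto_const) simp
    have "norm (s n B' - s N B') \<le> e / 4" if "N \<le> n" for n
      using norm_point_diff_le[OF cauchy_seqs_points[OF s, of n] cauchy_seqs_points[OF s, of N] B']
        N[of n N] that by simp
    then show "\<forall>\<^sub>F n in sequentially. norm (s n B' - s N B') \<le> e / 4"
      by (auto simp: eventually_sequentially)
  qed simp
  have "(\<lambda>n. s N (Bn n)) \<longlonglongrightarrow> s N B"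
    by (rule tendsto_point[OF cauchy_seqs_points[OF s] _ _ lim]) (use B in \<open>auto simp: forms_le_def\<close>)
  from LIMSEQ_D[OF this, of "e / 4"] e obtain M
    where M: "\<And>n. M \<le> n \<Longrightarrow> norm (s N (Bn n) - s N B) < e / 4"
    by auto
  have "norm (pairing s (Bn n) - pairing s B) < e" if "M \<le> n" for n
  proof -
    show ?thesis
      using norm_diff_le_via[of "pairing s (Bn n)" "pairing s B" "s N (Bn n)" "s N B"] close[OF B(1)[of n]] close[OF B(2)] M[OF that] e by simp
  qed
  then show "\<exists>no. \<forall>n\<ge>no. norm (pairing s (Bn n) - pairing s B) < e"
    by blast
qed

lemma lim_nrm_add_scaleR_ge:
  assumes s: "s \<in> cauchy_seqs T" and h: "h \<in> cauchy_seqs T"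
  shows "lim_nrm s - \<bar>r\<bar> * lim_nrm h \<le> lim_nrm (\<lambda>n. s n + r *\<^sub>R h n)"
proof (rule tendsto_le)
  show "(\<lambda>n. nrm T (s n + r *\<^sub>R h n)) \<longlonglongrightarrow> lim_nrm (\<lambda>n. s n + r *\<^sub>R h n)"
    by (rule tendsto_lim_nrm[OF cauchy_seqs_add_scaleR[OF s h]])
  show "(\<lambda>n. nrm T (s n) - \<bar>r\<bar> * nrm T (h n)) \<longlonglongrightarrow> lim_nrm s - \<bar>r\<bar> * lim_nrm h"
    by (intro tendsto_diff tendsto_mult_left tendsto_lim_nrm s h)
  have "nrm T (s n) - \<bar>r\<bar> * nrm T (h n) \<le> nrm T (s n + r *\<^sub>R h n)" for n
    using nrm_add_scaleR_le[OF points_add_scaleR[OF cauchy_seqs_points[OF s] cauchy_seqs_points[OF h], of n r n]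
        cauchy_seqs_points[OF h, of n], of "- r"] by simp
  then show "\<forall>\<^sub>F n in sequentially. nrm T (s n) - \<bar>r\<bar> * nrm T (h n) \<le> nrm T (s n + r *\<^sub>R h n)"
    by simp
qed simp

end

section \<open>Difference quotients and norming forms\<close>

context scalar_pair
begin

text \<open>If no \<open>d\<close> works, there are steps \<open>t n\<close> tending to 0 and
  directions \<open>h n\<close> violating the bound. Forms that almost norm the perturbed points
  almost norm \<open>s\<close> as well, and a subsequence of them converges in norm to a form
  \<open>B\<close> attaining the norm of \<open>s\<close>. Norm convergence makes one of these forms
  close to \<open>B\<close> at its own direction, so \<open>B\<close> contradicts the
  violation.\<close>

lemma quotient_almost_attained:
  assumes s: "s \<in> cauchy_seqs T" and s1: "lim_nrm s = 1"
    and subseq: "\<And>Bn. (\<And>n. Bn n \<in> forms_le X Y 1) \<Longrightarrow> \<exists>r B. strict_mono (r :: nat \<Rightarrow> nat) \<and>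
      B \<in> forms_le X Y 1 \<and> (\<forall>x\<in>points X. \<forall>y\<in>points Y. (\<lambda>n. Bn (r n) x y) \<longlonglongrightarrow> B x y)"
    and norm_conv: "\<And>Bn B e. \<lbrakk>\<And>n. Bn n \<in> forms_le X Y 1; B \<in> forms_le X Y 1;
      \<And>x y. x \<in> points X \<Longrightarrow> y \<in> points Y \<Longrightarrow> (\<lambda>n. Bn n x y) \<longlonglongrightarrow> B x y;
      \<And>c. 0 \<le> c \<Longrightarrow> B \<in> forms_le X Y c \<Longrightarrow> 1 \<le> c; 0 < e\<rbrakk> \<Longrightarrow>
      \<exists>n. (\<lambda>x y. Bn n x y - B x y) \<in> forms_le X Y e"
    and e: "0 < e"
  shows "\<exists>d>0. \<forall>t h. 0 < t \<longrightarrow> t < d \<longrightarrow> h \<in> cauchy_seqs T \<longrightarrow> lim_nrm h \<le> 1 \<longrightarrow>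
    (\<exists>B\<in>forms_le X Y 1. 1 \<bullet> pairing s B = 1 \<and>
      (lim_nrm (\<lambda>n. s n + t *\<^sub>R h n) - 1) / t \<le> 1 \<bullet> pairing h B + e)"
proof (rule ccontr)
  assume neg: "\<not> ?thesis"
  define Q where "Q t h \<longleftrightarrow> (\<exists>B\<in>forms_le X Y 1. 1 \<bullet> pairing s B = 1 \<and>
      (lim_nrm (\<lambda>n. s n + t *\<^sub>R h n) - 1) / t \<le> 1 \<bullet> pairing h B + e)" for t h
  have "\<exists>t h. 0 < t \<and> t < inverse (real (Suc n)) \<and> h \<in> cauchy_seqs T \<and> lim_nrm h \<le> 1 \<and> \<not> Q t h" for n
  proof -
    have "0 < inverse (real (Suc n))"
      by simp
    then show ?thesis
      using neg unfolding Q_def[symmetric] by blast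
  qed
  then obtain t h where t: "\<And>n. 0 < t n" "\<And>n. t n < inverse (real (Suc n))"
    and h: "\<And>n. h n \<in> cauchy_seqs T" "\<And>n. lim_nrm (h n) \<le> 1"
    and "\<And>n. \<not> Q (t n) (h n)"
    by metis
  then have bad: "1 \<bullet> pairing (h n) B + e < (lim_nrm (\<lambda>k. s k + t n *\<^sub>R h n k) - 1) / t n"
    if "B \<in> forms_le X Y 1" "1 \<bullet> pairing s B = 1" for n B
    using that unfolding Q_def not_le[symmetric] by blast
  define w where "w n = (\<lambda>k. s k + t n *\<^sub>R h n k)" for n
  have w: "w n \<in> cauchy_seqs T" for n
    unfolding w_def by (intro cauchy_seqs_add_scaleR s h)
  \<comment> \<open>The error is proportional to \<open>t n\<close>, so that it is still
    \<open>e / 3\<close> after division by the step.\<close>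
  have "\<exists>B. B \<in> forms_le X Y 1 \<and> lim_nrm (w n) - t n * (e / 3) \<le> 1 \<bullet> pairing (w n) B" for n
  proof -
    have "0 < t n * (e / 3)"
      using t(1)[of n] e by simp
    from exists_almost_norming_form[OF w this] show ?thesis
      by blast
  qed
  then obtain A where A: "\<And>n. A n \<in> forms_le X Y 1"
    and normA: "\<And>n. lim_nrm (w n) - t n * (e / 3) \<le> 1 \<bullet> pairing (w n) (A n)"
    by metis
  have wA: "1 \<bullet> pairing (w n) B = 1 \<bullet> pairing s B + t n * (1 \<bullet> pairing (h n) B)"
    if "B \<in> forms_le X Y 1" for n B
    unfolding w_def using pairing_add_scaleR[OF s h(1) that] by (simp add: inner_add_right)
  have re_le: "1 \<bullet> pairing x B \<le> lim_nrm x" if "x \<in> cauchy_seqs T" "B \<in> forms_le X Y 1" for x B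
    using norm_pairing_le[OF that] inner_one_le[of "pairing x B"] by simp
  \<comment> \<open>Besides \<open>t n * (e / 3)\<close>, a loss of \<open>t n\<close> comes from
    the norm of the perturbed point and another one from the value of the form at
    \<open>h n\<close>; hence the factor \<open>2 + e / 3\<close>.\<close>
  have sA: "(\<lambda>n. 1 \<bullet> pairing s (A n)) \<longlonglongrightarrow> 1"
  proof (rule tendsto_sandwich)
    show "\<forall>\<^sub>F n in sequentially. 1 - inverse (real (Suc n)) * (2 + e / 3) \<le> 1 \<bullet> pairing s (A n)"
    proof (intro always_eventually allI)
      fix n
      have "1 - t n \<le> lim_nrm s - \<bar>t n\<bar> * lim_nrm (h n)"
        using t(1)[of n] h(2)[of n] s1 by simp
      also have "\<dots> \<le> lim_nrm (w n)"
        unfolding w_def by (rule lim_nrm_add_scaleR_ge[OF s h(1)])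
      finally have "1 - t n - t n * (e / 3) \<le> 1 \<bullet> pairing s (A n) + t n * (1 \<bullet> pairing (h n) (A n))"
        using normA[of n] wA[OF A] by simp
      moreover have "t n * (1 \<bullet> pairing (h n) (A n)) \<le> t n * 1"
        using re_le[OF h(1) A, of n n] h(2)[of n] t(1)[of n] by (intro mult_left_mono) auto
      ultimately have "1 - t n * (2 + e / 3) \<le> 1 \<bullet> pairing s (A n)"
        by (simp add: algebra_simps)
      moreover have "t n * (2 + e / 3) \<le> inverse (real (Suc n)) * (2 + e / 3)"
        using t(2)[of n] e by (intro mult_right_mono) auto
      ultimately show "1 - inverse (real (Suc n)) * (2 + e / 3) \<le> 1 \<bullet> pairing s (A n)"
        by linarith
    qed
    show "\<forall>\<^sub>F n in sequentially. 1 \<bullet> pairing s (A n) \<le> 1"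
      using re_le[OF s A] s1 by simp
    show "(\<lambda>n. 1 - inverse (real (Suc n)) * (2 + e / 3)) \<longlonglongrightarrow> 1"
      using tendsto_diff[OF tendsto_const[of 1] tendsto_mult_right[OF LIMSEQ_inverse_real_of_nat]]
      by fastforce
  qed simp
  obtain r B where r: "strict_mono (r :: nat \<Rightarrow> nat)" and B: "B \<in> forms_le X Y 1"
    and lim: "\<And>x y. x \<in> points X \<Longrightarrow> y \<in> points Y \<Longrightarrow> (\<lambda>n. A (r n) x y) \<longlonglongrightarrow> B x y"
    using subseq[of A] A by blast
  have "(\<lambda>n. 1 \<bullet> pairing s (A (r n))) \<longlonglongrightarrow> 1 \<bullet> pairing s B"
    by (intro tendsto_inner tendsto_const tendsto_pairing_forms[OF s A B lim])
  moreover have "(\<lambda>n. 1 \<bullet> pairing s (A (r n))) \<longlonglongrightarrow> 1"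
    using LIMSEQ_subseq_LIMSEQ[OF sA r] by (simp add: o_def)
  ultimately have sB: "1 \<bullet> pairing s B = 1"
    by (rule LIMSEQ_unique)
  \<comment> \<open>Attaining the norm of a unit point forces norm at least one on \<open>B\<close>,
    the condition under which pointwise convergence improves to norm convergence.\<close>
  have nB: "1 \<le> c" if "0 \<le> c" "B \<in> forms_le X Y c" for c
    using norm_pairing_le[OF s that(2,1)] inner_one_le[of "pairing s B"] sB s1 by simp
  have e3: "0 < e / 3"
    using e by simp
  have "\<exists>n. (\<lambda>x y. A (r n) x y - B x y) \<in> forms_le X Y (e / 3)"
    by (rule norm_conv[OF A B]) (assumption | rule lim nB e3)+
  then obtain n where n: "(\<lambda>x y. A (r n) x y - B x y) \<in> forms_le X Y (e / 3)" ..
  define m where "m = r n"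
  have "norm (pairing (h m) (A m) - pairing (h m) B) \<le> e / 3 * lim_nrm (h m)"
    using norm_pairing_le[OF h(1) n, of m] pairing_diff_form[OF h(1) A B, of m m] e
    by (simp add: m_def)
  also have "\<dots> \<le> e / 3 * 1"
    using h(2)[of m] e by (intro mult_left_mono) auto
  finally have close: "1 \<bullet> pairing (h m) (A m) - 1 \<bullet> pairing (h m) B \<le> e / 3"
    using inner_one_le[of "pairing (h m) (A m) - pairing (h m) B"] by (simp add: inner_diff_right)
  have "lim_nrm (w m) - 1 \<le> t m * (1 \<bullet> pairing (h m) (A m)) + t m * (e / 3)"
    using normA[of m] wA[OF A, of m m] re_le[OF s A, of m] s1 by simp
  also have "\<dots> = t m * (1 \<bullet> pairing (h m) (A m) + e / 3)"
    by (simp add: algebra_simps)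
  also have "\<dots> \<le> t m * (1 \<bullet> pairing (h m) B + e)"
    using close e t(1)[of m] by (intro mult_left_mono) auto
  finally have "(lim_nrm (w m) - 1) / t m \<le> 1 \<bullet> pairing (h m) B + e"
    using t(1)[of m] by (simp add: field_simps)
  then show False
    using bad[OF B sB, of m] by (simp add: w_def)
qed

text \<open>The one-sided derivative at \<open>s\<close> in direction \<open>h\<close> is the largest value at \<open>h\<close> of a form of
  norm one attaining the norm of \<open>s\<close>.\<close>

theorem ssd_at_if_norm_convergence:
  assumes s: "s \<in> cauchy_seqs T" and s1: "lim_nrm s = 1"
    and subseq: "\<And>Bn. (\<And>n. Bn n \<in> forms_le X Y 1) \<Longrightarrow> \<exists>r B. strict_mono (r :: nat \<Rightarrow> nat) \<and>
      B \<in> forms_le X Y 1 \<and> (\<forall>x\<in>points X. \<forall>y\<in>points Y. (\<lambda>n. Bn (r n) x y) \<longlonglongrightarrow> B x y)"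
    and norm_conv: "\<And>Bn B e. \<lbrakk>\<And>n. Bn n \<in> forms_le X Y 1; B \<in> forms_le X Y 1;
      \<And>x y. x \<in> points X \<Longrightarrow> y \<in> points Y \<Longrightarrow> (\<lambda>n. Bn n x y) \<longlonglongrightarrow> B x y;
      \<And>c. 0 \<le> c \<Longrightarrow> B \<in> forms_le X Y c \<Longrightarrow> 1 \<le> c; 0 < e\<rbrakk> \<Longrightarrow>
      \<exists>n. (\<lambda>x y. Bn n x y - B x y) \<in> forms_le X Y e"
  shows "ssd_at (completion T) (cauchy_class s)"
proof -
  define D where "D = {B \<in> forms_le X Y 1. 1 \<bullet> pairing s B = 1}"
  define L where "L h = (SUP B\<in>D. 1 \<bullet> pairing h B)" for h
  have attained: "\<exists>d>0. \<forall>t h. 0 < t \<longrightarrow> t < d \<longrightarrow> h \<in> cauchy_seqs T \<longrightarrow> lim_nrm h \<le> 1 \<longrightarrow>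
    (\<exists>B\<in>D. (lim_nrm (\<lambda>n. s n + t *\<^sub>R h n) - 1) / t \<le> 1 \<bullet> pairing h B + e)" if "0 < e" for e
    using quotient_almost_attained[OF s s1 subseq norm_conv that] unfolding D_def by fast
  have lower: "1 \<bullet> pairing h B \<le> (lim_nrm (\<lambda>n. s n + t *\<^sub>R h n) - 1) / t"
    if "0 < t" "h \<in> cauchy_seqs T" "B \<in> D" for t h B
  proof -
    have B: "B \<in> forms_le X Y 1" "1 \<bullet> pairing s B = 1"
      using that by (auto simp: D_def)
    have "1 + t * (1 \<bullet> pairing h B) = 1 \<bullet> pairing (\<lambda>n. s n + t *\<^sub>R h n) B"
      using pairing_add_scaleR[OF s that(2) B(1)] B(2) by (simp add: inner_add_right)
    also have "\<dots> \<le> lim_nrm (\<lambda>n. s n + t *\<^sub>R h n)"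
      using norm_pairing_le[OF cauchy_seqs_add_scaleR[OF s that(2), of t] B(1)]
        inner_one_le[of "pairing (\<lambda>n. s n + t *\<^sub>R h n) B"] by simp
    finally show ?thesis
      using that(1) by (simp add: field_simps)
  qed
  have zero: "(\<lambda>_. 0) \<in> cauchy_seqs T" "lim_nrm (\<lambda>_. 0) = 0"
    using cauchy_seqs_const[OF zero_points_T] lim_nrm_eqI[of 0 "\<lambda>_. 0" 0] nrm_T_zero by auto
  obtain d :: real where "0 < d" and d: "\<forall>t h. 0 < t \<longrightarrow> t < d \<longrightarrow> h \<in> cauchy_seqs T \<longrightarrow>
      lim_nrm h \<le> 1 \<longrightarrow> (\<exists>B\<in>D. (lim_nrm (\<lambda>n. s n + t *\<^sub>R h n) - 1) / t \<le> 1 \<bullet> pairing h B + 1)"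
    using attained[of 1] by auto
  \<comment> \<open>The zero direction already produces a member of \<open>D\<close>, so the
    supremum defining \<open>L\<close> is over a nonempty set.\<close>
  have "D \<noteq> {}"
    using d[rule_format, of "d / 2" "\<lambda>_. 0"] \<open>0 < d\<close> zero by auto
  \<comment> \<open>The quotient at step 1 bounds the values at \<open>h\<close>, so the supremum is
    finite.\<close>
  have upper: "1 \<bullet> pairing h B \<le> L h" if "h \<in> cauchy_seqs T" "B \<in> D" for h B
    unfolding L_def using lower[OF zero_less_one that(1)] that(2)
    by (intro cSUP_upper bdd_aboveI2) auto
  have L_le: "L h \<le> (lim_nrm (\<lambda>n. s n + t *\<^sub>R h n) - 1) / t" if "0 < t" "h \<in> cauchy_seqs T" for t h
    unfolding L_def using lower[OF that] \<open>D \<noteq> {}\<close> by (intro cSUP_least) auto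
  show ?thesis
    unfolding ssd_at_cauchy_class_iff[OF s] s1
  proof (intro exI[of _ L] allI impI)
    fix e :: real assume "0 < e"
    then have "0 < e / 2"
      by simp
    from attained[OF this] obtain d where "0 < d" and d: "\<forall>t h. 0 < t \<longrightarrow> t < d \<longrightarrow>
        h \<in> cauchy_seqs T \<longrightarrow> lim_nrm h \<le> 1 \<longrightarrow>
        (\<exists>B\<in>D. (lim_nrm (\<lambda>n. s n + t *\<^sub>R h n) - 1) / t \<le> 1 \<bullet> pairing h B + e / 2)"
      by (elim exE conjE)
    show "\<exists>d>0. \<forall>t. 0 < t \<and> t < d \<longrightarrow> (\<forall>h\<in>cauchy_seqs T. lim_nrm h \<le> 1 \<longrightarrow>
        \<bar>(lim_nrm (\<lambda>n. s n + t *\<^sub>R h n) - 1) / t - L h\<bar> < e)"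
    proof (intro exI[of _ d] conjI allI impI ballI)
      fix t h assume "0 < t \<and> t < d" and h: "h \<in> cauchy_seqs T" "lim_nrm h \<le> 1"
      then have t: "0 < t" "t < d"
        by auto
      obtain B where "B \<in> D" "(lim_nrm (\<lambda>n. s n + t *\<^sub>R h n) - 1) / t \<le> 1 \<bullet> pairing h B + e / 2"
        using d[rule_format, OF t h] by (elim bexE)
      then show "\<bar>(lim_nrm (\<lambda>n. s n + t *\<^sub>R h n) - 1) / t - L h\<bar> < e"
        using upper[OF h(1), of B] L_le[OF t(1) h(1)] \<open>0 < e\<close> by linarith
    qed (rule \<open>0 < d\<close>)
  qed
qed

end

section \<open>Sequence spaces\<close>

lemma ell_simps [simp]:
  fixes p :: real
  shows "x \<in> points (ell TYPE('k::real_normed_field) (ereal p)) \<longleftrightarrow> summable (\<lambda>n. norm (x n) powr p)"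
    "vadd (ell TYPE('k) P) = (\<lambda>x y n. x n + y n)"
    "smul (ell TYPE('k) P) = (\<lambda>a x n. a * x n)"
  by (simp_all add: ell_def)

lemma nrm_ell:
  "nrm (ell TYPE('k::real_normed_field) (ereal p)) x = (\<Sum>n. norm (x n) powr p) powr (1 / p)"
  by (simp add: ell_def)

lemma nrm_ell_nonneg: "0 \<le> nrm (ell TYPE('k::real_normed_field) (ereal p)) x"
  by (simp add: nrm_ell)

lemma nrm_ell_powr:
  assumes "0 < p" "summable (\<lambda>n. norm (x n) powr p)"
  shows "nrm (ell TYPE('k::real_normed_field) (ereal p)) x powr p = (\<Sum>n. norm (x n) powr p)"
  using assms by (simp add: nrm_ell powr_powr suminf_nonneg)

lemma nrm_ell_mono:
  fixes x :: "nat \<Rightarrow> 'k::real_normed_field"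
  assumes "0 < p" "summable (\<lambda>n. norm (y n) powr p)" "\<And>n. norm (x n) \<le> norm (y n)"
  shows "summable (\<lambda>n. norm (x n) powr p)"
    "nrm (ell TYPE('k) (ereal p)) x \<le> nrm (ell TYPE('k) (ereal p)) y"
proof -
  have le: "norm (x n) powr p \<le> norm (y n) powr p" for n
    using assms by (intro powr_mono2) auto
  then show *: "summable (\<lambda>n. norm (x n) powr p)"
    by (intro summable_comparison_test'[OF assms(2)]) simp
  show "nrm (ell TYPE('k) (ereal p)) x \<le> nrm (ell TYPE('k) (ereal p)) y"
    unfolding nrm_ell using assms(1)
    by (intro powr_mono2 suminf_le[OF le * assms(2)] suminf_nonneg *) auto
qed

lemma ell_coordinate_le:
  fixes x :: "nat \<Rightarrow> 'k::real_normed_field"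
  assumes "0 < p" "summable (\<lambda>n. norm (x n) powr p)"
  shows "norm (x n) \<le> nrm (ell TYPE('k) (ereal p)) x"
proof -
  have "(\<Sum>k\<in>{n}. norm (x k) powr p) \<le> (\<Sum>k. norm (x k) powr p)"
    using assms by (intro sum_le_suminf) auto
  then have "(norm (x n) powr p) powr (1 / p) \<le> (\<Sum>k. norm (x k) powr p) powr (1 / p)"
    using assms by (intro powr_mono2) auto
  then show ?thesis
    using assms by (simp add: nrm_ell powr_powr)
qed

definition unit_seq :: "nat \<Rightarrow> nat \<Rightarrow> 'k::real_normed_field" where
  "unit_seq i = (\<lambda>n. if n = i then 1 else 0)"

lemma unit_seq_ell:
  assumes "0 < p"
  shows "summable (\<lambda>n. norm (unit_seq i n :: 'k::real_normed_field) powr p)"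
    "nrm (ell TYPE('k) (ereal p)) (unit_seq i) = 1"
proof -
  have "(\<lambda>n. norm (unit_seq i n :: 'k) powr p) = (\<lambda>n. if n = i then 1 else 0)"
    by (auto simp: unit_seq_def)
  then have "(\<lambda>n. norm (unit_seq i n :: 'k) powr p) sums 1"
    using sums_single[of i "\<lambda>_. 1 :: real"] by simp
  then show "summable (\<lambda>n. norm (unit_seq i n :: 'k) powr p)"
    "nrm (ell TYPE('k) (ereal p)) (unit_seq i) = 1"
    by (simp_all add: nrm_ell sums_iff)
qed

lemma norm_add_powr_le:
  fixes a b :: "'a::real_normed_vector"
  assumes "0 \<le> p"
  shows "norm (a + b) powr p \<le> 2 powr p * (norm a powr p + norm b powr p)"
proof -
  have "norm (a + b) powr p \<le> (2 * max (norm a) (norm b)) powr p"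
    using norm_triangle_ineq[of a b] assms by (intro powr_mono2) auto
  also have "\<dots> = 2 powr p * max (norm a) (norm b) powr p"
    by (simp add: powr_mult)
  also have "\<dots> \<le> 2 powr p * (norm a powr p + norm b powr p)"
    by (intro mult_left_mono) (auto simp: max_def)
  finally show ?thesis .
qed

lemma summable_add_powr:
  fixes x y :: "nat \<Rightarrow> 'a::real_normed_vector"
  assumes "0 \<le> p" "summable (\<lambda>n. norm (x n) powr p)" "summable (\<lambda>n. norm (y n) powr p)"
  shows "summable (\<lambda>n. norm (x n + y n) powr p)"
proof (rule summable_comparison_test')
  show "summable (\<lambda>n. 2 powr p * (norm (x n) powr p + norm (y n) powr p))"
    using assms by (intro summable_mult summable_add)
qed (use norm_add_powr_le[OF assms(1)] in simp)

lemma smul_ell: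
  fixes x :: "nat \<Rightarrow> 'k::real_normed_field"
  assumes "0 < p" "summable (\<lambda>n. norm (x n) powr p)"
  shows "summable (\<lambda>n. norm (a * x n) powr p)"
    "nrm (ell TYPE('k) (ereal p)) (\<lambda>n. a * x n) = norm a * nrm (ell TYPE('k) (ereal p)) x"
proof -
  have eq: "norm (a * x n) powr p = norm a powr p * norm (x n) powr p" for n
    by (simp add: norm_mult powr_mult)
  show "summable (\<lambda>n. norm (a * x n) powr p)"
    unfolding eq using assms by (intro summable_mult)
  show "nrm (ell TYPE('k) (ereal p)) (\<lambda>n. a * x n) = norm a * nrm (ell TYPE('k) (ereal p)) x"
    unfolding nrm_ell eq using assms
    by (simp add: suminf_mult powr_mult powr_powr suminf_nonneg)
qed

lemma ell_infinity [simp]: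
  "x \<in> points (ell TYPE('k::real_normed_field) \<infinity>) \<longleftrightarrow> bounded (range x)"
  "nrm (ell TYPE('k) \<infinity>) x = (SUP n. norm (x n))"
  by (simp_all add: ell_def)

lemma bdd_above_norm_range: "bounded (range x) \<Longrightarrow> bdd_above (range (\<lambda>n. norm (x n)))"
  by (auto simp: bounded_iff bdd_above_def)

lemma smul_ell_infinity:
  fixes x :: "nat \<Rightarrow> 'k::real_normed_field"
  assumes "bounded (range x)"
  shows "bounded (range (\<lambda>n. a * x n))" "(SUP n. norm (a * x n)) = norm a * (SUP n. norm (x n))"
proof -
  have b: "norm (x n) \<le> (SUP n. norm (x n))" for n
    using assms by (intro cSUP_upper bdd_above_norm_range) auto
  show *: "bounded (range (\<lambda>n. a * x n))"
    unfolding bounded_iff using b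
    by (intro exI[of _ "norm a * (SUP n. norm (x n))"]) (auto simp: norm_mult intro!: mult_left_mono)
  show "(SUP n. norm (a * x n)) = norm a * (SUP n. norm (x n))"
  proof (cases "a = 0")
    case False
    have "(SUP n. norm (x n)) \<le> (SUP n. norm (a * x n)) / norm a"
    proof (rule cSUP_least)
      fix n
      have "norm (a * x n) \<le> (SUP n. norm (a * x n))"
        using * by (intro cSUP_upper bdd_above_norm_range) auto
      then show "norm (x n) \<le> (SUP n. norm (a * x n)) / norm a"
        using False by (simp add: norm_mult field_simps)
    qed simp
    moreover have "(SUP n. norm (a * x n)) \<le> norm a * (SUP n. norm (x n))"
      using b by (intro cSUP_least) (auto simp: norm_mult intro!: mult_left_mono)
    ultimately show ?thesis
      using False by (simp add: field_simps)
  qed simp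
qed

lemma ell_exponent_cases:
  fixes p :: ereal
  assumes "1 \<le> p"
  obtains r where "p = ereal r" "1 \<le> r" | "p = \<infinity>"
  using assms by (cases p) auto

lemma homogeneous_ell:
  fixes p :: ereal and x :: "nat \<Rightarrow> 'k::real_normed_field"
  assumes p: "1 \<le> p" and x: "x \<in> points (ell TYPE('k) p)"
  shows "0 \<le> nrm (ell TYPE('k) p) x \<and> smul (ell TYPE('k) p) a x \<in> points (ell TYPE('k) p) \<and>
    nrm (ell TYPE('k) p) (smul (ell TYPE('k) p) a x) = norm a * nrm (ell TYPE('k) p) x"
  using p
proof (cases rule: ell_exponent_cases)
  case 2
  have "norm (x 0) \<le> (SUP n. norm (x n))"
    using x 2 by (intro cSUP_upper bdd_above_norm_range) auto
  then have "0 \<le> (SUP n. norm (x n))"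
    using norm_ge_zero order_trans by blast
  then show ?thesis
    using x 2 smul_ell_infinity[of x a] by simp
next
  case (1 r)
  then show ?thesis
    using x smul_ell[of r x a] nrm_ell_nonneg[of r x] by simp
qed

definition head :: "nat \<Rightarrow> (nat \<Rightarrow> 'k::zero) \<Rightarrow> nat \<Rightarrow> 'k" where
  "head m x = (\<lambda>n. if n < m then x n else 0)"

definition tail :: "nat \<Rightarrow> (nat \<Rightarrow> 'k::zero) \<Rightarrow> nat \<Rightarrow> 'k" where
  "tail m x = (\<lambda>n. if n < m then 0 else x n)"

lemma head_ell:
  fixes x :: "nat \<Rightarrow> 'k::real_normed_field"
  assumes "0 < p" "summable (\<lambda>n. norm (x n) powr p)"
  shows "summable (\<lambda>n. norm (head m x n) powr p)"
    "nrm (ell TYPE('k) (ereal p)) (head m x) \<le> nrm (ell TYPE('k) (ereal p)) x"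
  by (rule nrm_ell_mono[OF assms]; simp add: head_def)+

lemma tail_ell:
  fixes x :: "nat \<Rightarrow> 'k::real_normed_field"
  assumes "0 < p" "summable (\<lambda>n. norm (x n) powr p)"
  shows "summable (\<lambda>n. norm (tail m x n) powr p)"
    "nrm (ell TYPE('k) (ereal p)) (tail m x) \<le> nrm (ell TYPE('k) (ereal p)) x"
  by (rule nrm_ell_mono[OF assms]; simp add: tail_def)+

text \<open>The p-th power of the norm of the tail is the remainder of a convergent series.\<close>

lemma tendsto_tail_ell:
  fixes x :: "nat \<Rightarrow> 'k::real_normed_field"
  assumes p: "0 < p" and x: "summable (\<lambda>n. norm (x n) powr p)"
  shows "(\<lambda>m. nrm (ell TYPE('k) (ereal p)) (tail m x)) \<longlonglongrightarrow> 0"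
proof -
  have eq: "(\<Sum>n. norm (tail m x n) powr p)
      = (\<Sum>n. norm (x n) powr p) - (\<Sum>n<m. norm (x n) powr p)" for m
  proof -
    have "(\<Sum>n. norm (tail m x n) powr p)
        = (\<Sum>n. norm (tail m x (n + m)) powr p) + (\<Sum>n<m. norm (tail m x n) powr p)"
      by (rule suminf_split_initial_segment) (rule tail_ell[OF p x])
    also have "\<dots> = (\<Sum>n. norm (x (n + m)) powr p)"
      by (simp add: tail_def)
    also have "\<dots> = (\<Sum>n. norm (x n) powr p) - (\<Sum>n<m. norm (x n) powr p)"
      by (rule suminf_minus_initial_segment[OF x])
    finally show ?thesis .
  qed
  have "(\<lambda>m. (\<Sum>n. norm (x n) powr p) - (\<Sum>n<m. norm (x n) powr p)) \<longlonglongrightarrow>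
      (\<Sum>n. norm (x n) powr p) - (\<Sum>n. norm (x n) powr p)"
    by (intro tendsto_diff tendsto_const summable_LIMSEQ x)
  then have "(\<lambda>m. (\<Sum>n. norm (tail m x n) powr p)) \<longlonglongrightarrow> 0"
    by (simp add: eq)
  then show ?thesis
    unfolding nrm_ell using p
    by (intro tendsto_zero_powrI[where b = "1 / p"] tendsto_const) (auto intro!: always_eventually suminf_nonneg tail_ell x)
qed

section \<open>Smoothness and disjointness estimates for the norms of sequence spaces\<close>

lemma le_powr_Young:
  fixes a :: real
  assumes "1 < p" "0 \<le> a"
  shows "a \<le> a powr p / p + (1 - 1 / p)"
proof -
  \<comment> \<open>Young's inequality for the product \<open>a * 1\<close>. The result is the
    tangent estimate of the power at 1, which passes from p-th powers of norms to norms without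
    extracting roots.\<close>
  define q where "q = p / (p - 1)"
  have "1 < q" "1 / q = 1 - 1 / p"
    using assms by (auto simp: q_def field_simps)
  then show ?thesis
    using Youngs_inequality[of p q a 1] assms by simp
qed

text \<open>On disjoint supports the q-th powers add. The Young estimate then bounds the norm
  itself, the constants \<open>1 / q\<close> and \<open>1 - 1 / q\<close> adding up to 1.\<close>

lemma nrm_ell_disjoint_le:
  fixes y v :: "nat \<Rightarrow> 'k::real_normed_field"
  assumes q: "1 < q" and y: "summable (\<lambda>n. norm (y n) powr q)" "nrm (ell TYPE('k) (ereal q)) y \<le> 1"
    and v: "summable (\<lambda>n. norm (v n) powr q)" "nrm (ell TYPE('k) (ereal q)) v \<le> 1"
    and disj: "\<And>n. y n = 0 \<or> v n = 0"
  shows "nrm (ell TYPE('k) (ereal q)) (\<lambda>n. y n + of_real b * v n) \<le> 1 + \<bar>b\<bar> powr q"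
proof -
  let ?N = "nrm (ell TYPE('k) (ereal q)) (\<lambda>n. y n + of_real b * v n)"
  have le1: "(\<Sum>n. norm (z n) powr q) \<le> 1"
    if "summable (\<lambda>n. norm (z n) powr q)" "nrm (ell TYPE('k) (ereal q)) z \<le> 1" for z :: "nat \<Rightarrow> 'k"
    using nrm_ell_powr[OF _ that(1)] q powr_mono2[OF _ nrm_ell_nonneg that(2), of q] by simp
  have eq: "norm (y n + of_real b * v n) powr q = norm (y n) powr q + \<bar>b\<bar> powr q * norm (v n) powr q" for n
    using disj[of n] by (auto simp: norm_mult powr_mult)
  have "?N powr q = (\<Sum>n. norm (y n) powr q + \<bar>b\<bar> powr q * norm (v n) powr q)"
    using q y(1) v(1) by (subst nrm_ell_powr) (auto simp: eq intro!: summable_add summable_mult)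
  also have "\<dots> = (\<Sum>n. norm (y n) powr q) + \<bar>b\<bar> powr q * (\<Sum>n. norm (v n) powr q)"
    using y(1) v(1) by (simp add: suminf_add[symmetric] suminf_mult summable_mult)
  also have "\<dots> \<le> 1 + \<bar>b\<bar> powr q * 1"
    by (intro add_mono mult_left_mono le1 y v) auto
  finally have "?N powr q / q \<le> (1 + \<bar>b\<bar> powr q) / q"
    using q by (intro divide_right_mono) auto
  moreover have "\<bar>b\<bar> powr q / q \<le> \<bar>b\<bar> powr q / 1"
    using q by (intro divide_left_mono) auto
  ultimately show ?thesis
    using le_powr_Young[OF q, of ?N] by (simp add: nrm_ell_nonneg add_divide_distrib)
qed

text \<open>For \<open>z = - y\<close> with positive \<open>y\<close>, the bound
  \<open>1 + y \<le> exp y\<close> reduces the claim to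
  \<open>1 \<le> (1 - y + y^2) * (1 + y)\<close>, whose right side is
  \<open>1 + y^3\<close>.\<close>

lemma exp_le_quadratic:
  fixes z :: real
  assumes "z \<le> 1"
  shows "exp z \<le> 1 + z + z\<^sup>2"
proof (cases "0 \<le> z")
  case False
  define y where "y = - z"
  have y: "0 < y"
    using False by (simp add: y_def)
  have "exp z * (1 + y) \<le> exp z * exp y"
    by (intro mult_left_mono exp_ge_add_one_self) simp
  also have "\<dots> = 1"
    by (simp add: y_def flip: exp_add)
  also have "\<dots> \<le> (1 - y + y\<^sup>2) * (1 + y)"
    using y by (simp add: power2_eq_square algebra_simps)
  finally show ?thesis
    using y by (simp add: y_def)
qed (use assms exp_bound in auto)

text \<open>\<open>ln (1 + w) \<le> w\<close> reduces the power to an exponential. At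
  \<open>w = - 1\<close> the power is 0, and \<open>1 - r + r^2\<close> is positive.\<close>

lemma one_add_powr_le:
  fixes r w :: real
  assumes "0 \<le> r" "- 1 \<le> w" "r * w \<le> 1"
  shows "(1 + w) powr r \<le> 1 + r * w + (r * w)\<^sup>2"
proof (cases "w = - 1")
  case True
  have "0 \<le> (r - 1)\<^sup>2 + r"
    using assms by simp
  then show ?thesis
    using True by (simp add: power2_eq_square algebra_simps)
next
  case False
  then have "(1 + w) powr r = exp (r * ln (1 + w))"
    using assms by (simp add: powr_def)
  also have "\<dots> \<le> exp (r * w)"
    using assms False ln_add_one_self_le_self2[of w] by (simp add: mult_left_mono)
  also have "\<dots> \<le> 1 + r * w + (r * w)\<^sup>2"
    by (rule exp_le_quadratic[OF assms(3)])
  finally show ?thesis .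
qed

text \<open>If \<open>t\<close> is small against \<open>s\<close>, both powers are written with
  exponent \<open>p / 2\<close> of squared norms, and the parallelogram law turns the sum of the
  first-order terms into a quadratic term; this explains the first two summands of \<open>K\<close>.
  Otherwise both norms are at most a multiple of \<open>norm t\<close>, which explains the
  third.\<close>

lemma powr_two_smooth:
  fixes s t :: "'a::real_inner"
  assumes p: "2 \<le> p"
  defines "K \<equiv> p + 9 * p\<^sup>2 / 2 + 2 * (1 + 3 * p / 2) powr p"
  shows "norm (s + t) powr p + norm (s - t) powr p
    \<le> 2 * norm s powr p + K * (norm s powr (p - 2) * (norm t)\<^sup>2 + norm t powr p)"
\<comment> \<open>The threshold ensures \<open>p / 2 * w \<le> 1\<close>, as the quadratic bound for
  powers requires, since \<open>w\<close> is at most \<open>3 * \<tau>\<close>.\<close>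
proof (cases "norm s \<noteq> 0 \<and> 3 * p * norm t \<le> 2 * norm s")
  case True
  then have s: "0 < norm s"
    by simp
  define \<tau> where "\<tau> = norm t / norm s"
  have \<tau>: "0 \<le> \<tau>" "3 * p * \<tau> \<le> 2"
    using True by (auto simp: \<tau>_def field_simps)
  have "6 * \<tau> \<le> 3 * p * \<tau>"
    using p \<tau>(1) by (intro mult_right_mono) auto
  then have \<tau>1: "\<tau> \<le> 1"
    using \<tau> by linarith
  have bound: "norm z powr p \<le> norm s powr p * (1 + p / 2 * w + 9 * p\<^sup>2 / 4 * \<tau>\<^sup>2)"
    if z: "norm s - norm t \<le> norm z" "norm z \<le> norm s + norm t"
      and w: "w = (norm z / norm s)\<^sup>2 - 1" for z :: 'a and w
  proof -
    have \<zeta>: "1 - \<tau> \<le> norm z / norm s" "norm z / norm s \<le> 1 + \<tau>"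
      using divide_right_mono[OF z(1), of "norm s"] divide_right_mono[OF z(2), of "norm s"] s
      by (simp_all add: \<tau>_def diff_divide_distrib add_divide_distrib)
    have "(norm z / norm s)\<^sup>2 \<le> (1 + \<tau>)\<^sup>2" "(1 - \<tau>)\<^sup>2 \<le> (norm z / norm s)\<^sup>2"
      using \<zeta> \<tau> \<tau>1 by (auto intro!: power_mono)
    moreover have "\<tau>\<^sup>2 \<le> \<tau>"
      using \<tau> \<tau>1 by (simp add: power2_eq_square mult_left_le)
    moreover have "(1 + \<tau>)\<^sup>2 = 1 + 2 * \<tau> + \<tau>\<^sup>2" "(1 - \<tau>)\<^sup>2 = 1 - 2 * \<tau> + \<tau>\<^sup>2"
      by (simp_all add: power2_sum power2_diff)
    ultimately have "w \<le> 3 * \<tau>" "- (3 * \<tau>) \<le> w"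
      using \<tau>(1) zero_le_power2[of \<tau>] unfolding w by linarith+
    then have "\<bar>p / 2 * w\<bar> \<le> p / 2 * (3 * \<tau>)"
      using p by (simp add: abs_mult)
    moreover from this have "(p / 2 * w)\<^sup>2 \<le> (p / 2 * (3 * \<tau>))\<^sup>2"
      by (rule power2_le_iff_abs_le[THEN iffD2, rotated]) (use p \<tau>(1) in simp)
    moreover have "p / 2 * (3 * \<tau>) = 3 * p * \<tau> / 2"
      by simp
    ultimately have pw: "p / 2 * w \<le> 1" "(p / 2 * w)\<^sup>2 \<le> (p / 2 * (3 * \<tau>))\<^sup>2"
      using \<tau>(2) by linarith+
    have "norm z powr p = norm s powr p * (norm z / norm s) powr p"
      using s by (simp add: powr_divide)
    also have "(norm z / norm s) powr p = (1 + w) powr (p / 2)"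
      using s by (cases "z = 0") (simp_all add: w powr_powr flip: powr_numeral)
    also have "norm s powr p * (1 + w) powr (p / 2) \<le> norm s powr p * (1 + p / 2 * w + (p / 2 * w)\<^sup>2)"
      using p pw(1) unfolding w by (intro mult_left_mono one_add_powr_le) auto
    also have "\<dots> \<le> norm s powr p * (1 + p / 2 * w + (p / 2 * (3 * \<tau>))\<^sup>2)"
      using pw(2) by (intro mult_left_mono) auto
    finally show ?thesis
      by (simp add: power_mult_distrib power_divide mult.commute mult.left_commute)
  qed
  \<comment> \<open>Squared norms satisfy an exact identity: the parts of \<open>w1\<close> and
    \<open>w2\<close> that are linear in \<open>t\<close> cancel in the sum.\<close>
  define w1 w2 where "w1 = (norm (s + t) / norm s)\<^sup>2 - 1" and "w2 = (norm (s - t) / norm s)\<^sup>2 - 1"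
  have "w1 + w2 = ((norm (s + t))\<^sup>2 + (norm (s - t))\<^sup>2) / (norm s)\<^sup>2 - 2"
    by (simp add: w1_def w2_def power_divide add_divide_distrib)
  also have "(norm (s + t))\<^sup>2 + (norm (s - t))\<^sup>2 = 2 * (norm s)\<^sup>2 + 2 * (norm t)\<^sup>2"
    by (simp add: power2_norm_eq_inner inner_add inner_diff inner_commute)
  also have "\<dots> / (norm s)\<^sup>2 - 2 = 2 * \<tau>\<^sup>2"
    using s by (simp add: \<tau>_def power_divide add_divide_distrib)
  finally have w: "w1 + w2 = 2 * \<tau>\<^sup>2" .
  have "norm (s + t) powr p \<le> norm s powr p * (1 + p / 2 * w1 + 9 * p\<^sup>2 / 4 * \<tau>\<^sup>2)"
    using norm_diff_ineq[of s t] norm_triangle_ineq[of s t] by (intro bound) (simp_all add: w1_def)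
  moreover have "norm (s - t) powr p \<le> norm s powr p * (1 + p / 2 * w2 + 9 * p\<^sup>2 / 4 * \<tau>\<^sup>2)"
    using norm_triangle_ineq2[of s t] norm_triangle_ineq4[of s t] by (intro bound) (simp_all add: w2_def)
  ultimately have "norm (s + t) powr p + norm (s - t) powr p
      \<le> norm s powr p * (1 + p / 2 * w1 + 9 * p\<^sup>2 / 4 * \<tau>\<^sup>2)
        + norm s powr p * (1 + p / 2 * w2 + 9 * p\<^sup>2 / 4 * \<tau>\<^sup>2)"
    by (rule add_mono)
  also have "\<dots> = norm s powr p * (2 + p / 2 * (w1 + w2) + 9 * p\<^sup>2 / 2 * \<tau>\<^sup>2)"
    by (simp add: algebra_simps)
  also have "\<dots> = 2 * norm s powr p + (p + 9 * p\<^sup>2 / 2) * (norm s powr p * \<tau>\<^sup>2)"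
    unfolding w by (simp add: algebra_simps)
  also have "norm s powr p * \<tau>\<^sup>2 = norm s powr (p - 2) * (norm t)\<^sup>2"
    using s by (simp add: \<tau>_def powr_diff power_divide)
  also have "2 * norm s powr p + (p + 9 * p\<^sup>2 / 2) * (norm s powr (p - 2) * (norm t)\<^sup>2)
      \<le> 2 * norm s powr p + K * (norm s powr (p - 2) * (norm t)\<^sup>2 + norm t powr p)"
    using p unfolding K_def by (intro add_left_mono mult_mono) auto
  finally show ?thesis .
next
  case False
  then have "norm s \<le> 3 * p / 2 * norm t"
    using p by auto
  then have t: "norm s + norm t \<le> (1 + 3 * p / 2) * norm t"
    by (simp add: algebra_simps)
  have "norm (s + t) powr p \<le> ((1 + 3 * p / 2) * norm t) powr p"
      "norm (s - t) powr p \<le> ((1 + 3 * p / 2) * norm t) powr p"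
    using p t norm_triangle_ineq[of s t] norm_triangle_ineq4[of s t] by (auto intro!: powr_mono2)
  then have "norm (s + t) powr p + norm (s - t) powr p \<le> 2 * (1 + 3 * p / 2) powr p * norm t powr p"
    using p by (simp add: powr_mult)
  also have "\<dots> \<le> K * (norm s powr (p - 2) * (norm t)\<^sup>2 + norm t powr p)"
    using p unfolding K_def by (intro mult_mono) auto
  finally show ?thesis
    by (simp add: add_increasing)
qed

text \<open>The pointwise estimate is summed, with \<open>a powr p \<le> a^2\<close> bringing all
  errors to order a^2. The sums of the powers of x and u contribute 1 and 2, which is the 3 in the
  final constant. The Young estimate returns to norms, and
  \<open>2 / p + 2 * (1 - 1 / p) = 2\<close> preserves the leading term.\<close>

lemma nrm_ell_two_smooth:
  assumes p: "2 \<le> p"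
  obtains K where "0 \<le> K"
    "\<And>x u a. summable (\<lambda>n. norm (x n :: 'k::{real_normed_field, real_inner}) powr p) \<Longrightarrow>
      summable (\<lambda>n. norm (u n) powr p) \<Longrightarrow> nrm (ell TYPE('k) (ereal p)) x \<le> 1 \<Longrightarrow>
      nrm (ell TYPE('k) (ereal p)) u \<le> 1 \<Longrightarrow> 0 \<le> a \<Longrightarrow> a \<le> 1 \<Longrightarrow>
      nrm (ell TYPE('k) (ereal p)) (\<lambda>n. x n + of_real a * u n)
      + nrm (ell TYPE('k) (ereal p)) (\<lambda>n. x n - of_real a * u n) \<le> 2 + K * a\<^sup>2"
proof -
  define K where "K = p + 9 * p\<^sup>2 / 2 + 2 * (1 + 3 * p / 2) powr p"
  have K: "0 \<le> K"
    using p by (simp add: K_def)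
  have main: "nrm (ell TYPE('k) (ereal p)) (\<lambda>n. x n + of_real a * u n)
      + nrm (ell TYPE('k) (ereal p)) (\<lambda>n. x n - of_real a * u n) \<le> 2 + 3 * K * a\<^sup>2"
    if x: "summable (\<lambda>n. norm (x n) powr p)" and u: "summable (\<lambda>n. norm (u n) powr p)"
      and x1: "nrm (ell TYPE('k) (ereal p)) x \<le> 1" and u1: "nrm (ell TYPE('k) (ereal p)) u \<le> 1"
      and a: "0 \<le> a" "a \<le> 1" for x u :: "nat \<Rightarrow> 'k" and a :: real
  proof -
    have le1: "(\<Sum>n. norm (z n) powr p) \<le> 1"
      if "summable (\<lambda>n. norm (z n) powr p)" "nrm (ell TYPE('k) (ereal p)) z \<le> 1" for z :: "nat \<Rightarrow> 'k"
      using nrm_ell_powr[OF _ that(1)] p powr_mono2[OF _ nrm_ell_nonneg that(2), of p] by simp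
    have au: "summable (\<lambda>n. norm (c * u n) powr p)" for c
      using smul_ell(1)[OF _ u] p by simp
    have sums: "summable (\<lambda>n. norm (x n + of_real a * u n) powr p)"
        "summable (\<lambda>n. norm (x n - of_real a * u n) powr p)"
      using summable_add_powr[OF _ x au, of "of_real a"] summable_add_powr[OF _ x au, of "- of_real a"] p
      by auto
    have termwise: "norm (x n + of_real a * u n) powr p + norm (x n - of_real a * u n) powr p
        \<le> 2 * norm (x n) powr p + K * a\<^sup>2 * (norm (x n) powr p + 2 * norm (u n) powr p)" for n
    proof -
      have "norm (x n + of_real a * u n) powr p + norm (x n - of_real a * u n) powr p
          \<le> 2 * norm (x n) powr p + K * (norm (x n) powr (p - 2) * (norm (of_real a * u n))\<^sup>2
            + norm (of_real a * u n) powr p)"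
        unfolding K_def by (rule powr_two_smooth[OF p])
      also have "\<dots> = 2 * norm (x n) powr p + K * (a\<^sup>2 * (norm (x n) powr (p - 2) * (norm (u n))\<^sup>2)
            + a powr p * norm (u n) powr p)"
        using a by (simp add: norm_mult power_mult_distrib powr_mult)
      also have "\<dots> \<le> 2 * norm (x n) powr p + K * (a\<^sup>2 * (norm (x n) powr p + norm (u n) powr p)
            + a\<^sup>2 * norm (u n) powr p)"
      proof (intro add_left_mono mult_left_mono add_mono mult_right_mono K)
        show "a powr p \<le> a\<^sup>2"
        proof (cases "a = 0")
          case False
          then show ?thesis
            using a p powr_mono'[of 2 p a] by simp
        qed simp
        show "norm (x n) powr (p - 2) * (norm (u n))\<^sup>2 \<le> norm (x n) powr p + norm (u n) powr p"
        proof -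
          \<comment> \<open>The mixed product is at most the p-th power of the larger factor, so no
            Hoelder inequality is called for when summing.\<close>
          define M where "M = max (norm (x n)) (norm (u n))"
          have "norm (x n) powr (p - 2) * (norm (u n))\<^sup>2 \<le> M powr (p - 2) * M\<^sup>2"
            using p by (intro mult_mono powr_mono2 power_mono) (auto simp: M_def)
          also have "\<dots> = M powr p"
          proof -
            have "0 \<le> M"
              by (simp add: M_def le_max_iff_disj)
            then show ?thesis
              by (cases "M = 0") (simp_all add: powr_diff)
          qed
          also have "\<dots> \<le> norm (x n) powr p + norm (u n) powr p"
            by (auto simp: M_def max_def)
          finally show ?thesis .
        qed
      qed auto
      finally show ?thesis
        by (simp add: algebra_simps)
    qed
    define N1 N2 where "N1 = nrm (ell TYPE('k) (ereal p)) (\<lambda>n. x n + of_real a * u n)"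
      and "N2 = nrm (ell TYPE('k) (ereal p)) (\<lambda>n. x n - of_real a * u n)"
    have "N1 powr p + N2 powr p
        = (\<Sum>n. norm (x n + of_real a * u n) powr p + norm (x n - of_real a * u n) powr p)"
      unfolding N1_def N2_def using sums p by (simp add: nrm_ell_powr suminf_add)
    also have "\<dots> \<le> (\<Sum>n. 2 * norm (x n) powr p + K * a\<^sup>2 * (norm (x n) powr p + 2 * norm (u n) powr p))"
      using sums x u by (intro suminf_le termwise summable_add summable_mult)
    also have "\<dots> = 2 * (\<Sum>n. norm (x n) powr p)
        + K * a\<^sup>2 * ((\<Sum>n. norm (x n) powr p) + 2 * (\<Sum>n. norm (u n) powr p))"
      using x u by (simp add: suminf_add[symmetric] suminf_mult summable_add summable_mult)
    also have "\<dots> \<le> 2 * 1 + K * a\<^sup>2 * (1 + 2 * 1)"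
      using K le1[OF x x1] le1[OF u u1] by (intro add_mono mult_left_mono) auto
    finally have "(N1 powr p + N2 powr p) / p \<le> (2 + 3 * K * a\<^sup>2) / p"
      using p by (intro divide_right_mono) auto
    moreover have "3 * K * a\<^sup>2 / p \<le> 3 * K * a\<^sup>2 / 1"
      using p K by (intro divide_left_mono) auto
    moreover have "N1 \<le> N1 powr p / p + (1 - 1 / p)" "N2 \<le> N2 powr p / p + (1 - 1 / p)"
      using p by (auto simp: N1_def N2_def nrm_ell_nonneg intro!: le_powr_Young)
    ultimately show ?thesis
      by (simp add: N1_def N2_def add_divide_distrib)
  qed
  show ?thesis
    by (rule that[of "3 * K"]) (use K main in auto)
qed

section \<open>Norm convergence of bilinear forms\<close>

lemma homogeneous_pair_ell:
  assumes "1 \<le> p" "1 \<le> q"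
  shows "homogeneous_pair (ell TYPE('k::real_normed_field) p) (ell TYPE('k) q)"
  using homogeneous_ell[OF assms(1)] homogeneous_ell[OF assms(2)] by unfold_locales auto

lemma ell_form_rules:
  fixes p q :: real
  assumes "B \<in> bilinear_forms (ell TYPE('k::real_normed_field) (ereal p)) (ell TYPE('k) (ereal q))"
    and "summable (\<lambda>n. norm (x n) powr p)" "summable (\<lambda>n. norm (y n) powr q)"
  shows "summable (\<lambda>n. norm (x' n) powr p) \<Longrightarrow> B (\<lambda>n. x n + x' n) y = B x y + B x' y"
    "summable (\<lambda>n. norm (y' n) powr q) \<Longrightarrow> B x (\<lambda>n. y n + y' n) = B x y + B x y'"
    "B (\<lambda>n. a * x n) y = a * B x y"
    "B x (\<lambda>n. a * y n) = a * B x y"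
  using assms by (simp_all add: bilinear_forms_def)

lemma forms_le_ellD:
  fixes p q :: real
  assumes "B \<in> forms_le (ell TYPE('k::real_normed_field) (ereal p)) (ell TYPE('k) (ereal q)) C"
    and "summable (\<lambda>n. norm (x n) powr p)" "summable (\<lambda>n. norm (y n) powr q)"
  shows "norm (B x y) \<le> C * (nrm (ell TYPE('k) (ereal p)) x * nrm (ell TYPE('k) (ereal q)) y)"
  using assms by (simp add: forms_le_def)

lemma forms_le_bilinear: "B \<in> forms_le X Y C \<Longrightarrow> B \<in> bilinear_forms X Y"
  by (simp add: forms_le_def)

lemma forms_le_flip: "B \<in> forms_le X Y C \<Longrightarrow> (\<lambda>y x. B x y) \<in> forms_le Y X C"
  by (auto simp: forms_le_def bilinear_forms_def mult.commute)

text \<open>\<open>a = \<kappa> * b\<close> makes the quadratic error a small multiple of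
  \<open>a * b\<close>. Then \<open>b\<close> is taken so small that
  \<open>b powr (q - 2) \<le> c\<close>, which is possible because q > 2, and \<delta> comes last.
  The quadratic terms, \<open>b powr q\<close> and \<delta> each take a third of the right
  side.\<close>

lemma small_parameters:
  fixes K \<eta> q :: real
  assumes K: "0 \<le> K" and \<eta>: "0 < \<eta>" and q: "2 < q"
  obtains a b \<delta> where "0 < a" "a \<le> 1" "0 < b" "b \<le> 1" "0 < \<delta>" "\<delta> < 1"
    "\<delta> + K * a\<^sup>2 + b powr q + K * a\<^sup>2 * b powr q \<le> \<eta> * (a * b)"
proof -
  \<comment> \<open>The factor 6 yields \<open>2 * K * \<kappa> \<le> \<eta> / 3\<close>, where the
    2 also covers the term containing \<open>b powr q\<close>, a number at most 1. Adding 6 keeps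
    the denominator positive when \<open>K\<close> is 0.\<close>
  define \<kappa> where "\<kappa> = min 1 (\<eta> / (6 * K + 6))"
  define c where "c = \<kappa> * \<eta> / 3"
  define b where "b = min 1 (c powr (1 / (q - 2)))"
  define a where "a = \<kappa> * b"
  define \<delta> where "\<delta> = min (1 / 2) (\<eta> * (a * b) / 3)"
  have \<kappa>: "0 < \<kappa>" "\<kappa> \<le> 1" "\<kappa> \<le> \<eta> / (6 * K + 6)"
    using K \<eta> by (auto simp: \<kappa>_def)
  then have "\<kappa> * (6 * K + 6) \<le> \<eta>"
    using K by (simp add: field_simps)
  then have \<kappa>K: "2 * K * \<kappa> \<le> \<eta> / 3"
    using \<kappa>(1) by (simp add: algebra_simps)
  have c: "0 < c"
    using \<kappa>(1) \<eta> by (simp add: c_def)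
  have b: "0 < b" "b \<le> 1"
    using c by (auto simp: b_def)
  have ab: "0 < a * b"
    using b \<kappa> by (simp add: a_def)
  have a: "0 < a" "a \<le> 1"
    using b \<kappa> by (auto simp: a_def intro: mult_le_one)
  have "2 * K * a\<^sup>2 = (2 * K * \<kappa>) * (a * b)"
    by (simp add: a_def power2_eq_square)
  also have "\<dots> \<le> \<eta> / 3 * (a * b)"
    using \<kappa>K ab by (intro mult_right_mono) auto
  finally have A: "2 * K * a\<^sup>2 \<le> \<eta> / 3 * (a * b)" .
  have "b powr (q - 2) \<le> (c powr (1 / (q - 2))) powr (q - 2)"
    using b q by (intro powr_mono2) (auto simp: b_def)
  also have "\<dots> = c"
    using q c by (simp add: powr_powr)
  finally have "b powr (q - 2) * b\<^sup>2 \<le> c * b\<^sup>2"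
    by (intro mult_right_mono) auto
  moreover have "b powr (q - 2) * b\<^sup>2 = b powr q"
    using b by (simp add: powr_diff)
  moreover have "c * b\<^sup>2 = \<eta> / 3 * (a * b)"
    by (simp add: c_def a_def power2_eq_square)
  ultimately have B: "b powr q \<le> \<eta> / 3 * (a * b)"
    by simp
  have "b powr q \<le> 1"
    using b q powr_mono2[of q b 1] by simp
  then have "K * a\<^sup>2 * b powr q \<le> K * a\<^sup>2 * 1"
    using K by (intro mult_left_mono) auto
  moreover have "\<delta> \<le> \<eta> * (a * b) / 3" "0 < \<delta>" "\<delta> < 1"
    using \<eta> ab by (auto simp: \<delta>_def)
  ultimately have "\<delta> + K * a\<^sup>2 + b powr q + K * a\<^sup>2 * b powr q \<le> \<eta> * (a * b)"
    using A B by simp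
  then show ?thesis
    using that a b \<open>0 < \<delta>\<close> \<open>\<delta> < 1\<close> by blast
qed

text \<open>Evaluating a form at \<open>(x + a u, y + b v)\<close> and at \<open>(x - a u, y - b v)\<close> and averaging isolates
  \<open>B x y + a b B u v\<close>. The norm of the first factor grows like \<open>a\<^sup>2\<close> by smoothness, that of the
  second like \<open>b powr q\<close> by disjointness, so that \<open>B u v\<close> is small if \<open>B x y\<close> is almost maximal.\<close>

lemma almost_norming_tail_small:
  fixes p q \<eta> :: real
  assumes p: "2 < p" and q: "2 < q" and \<eta>: "0 < \<eta>"
  obtains \<delta> where "0 < \<delta>" "\<delta> < 1"
    "\<And>B x y m u v. B \<in> forms_le (ell TYPE('k::{real_normed_field, euclidean_space}) (ereal p)) (ell TYPE('k) (ereal q)) 1 \<Longrightarrow>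
      summable (\<lambda>n. norm (x n) powr p) \<Longrightarrow> nrm (ell TYPE('k) (ereal p)) x \<le> 1 \<Longrightarrow>
      summable (\<lambda>n. norm (y n) powr q) \<Longrightarrow> nrm (ell TYPE('k) (ereal q)) y \<le> 1 \<Longrightarrow>
      (\<And>n. m \<le> n \<Longrightarrow> y n = 0) \<Longrightarrow> 1 - \<delta> \<le> norm (B x y) \<Longrightarrow>
      summable (\<lambda>n. norm (u n) powr p) \<Longrightarrow> summable (\<lambda>n. norm (v n) powr q) \<Longrightarrow>
      norm (B u (tail m v)) \<le> \<eta> * (nrm (ell TYPE('k) (ereal p)) u * nrm (ell TYPE('k) (ereal q)) v)"
proof -
  let ?X = "ell TYPE('k) (ereal p)" and ?Y = "ell TYPE('k) (ereal q)"
  obtain K where K: "0 \<le> K" and smooth: "\<And>x u a. summable (\<lambda>n. norm (x n :: 'k) powr p) \<Longrightarrow>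
      summable (\<lambda>n. norm (u n) powr p) \<Longrightarrow> nrm ?X x \<le> 1 \<Longrightarrow> nrm ?X u \<le> 1 \<Longrightarrow> 0 \<le> a \<Longrightarrow> a \<le> 1 \<Longrightarrow>
      nrm ?X (\<lambda>n. x n + of_real a * u n) + nrm ?X (\<lambda>n. x n - of_real a * u n) \<le> 2 + K * a\<^sup>2"
    by (rule nrm_ell_two_smooth[of p]) (use p in auto)
  \<comment> \<open>\<open>K\<close> is halved because the smoothness estimate concerns a sum of two
    norms, of which the average is taken.\<close>
  have K2: "0 \<le> K / 2"
    using K by simp
  obtain a b \<delta> where a: "0 < a" "a \<le> 1" and b: "0 < b" "b \<le> 1" and \<delta>: "0 < \<delta>" "\<delta> < 1"
    and small: "\<delta> + K / 2 * a\<^sup>2 + b powr q + K / 2 * a\<^sup>2 * b powr q \<le> \<eta> * (a * b)"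
    by (rule small_parameters[OF K2 \<eta> q])
  have unit: "norm (B u v) \<le> \<eta>"
    if B: "B \<in> forms_le ?X ?Y 1"
      and x: "summable (\<lambda>n. norm (x n) powr p)" "nrm ?X x \<le> 1"
      and y: "summable (\<lambda>n. norm (y n) powr q)" "nrm ?Y y \<le> 1"
      and Bxy: "1 - \<delta> \<le> norm (B x y)"
      and u: "summable (\<lambda>n. norm (u n) powr p)" "nrm ?X u \<le> 1"
      and v: "summable (\<lambda>n. norm (v n) powr q)" "nrm ?Y v \<le> 1"
      and disj: "\<And>n. y n = 0 \<or> v n = 0" for B x y u v
  proof -
    note rules = ell_form_rules[OF forms_le_bilinear[OF B]]
    \<comment> \<open>The unimodular factors make the two main terms nonnegative reals, so that they
      add up without cancellation and the real part loses nothing.\<close>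
    obtain c where c: "norm c = 1" "c * B x y = of_real (norm (B x y))"
      by (rule unimodular_rotation)
    obtain d where d: "norm d = 1" "d * B u v = of_real (norm (B u v))"
      by (rule unimodular_rotation)
    define x' u' where "x' = (\<lambda>n. c * x n)" and "u' = (\<lambda>n. d * u n)"
    have x': "summable (\<lambda>n. norm (x' n) powr p)" "nrm ?X x' \<le> 1"
      and u': "summable (\<lambda>n. norm (u' n) powr p)" "nrm ?X u' \<le> 1"
      using smul_ell[of p x c] smul_ell[of p u d] x u c d p by (auto simp: x'_def u'_def)
    have eval: "1 \<bullet> B (\<lambda>n. x' n + of_real (s * a) * u' n) (\<lambda>n. y n + of_real (s * b) * v n)
        = norm (B x y) + s * (a * (1 \<bullet> B u' y) + b * (1 \<bullet> B x' v)) + s\<^sup>2 * (a * b * norm (B u v))" for s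
    proof -
      have su: "summable (\<lambda>n. norm (of_real (s * a) * u' n) powr p)"
        and sv: "summable (\<lambda>n. norm (of_real (s * b) * v n) powr q)"
        using smul_ell(1)[of p u' "of_real (s * a)"] smul_ell(1)[of q v "of_real (s * b)"] u' v p q by auto
      have yv: "summable (\<lambda>n. norm (y n + of_real (s * b) * v n) powr q)"
        using summable_add_powr[OF _ y(1) sv] q by simp
      have "B (\<lambda>n. x' n + of_real (s * a) * u' n) (\<lambda>n. y n + of_real (s * b) * v n)
          = B x' y + of_real (s * b) * B x' v + of_real (s * a) * (B u' y + of_real (s * b) * B u' v)"
        using rules(1)[OF x'(1) yv su] rules(3)[OF u'(1) yv] rules(2)[OF x'(1) y(1) sv]
          rules(2)[OF u'(1) y(1) sv] rules(4)[OF x'(1) v(1)] rules(4)[OF u'(1) v(1)] by simp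
      moreover have "B x' y = of_real (norm (B x y))" "B u' v = of_real (norm (B u v))"
        using rules(3)[OF x(1) y(1), of c] rules(3)[OF u(1) v(1), of d] c d
        by (simp_all add: x'_def u'_def)
      ultimately have eq: "B (\<lambda>n. x' n + of_real (s * a) * u' n) (\<lambda>n. y n + of_real (s * b) * v n)
          = of_real (norm (B x y)) + of_real (s * a) * B u' y + of_real (s * b) * B x' v
            + of_real (s * a * (s * b) * norm (B u v))"
        by (simp add: algebra_simps)
      have re_mult: "1 \<bullet> (of_real r * z) = r * (1 \<bullet> z)" for r and z :: 'k
        by (simp flip: scaleR_conv_of_real)
      show ?thesis
        unfolding eq inner_add_right re_mult inner_one_of_real
        by (simp add: power2_eq_square algebra_simps)
    qed
    have bound: "1 \<bullet> B (\<lambda>n. x' n + of_real (s * a) * u' n) (\<lambda>n. y n + of_real (s * b) * v n)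
        \<le> nrm ?X (\<lambda>n. x' n + of_real (s * a) * u' n) * (1 + b powr q)" if s: "\<bar>s\<bar> = 1" for s
    proof -
      have sums: "summable (\<lambda>n. norm (x' n + of_real (s * a) * u' n) powr p)"
        "summable (\<lambda>n. norm (y n + of_real (s * b) * v n) powr q)"
        using smul_ell(1)[of p u' "of_real (s * a)"] smul_ell(1)[of q v "of_real (s * b)"] u' v p q x' y
        by (auto intro!: summable_add_powr)
      have "nrm ?Y (\<lambda>n. y n + of_real (s * b) * v n) \<le> 1 + \<bar>s * b\<bar> powr q"
        by (rule nrm_ell_disjoint_le[OF _ y v disj]) (use q in simp)
      then have "nrm ?Y (\<lambda>n. y n + of_real (s * b) * v n) \<le> 1 + b powr q"
        using s b by (simp add: abs_mult)
      then have "nrm ?X (\<lambda>n. x' n + of_real (s * a) * u' n) * nrm ?Y (\<lambda>n. y n + of_real (s * b) * v n)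
          \<le> nrm ?X (\<lambda>n. x' n + of_real (s * a) * u' n) * (1 + b powr q)"
        by (intro mult_left_mono nrm_ell_nonneg)
      then show ?thesis
        using forms_le_ellD[OF B sums]
          inner_one_le[of "B (\<lambda>n. x' n + of_real (s * a) * u' n) (\<lambda>n. y n + of_real (s * b) * v n)"]
        by linarith
    qed
    have "2 * norm (B x y) + 2 * (a * b * norm (B u v))
        \<le> (nrm ?X (\<lambda>n. x' n + of_real a * u' n) + nrm ?X (\<lambda>n. x' n - of_real a * u' n)) * (1 + b powr q)"
      using eval[of 1] eval[of "- 1"] bound[of 1] bound[of "- 1"] by (simp add: distrib_right)
    also have "\<dots> \<le> (2 + K * a\<^sup>2) * (1 + b powr q)"
      using smooth[OF x'(1) u'(1) x'(2) u'(2)] a by (intro mult_right_mono) auto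
    finally have "a * b * norm (B u v) \<le> \<delta> + K / 2 * a\<^sup>2 + b powr q + K / 2 * a\<^sup>2 * b powr q"
      using Bxy by (simp add: algebra_simps)
    also note small
    finally show "norm (B u v) \<le> \<eta>"
      using a b by (simp add: mult.commute)
  qed
  show ?thesis
  proof (rule that[OF \<delta>])
    fix B m and x y u v :: "nat \<Rightarrow> 'k"
    assume B: "B \<in> forms_le ?X ?Y 1"
      and x: "summable (\<lambda>n. norm (x n) powr p)" "nrm ?X x \<le> 1"
      and y: "summable (\<lambda>n. norm (y n) powr q)" "nrm ?Y y \<le> 1" "\<And>n. m \<le> n \<Longrightarrow> y n = 0"
      and Bxy: "1 - \<delta> \<le> norm (B x y)"
      and u: "summable (\<lambda>n. norm (u n) powr p)" and v: "summable (\<lambda>n. norm (v n) powr q)"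
    note rules = ell_form_rules[OF forms_le_bilinear[OF B]]
    define U W where "U = nrm ?X u" and "W = nrm ?Y v"
    have tv: "summable (\<lambda>n. norm (tail m v n) powr q)" "nrm ?Y (tail m v) \<le> W"
      unfolding W_def using tail_ell[OF _ v] q by auto
    show "norm (B u (tail m v)) \<le> \<eta> * (nrm ?X u * nrm ?Y v)"
    \<comment> \<open>Normalisation requires nonzero norms; if one of them is 0, boundedness of
      \<open>B\<close> already makes the value 0.\<close>
    proof (cases "U = 0 \<or> W = 0")
      case True
      have "U * nrm ?Y (tail m v) = 0"
        using True tv(2) nrm_ell_nonneg[of q "tail m v"] by auto
      then have "norm (B u (tail m v)) \<le> 0"
        using forms_le_ellD[OF B u tv(1)] by (simp only: U_def mult_1)
      also have "0 \<le> \<eta> * (nrm ?X u * nrm ?Y v)"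
        using \<eta> by (simp add: nrm_ell_nonneg)
      finally show ?thesis .
    next
      case False
      then have UW: "0 < U" "0 < W"
        using nrm_ell_nonneg[of p u] nrm_ell_nonneg[of q v] by (auto simp: U_def W_def)
      have u': "summable (\<lambda>n. norm (of_real (1 / U) * u n) powr p)"
        "nrm ?X (\<lambda>n. of_real (1 / U) * u n) \<le> 1"
        using smul_ell[OF _ u, of "of_real (1 / U)"] p UW by (auto simp: U_def norm_divide)
      have v': "summable (\<lambda>n. norm (of_real (1 / W) * tail m v n) powr q)"
        "nrm ?Y (\<lambda>n. of_real (1 / W) * tail m v n) \<le> 1"
        using smul_ell[OF _ tv(1), of "of_real (1 / W)"] q UW tv(2) by (auto simp: norm_divide)
      have "norm (B (\<lambda>n. of_real (1 / U) * u n) (\<lambda>n. of_real (1 / W) * tail m v n)) \<le> \<eta>"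
      proof (rule unit[OF B x y(1,2) Bxy u' v'])
        show "y n = 0 \<or> of_real (1 / W) * tail m v n = 0" for n
          using y(3)[of n] by (simp add: tail_def)
      qed
      then have "norm (B u (tail m v)) / (U * W) \<le> \<eta>"
        using rules(3)[OF u v'(1), of "of_real (1 / U)"] rules(4)[OF u tv(1), of "of_real (1 / W)"] UW
        by (simp add: norm_mult norm_divide mult.commute)
      then show ?thesis
        using UW by (simp add: U_def[symmetric] W_def[symmetric] field_simps)
    qed
  qed
qed

text \<open>One unit vector at a time is split off, in each variable separately. This is how
  convergence of entries becomes convergence on heads.\<close>

lemma form_head_sum:
  fixes p q :: real
  assumes p: "0 < p" and q: "0 < q"
    and B: "B \<in> bilinear_forms (ell TYPE('k::real_normed_field) (ereal p)) (ell TYPE('k) (ereal q))"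
    and x: "summable (\<lambda>n. norm (x n) powr p)" and y: "summable (\<lambda>n. norm (y n) powr q)"
  shows "B (head m x) (head m y) = (\<Sum>i<m. \<Sum>j<m. x i * (y j * B (unit_seq i) (unit_seq j)))"
proof -
  have step: "head (Suc m) z = (\<lambda>n. head m z n + z m * unit_seq m n)" for m and z :: "nat \<Rightarrow> 'k"
    by (auto simp: head_def unit_seq_def fun_eq_iff less_Suc_eq)
  have zero: "head 0 z = (\<lambda>n. 0 * z n)" for z :: "nat \<Rightarrow> 'k"
    by (simp add: head_def)
  have units: "summable (\<lambda>n. norm (c * unit_seq i n :: 'k) powr r)" if "0 < r" for r c i
    by (rule smul_ell[OF that unit_seq_ell(1)[OF that]])
  have left: "B (head m x) z = (\<Sum>i<m. x i * B (unit_seq i) z)" if z: "summable (\<lambda>n. norm (z n) powr q)" for z m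
  proof (induction m)
    case 0
    then show ?case
      using ell_form_rules(3)[OF B x z, of 0] unfolding zero by simp
  next
    case (Suc m)
    then show ?case
      unfolding step
      using ell_form_rules(1)[OF B head_ell(1)[OF p x] z units[OF p]]
        ell_form_rules(3)[OF B unit_seq_ell(1)[OF p] z] by simp
  qed
  have right: "B z (head m y) = (\<Sum>j<m. y j * B z (unit_seq j))" if z: "summable (\<lambda>n. norm (z n) powr p)" for z m
  proof (induction m)
    case 0
    then show ?case
      using ell_form_rules(4)[OF B z y, of 0] unfolding zero by simp
  next
    case (Suc m)
    then show ?case
      unfolding step
      using ell_form_rules(2)[OF B z head_ell(1)[OF q y] units[OF q]]
        ell_form_rules(4)[OF B z unit_seq_ell(1)[OF q]] by simp
  qed
  show ?thesis
    using left[OF head_ell(1)[OF q y], of m m] right[OF unit_seq_ell(1)[OF p]]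
    by (simp add: sum_distrib_left)
qed

text \<open>The last block keeps all of \<open>x\<close> while the middle one keeps only the head of
  \<open>y\<close>, so the three blocks do not overlap and each infinite block is a tail in one
  variable, as the tail estimate expects.\<close>

lemma form_head_tail:
  fixes p q :: real
  assumes p: "0 < p" and q: "0 < q"
    and B: "B \<in> bilinear_forms (ell TYPE('k::real_normed_field) (ereal p)) (ell TYPE('k) (ereal q))"
    and x: "summable (\<lambda>n. norm (x n) powr p)" and y: "summable (\<lambda>n. norm (y n) powr q)"
  shows "B x y = B (head m x) (head m y) + B (tail m x) (head m y) + B x (tail m y)"
proof -
  have split: "z = (\<lambda>n. head m z n + tail m z n)" for z :: "nat \<Rightarrow> 'k"
    by (auto simp: head_def tail_def)
  have "B x y = B x (head m y) + B x (tail m y)"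
    using ell_form_rules(2)[OF B x head_ell(1)[OF q y] tail_ell(1)[OF q y], of m m] split[of y] by simp
  also have "B x (head m y) = B (head m x) (head m y) + B (tail m x) (head m y)"
    using ell_form_rules(1)[OF B head_ell(1)[OF p x] head_ell(1)[OF q y] tail_ell(1)[OF p x], of m m m]
      split[of x] by simp
  finally show ?thesis
    by simp
qed

text \<open>The bound does not involve \<open>B\<close>: truncation is uniform over the unit ball of
  forms.\<close>

lemma form_head_diff_le:
  fixes p q :: real
  assumes p: "0 < p" and q: "0 < q"
    and B: "B \<in> forms_le (ell TYPE('k::real_normed_field) (ereal p)) (ell TYPE('k) (ereal q)) 1"
    and x: "summable (\<lambda>n. norm (x n) powr p)" and y: "summable (\<lambda>n. norm (y n) powr q)"
  shows "norm (B x y - B (head m x) (head m y))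
    \<le> nrm (ell TYPE('k) (ereal p)) (tail m x) * nrm (ell TYPE('k) (ereal q)) y
      + nrm (ell TYPE('k) (ereal p)) x * nrm (ell TYPE('k) (ereal q)) (tail m y)"
proof -
  let ?X = "ell TYPE('k) (ereal p)" and ?Y = "ell TYPE('k) (ereal q)"
  have "norm (B x y - B (head m x) (head m y)) = norm (B (tail m x) (head m y) + B x (tail m y))"
    using form_head_tail[OF p q forms_le_bilinear[OF B] x y, of m] by simp
  also have "\<dots> \<le> norm (B (tail m x) (head m y)) + norm (B x (tail m y))"
    by (rule norm_triangle_ineq)
  also have "norm (B (tail m x) (head m y)) \<le> nrm ?X (tail m x) * nrm ?Y (head m y)"
    using forms_le_ellD[OF B tail_ell(1)[OF p x] head_ell(1)[OF q y], of m m] by simp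
  also have "\<dots> \<le> nrm ?X (tail m x) * nrm ?Y y"
    by (intro mult_left_mono head_ell(2)[OF q y] nrm_ell_nonneg)
  also have "norm (B x (tail m y)) \<le> nrm ?X x * nrm ?Y (tail m y)"
    using forms_le_ellD[OF B x tail_ell(1)[OF q y], of m] by simp
  finally show ?thesis
    by simp
qed

lemma tendsto_head_error:
  fixes p q :: real
  assumes p: "0 < p" and q: "0 < q"
    and x: "summable (\<lambda>n. norm (x n :: 'k::real_normed_field) powr p)"
    and y: "summable (\<lambda>n. norm (y n :: 'k) powr q)"
  shows "(\<lambda>m. nrm (ell TYPE('k) (ereal p)) (tail m x) * nrm (ell TYPE('k) (ereal q)) y
      + nrm (ell TYPE('k) (ereal p)) x * nrm (ell TYPE('k) (ereal q)) (tail m y)) \<longlonglongrightarrow> 0"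
  using tendsto_add[OF tendsto_mult_right[OF tendsto_tail_ell[OF p x]]
      tendsto_mult_left[OF tendsto_tail_ell[OF q y]]] by simp

section \<open>Sequential compactness of the unit ball of forms\<close>

lemma forms_le_limit:
  assumes Bn: "\<And>n. Bn n \<in> forms_le X Y C"
    and add_X: "\<And>x x'. x \<in> points X \<Longrightarrow> x' \<in> points X \<Longrightarrow> vadd X x x' \<in> points X"
    and add_Y: "\<And>y y'. y \<in> points Y \<Longrightarrow> y' \<in> points Y \<Longrightarrow> vadd Y y y' \<in> points Y"
    and smul_X: "\<And>a x. x \<in> points X \<Longrightarrow> smul X a x \<in> points X"
    and smul_Y: "\<And>a y. y \<in> points Y \<Longrightarrow> smul Y a y \<in> points Y"
    and lim: "\<And>x y. x \<in> points X \<Longrightarrow> y \<in> points Y \<Longrightarrow> (\<lambda>n. Bn n x y) \<longlonglongrightarrow> B x y"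
  shows "B \<in> forms_le X Y C"
proof -
  have bil: "Bn n \<in> bilinear_forms X Y" for n
    using Bn forms_le_bilinear by blast
  have "B (vadd X x x') y = B x y + B x' y"
    if "x \<in> points X" "x' \<in> points X" "y \<in> points Y" for x x' y
  proof (rule LIMSEQ_unique[OF lim])
    show "(\<lambda>n. Bn n (vadd X x x') y) \<longlonglongrightarrow> B x y + B x' y"
      using tendsto_add[OF lim lim, of x y x' y] bil that by (simp add: bilinear_forms_def)
  qed (use that add_X in auto)
  moreover have "B x (vadd Y y y') = B x y + B x y'"
    if "x \<in> points X" "y \<in> points Y" "y' \<in> points Y" for x y y'
  proof (rule LIMSEQ_unique[OF lim])
    show "(\<lambda>n. Bn n x (vadd Y y y')) \<longlonglongrightarrow> B x y + B x y'"
      using tendsto_add[OF lim lim, of x y x y'] bil that by (simp add: bilinear_forms_def)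
  qed (use that add_Y in auto)
  moreover have "B (smul X a x) y = a * B x y" if "x \<in> points X" "y \<in> points Y" for a x y
  proof (rule LIMSEQ_unique[OF lim])
    show "(\<lambda>n. Bn n (smul X a x) y) \<longlonglongrightarrow> a * B x y"
      using tendsto_mult_left[OF lim, of x y a] bil that by (simp add: bilinear_forms_def)
  qed (use that smul_X in auto)
  moreover have "B x (smul Y a y) = a * B x y" if "x \<in> points X" "y \<in> points Y" for a x y
  proof (rule LIMSEQ_unique[OF lim])
    show "(\<lambda>n. Bn n x (smul Y a y)) \<longlonglongrightarrow> a * B x y"
      using tendsto_mult_left[OF lim, of x y a] bil that by (simp add: bilinear_forms_def)
  qed (use that smul_Y in auto)
  moreover have "norm (B x y) \<le> C * (nrm X x * nrm Y y)" if "x \<in> points X" "y \<in> points Y" for x y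
    using Lim_bounded[OF tendsto_norm[OF lim[OF that]], of 0] Bn that by (simp add: forms_le_def)
  ultimately show ?thesis
    by (simp add: forms_le_def bilinear_forms_def)
qed

text \<open>There are countably many pairs of unit vectors, so a diagonal subsequence makes all
  entries converge; uniform truncation extends the convergence to all pairs of vectors.\<close>

lemma forms_le_sequentially_compact:
  fixes p q :: real
    and Bn :: "nat \<Rightarrow> (nat \<Rightarrow> 'k) \<Rightarrow> (nat \<Rightarrow> 'k::{real_normed_field, euclidean_space}) \<Rightarrow> 'k"
  assumes p: "1 \<le> p" and q: "1 \<le> q"
  defines "X \<equiv> ell TYPE('k) (ereal p)" and "Y \<equiv> ell TYPE('k) (ereal q)"
  assumes Bn: "\<And>n. Bn n \<in> forms_le X Y 1"
  shows "\<exists>r B. strict_mono (r :: nat \<Rightarrow> nat) \<and> B \<in> forms_le X Y 1 \<and>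
    (\<forall>x\<in>points X. \<forall>y\<in>points Y. (\<lambda>n. Bn (r n) x y) \<longlonglongrightarrow> B x y)"
proof -
  have pq: "0 < p" "0 < q"
    using p q by auto
  note Bn' = Bn[unfolded X_def Y_def]
  let ?e = "unit_seq :: nat \<Rightarrow> nat \<Rightarrow> 'k"
  have bound: "norm (Bn n (?e (fst z)) (?e (snd z))) \<le> 1" for n z
    using forms_le_ellD[OF Bn' unit_seq_ell(1)[OF pq(1)] unit_seq_ell(1)[OF pq(2)]] pq
    by (simp add: unit_seq_ell(2))
  obtain r :: "nat \<Rightarrow> nat" where r: "strict_mono r"
    and conv: "\<And>z. z \<in> UNIV \<Longrightarrow> \<exists>l. (\<lambda>n. Bn (r n) (?e (fst z)) (?e (snd z))) \<longlonglongrightarrow> l"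
    by (rule function_convergent_subsequence[of "UNIV :: (nat \<times> nat) set"
        "\<lambda>n z. Bn n (?e (fst z)) (?e (snd z))" 1]) (rule countableI_type, rule bound, blast)
  have "\<exists>l. (\<lambda>n. Bn (r n) (?e i) (?e j)) \<longlonglongrightarrow> l" for i j
    using conv[of "(i, j)"] by simp
  then obtain l where l: "\<And>i j. (\<lambda>n. Bn (r n) (?e i) (?e j)) \<longlonglongrightarrow> l i j"
    by metis
  have conv: "convergent (\<lambda>n. Bn (r n) x y)" if "x \<in> points X" "y \<in> points Y" for x y
  proof -
    have x: "summable (\<lambda>n. norm (x n) powr p)" and y: "summable (\<lambda>n. norm (y n) powr q)"
      using that by (simp_all add: X_def Y_def)
    have "Cauchy (\<lambda>n. Bn (r n) x y)"
    proof (rule CauchyI)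
      fix e :: real assume e: "0 < e"
      then have "0 < e / 3"
        by simp
      from LIMSEQ_D[OF tendsto_head_error[OF pq x y] this]
      obtain m where m: "norm (nrm X (tail m x) * nrm Y y + nrm X x * nrm Y (tail m y)) < e / 3"
        unfolding X_def Y_def by auto
      \<comment> \<open>The same \<open>m\<close> serves all forms, so that only a finite
        combination of convergent entries remains.\<close>
      have head: "norm (Bn n x y - Bn n (head m x) (head m y)) < e / 3" for n
        using form_head_diff_le[OF pq Bn' x y, of n m] m unfolding X_def Y_def real_norm_def by linarith
      have "(\<lambda>n. Bn (r n) (head m x) (head m y)) \<longlonglongrightarrow> (\<Sum>i<m. \<Sum>j<m. x i * (y j * l i j))"
        unfolding form_head_sum[OF pq forms_le_bilinear[OF Bn'] x y]
        by (intro tendsto_intros l)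
      then have "Cauchy (\<lambda>n. Bn (r n) (head m x) (head m y))"
        by (rule LIMSEQ_imp_Cauchy)
      from CauchyD[OF this \<open>0 < e / 3\<close>] obtain N where N: "\<And>i j. N \<le> i \<Longrightarrow> N \<le> j \<Longrightarrow>
          norm (Bn (r i) (head m x) (head m y) - Bn (r j) (head m x) (head m y)) < e / 3"
        by blast
      have "norm (Bn (r i) x y - Bn (r j) x y) < e" if "N \<le> i" "N \<le> j" for i j
        using norm_diff_le_via[of "Bn (r i) x y" "Bn (r j) x y" "Bn (r i) (head m x) (head m y)"
            "Bn (r j) (head m x) (head m y)"] head[of "r i"] head[of "r j"] N[OF that] by simp
      then show "\<exists>N. \<forall>i\<ge>N. \<forall>j\<ge>N. norm (Bn (r i) x y - Bn (r j) x y) < e"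
        by blast
    qed
    then show ?thesis
      by (rule Cauchy_convergent)
  qed
  define B where "B x y = lim (\<lambda>n. Bn (r n) x y)" for x y
  have lim: "(\<lambda>n. Bn (r n) x y) \<longlonglongrightarrow> B x y" if "x \<in> points X" "y \<in> points Y" for x y
    using conv[OF that] by (simp add: B_def convergent_LIMSEQ_iff)
  have "B \<in> forms_le X Y 1"
  proof (rule forms_le_limit[OF _ _ _ _ _ lim])
    show "Bn (r n) \<in> forms_le X Y 1" for n
      by (rule Bn)
    show "vadd X x x' \<in> points X" if "x \<in> points X" "x' \<in> points X" for x x'
      using that pq by (auto simp: X_def intro: summable_add_powr)
    show "vadd Y x x' \<in> points Y" if "x \<in> points Y" "x' \<in> points Y" for x x'
      using that pq by (auto simp: Y_def intro: summable_add_powr)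
    show "smul X a x \<in> points X" if "x \<in> points X" for a x
      using that smul_ell(1)[OF pq(1)] by (auto simp: X_def)
    show "smul Y a x \<in> points Y" if "x \<in> points Y" for a x
      using that smul_ell(1)[OF pq(2)] by (auto simp: Y_def)
  qed
  then show ?thesis
    using r lim by blast
qed

text \<open>The dual of the tensor product has the Kadec--Klee property: a form of norm one is almost
  attained at finitely supported vectors, and then it and all forms close to it at these vectors
  are determined up to a small error by finitely many coordinates.\<close>

lemma forms_norm_convergence:
  fixes p q :: real
    and Bn :: "nat \<Rightarrow> (nat \<Rightarrow> 'k) \<Rightarrow> (nat \<Rightarrow> 'k::{real_normed_field, euclidean_space}) \<Rightarrow> 'k"
  assumes p: "2 < p" and q: "2 < q"
  defines "X \<equiv> ell TYPE('k) (ereal p)" and "Y \<equiv> ell TYPE('k) (ereal q)"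
  assumes Bn: "\<And>n. Bn n \<in> forms_le X Y 1" and B: "B \<in> forms_le X Y 1"
    and lim: "\<And>x y. x \<in> points X \<Longrightarrow> y \<in> points Y \<Longrightarrow> (\<lambda>n. Bn n x y) \<longlonglongrightarrow> B x y"
    and norm1: "\<And>c. 0 \<le> c \<Longrightarrow> B \<in> forms_le X Y c \<Longrightarrow> 1 \<le> c"
    and e: "0 < e"
  shows "\<exists>n. (\<lambda>x y. Bn n x y - B x y) \<in> forms_le X Y e"
proof -
  have pq: "0 < p" "0 < q"
    using p q by auto
  note B' = B[unfolded X_def Y_def] and Bn' = Bn[unfolded X_def Y_def]
  \<comment> \<open>Five errors are added in the end: one from the finite block, and for each of the
    two infinite blocks one from \<open>Bn n\<close> and one from \<open>B\<close>.\<close>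
  define \<eta> where "\<eta> = e / 5"
  have \<eta>: "0 < \<eta>"
    using e by (simp add: \<eta>_def)
  obtain \<delta>1 where \<delta>1: "0 < \<delta>1" "\<delta>1 < 1" and right:
    "\<And>B x y m u v. B \<in> forms_le X Y 1 \<Longrightarrow>
      summable (\<lambda>n. norm (x n) powr p) \<Longrightarrow> nrm X x \<le> 1 \<Longrightarrow>
      summable (\<lambda>n. norm (y n) powr q) \<Longrightarrow> nrm Y y \<le> 1 \<Longrightarrow>
      (\<And>n. m \<le> n \<Longrightarrow> y n = 0) \<Longrightarrow> 1 - \<delta>1 \<le> norm (B x y) \<Longrightarrow>
      summable (\<lambda>n. norm (u n) powr p) \<Longrightarrow> summable (\<lambda>n. norm (v n) powr q) \<Longrightarrow>
      norm (B u (tail m v)) \<le> \<eta> * (nrm X u * nrm Y v)"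
    unfolding X_def Y_def by (rule almost_norming_tail_small[OF p q \<eta>]) blast
  \<comment> \<open>The estimate for the transposed forms, with exchanged exponents, controls tails
    in the first variable.\<close>
  obtain \<delta>2 where \<delta>2: "0 < \<delta>2" "\<delta>2 < 1" and left:
    "\<And>B x y m u v. B \<in> forms_le Y X 1 \<Longrightarrow>
      summable (\<lambda>n. norm (x n) powr q) \<Longrightarrow> nrm Y x \<le> 1 \<Longrightarrow>
      summable (\<lambda>n. norm (y n) powr p) \<Longrightarrow> nrm X y \<le> 1 \<Longrightarrow>
      (\<And>n. m \<le> n \<Longrightarrow> y n = 0) \<Longrightarrow> 1 - \<delta>2 \<le> norm (B x y) \<Longrightarrow>
      summable (\<lambda>n. norm (u n) powr q) \<Longrightarrow> summable (\<lambda>n. norm (v n) powr p) \<Longrightarrow>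
      norm (B u (tail m v)) \<le> \<eta> * (nrm Y u * nrm X v)"
    unfolding X_def Y_def by (rule almost_norming_tail_small[OF q p \<eta>]) blast
  define \<delta> where "\<delta> = min \<delta>1 \<delta>2"
  have \<delta>: "0 < \<delta>" "\<delta> < 1" "\<delta> \<le> \<delta>1" "\<delta> \<le> \<delta>2"
    using \<delta>1 \<delta>2 by (auto simp: \<delta>_def)
  \<comment> \<open>Norm at least one is used in this form: some pair of vectors exceeds the
    fraction \<open>1 - \<delta>\<close> of the trivial bound.\<close>
  have "B \<notin> forms_le X Y (1 - \<delta>)"
    using norm1[of "1 - \<delta>"] \<delta> by auto
  then obtain x0 y0 where x0: "summable (\<lambda>n. norm (x0 n) powr p)"
    and y0: "summable (\<lambda>n. norm (y0 n) powr q)"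
    and big: "(1 - \<delta>) * (nrm X x0 * nrm Y y0) < norm (B x0 y0)"
    using forms_le_bilinear[OF B] by (auto simp: forms_le_def not_le X_def Y_def)
  \<comment> \<open>The gap leaves room for truncating the pair to finite support, which the tail
    estimate demands; heads have no larger norm, so the fraction survives.\<close>
  have "0 < norm (B x0 y0) - (1 - \<delta>) * (nrm X x0 * nrm Y y0)"
    using big by simp
  from LIMSEQ_D[OF tendsto_head_error[OF pq x0 y0] this]
  obtain m where m: "norm (nrm X (tail m x0) * nrm Y y0 + nrm X x0 * nrm Y (tail m y0))
      < norm (B x0 y0) - (1 - \<delta>) * (nrm X x0 * nrm Y y0)"
    unfolding X_def Y_def by auto
  define x1 y1 where "x1 = head m x0" and "y1 = head m y0"
  have x1: "summable (\<lambda>n. norm (x1 n) powr p)" "nrm X x1 \<le> nrm X x0"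
    and y1: "summable (\<lambda>n. norm (y1 n) powr q)" "nrm Y y1 \<le> nrm Y y0"
    unfolding x1_def y1_def X_def Y_def by (intro head_ell pq x0 y0)+
  have "norm (B x0 y0) - norm (B x1 y1) \<le> norm (B x0 y0 - B x1 y1)"
    by (rule norm_triangle_ineq2)
  also have "\<dots> < norm (B x0 y0) - (1 - \<delta>) * (nrm X x0 * nrm Y y0)"
    using form_head_diff_le[OF pq B' x0 y0, of m] m
    unfolding X_def Y_def x1_def y1_def real_norm_def by linarith
  finally have "(1 - \<delta>) * (nrm X x0 * nrm Y y0) < norm (B x1 y1)"
    by simp
  moreover have "(1 - \<delta>) * (nrm X x1 * nrm Y y1) \<le> (1 - \<delta>) * (nrm X x0 * nrm Y y0)"
    using \<delta> x1(2) y1(2) by (intro mult_left_mono mult_mono) (auto simp: X_def Y_def nrm_ell_nonneg)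
  ultimately have big1: "(1 - \<delta>) * (nrm X x1 * nrm Y y1) < norm (B x1 y1)"
    by simp
  have "norm (B x1 y1) \<le> nrm X x1 * nrm Y y1"
    using forms_le_ellD[OF B' x1(1) y1(1)] by (simp add: X_def Y_def)
  with big1 have "nrm X x1 \<noteq> 0" "nrm Y y1 \<noteq> 0"
    by auto
  then have pos: "0 < nrm X x1" "0 < nrm Y y1"
    using nrm_ell_nonneg[of p x1] nrm_ell_nonneg[of q y1] by (auto simp: X_def Y_def)
  define x y where "x = (\<lambda>n. of_real (1 / nrm X x1) * x1 n)" and "y = (\<lambda>n. of_real (1 / nrm Y y1) * y1 n)"
  have x: "summable (\<lambda>n. norm (x n) powr p)" "nrm X x \<le> 1"
    using smul_ell[OF pq(1) x1(1), of "of_real (1 / nrm X x1)"] pos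
    by (simp_all add: x_def X_def norm_divide)
  have y: "summable (\<lambda>n. norm (y n) powr q)" "nrm Y y \<le> 1"
    using smul_ell[OF pq(2) y1(1), of "of_real (1 / nrm Y y1)"] pos
    by (simp_all add: y_def Y_def norm_divide)
  have supp: "x n = 0" "y n = 0" if "m \<le> n" for n
    using that by (auto simp: x_def y_def x1_def y1_def head_def)
  have "B x y = of_real (1 / nrm X x1) * (of_real (1 / nrm Y y1) * B x1 y1)"
    using ell_form_rules(3)[OF forms_le_bilinear[OF B'] x1(1) y(1), of "of_real (1 / nrm X x1)"]
      ell_form_rules(4)[OF forms_le_bilinear[OF B'] x1(1) y1(1), of "of_real (1 / nrm Y y1)"]
    by (simp add: x_def y_def)
  then have "norm (B x y) = norm (B x1 y1) / (nrm X x1 * nrm Y y1)"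
    using pos by (simp add: norm_mult norm_divide)
  then have Bxy: "1 - \<delta> < norm (B x y)"
    using big1 pos pos_less_divide_eq[of "nrm X x1 * nrm Y y1" "1 - \<delta>" "norm (B x1 y1)"] by simp
  have pts: "x \<in> points X" "y \<in> points Y"
    using x y by (simp_all add: X_def Y_def)
  have unit_pts: "unit_seq i \<in> points X" "unit_seq i \<in> points Y" for i
    using unit_seq_ell(1) pq by (simp_all add: X_def Y_def)
  have "\<forall>\<^sub>F n in sequentially. 1 - \<delta> < norm (Bn n x y)"
    by (rule order_tendstoD(1)[OF tendsto_norm[OF lim[OF pts]] Bxy])
  moreover have "(\<lambda>n. \<Sum>i<m. \<Sum>j<m. norm (Bn n (unit_seq i) (unit_seq j) - B (unit_seq i) (unit_seq j)))
      \<longlonglongrightarrow> (\<Sum>i<m. \<Sum>j<m. 0)"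
    by (intro tendsto_sum tendsto_norm_zero Lim_null[THEN iffD1] lim unit_pts)
  then have "\<forall>\<^sub>F n in sequentially.
      (\<Sum>i<m. \<Sum>j<m. norm (Bn n (unit_seq i) (unit_seq j) - B (unit_seq i) (unit_seq j))) < \<eta>"
    using order_tendstoD(2) \<eta> by fastforce
  ultimately have "\<forall>\<^sub>F n in sequentially. 1 - \<delta> < norm (Bn n x y) \<and>
      (\<Sum>i<m. \<Sum>j<m. norm (Bn n (unit_seq i) (unit_seq j) - B (unit_seq i) (unit_seq j))) < \<eta>"
    by (rule eventually_conj)
  \<comment> \<open>One index serves two purposes: \<open>Bn n\<close> is almost maximal at the same
    pair as \<open>B\<close>, and the m by m blocks of entries are close in sum.\<close>
  then obtain n where n: "1 - \<delta> < norm (Bn n x y)"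
      "(\<Sum>i<m. \<Sum>j<m. norm (Bn n (unit_seq i) (unit_seq j) - B (unit_seq i) (unit_seq j))) < \<eta>"
    by (auto simp: eventually_sequentially)
  have tail_right: "norm (A u (tail m v)) \<le> \<eta> * (nrm X u * nrm Y v)"
    if "A \<in> forms_le X Y 1" "1 - \<delta> < norm (A x y)"
      "summable (\<lambda>n. norm (u n) powr p)" "summable (\<lambda>n. norm (v n) powr q)" for A u v
    using right[OF that(1) x y supp(2) _ that(3,4)] that(2) \<delta> by simp
  have tail_left: "norm (A (tail m u) v) \<le> \<eta> * (nrm X u * nrm Y v)"
    if "A \<in> forms_le X Y 1" "1 - \<delta> < norm (A x y)"
      "summable (\<lambda>n. norm (u n) powr p)" "summable (\<lambda>n. norm (v n) powr q)" for A u v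
    using left[OF forms_le_flip[OF that(1)] y x supp(1) _ that(4,3)] that(2) \<delta> by (simp add: mult.commute)
  define D where "D = (\<lambda>x y. Bn n x y - B x y)"
  have D: "D \<in> bilinear_forms X Y"
    unfolding D_def by (intro diff_bilinear_forms forms_le_bilinear[OF B] forms_le_bilinear[OF Bn])
  have "norm (D u v) \<le> e * (nrm X u * nrm Y v)" if "u \<in> points X" "v \<in> points Y" for u v
  proof -
    have u: "summable (\<lambda>n. norm (u n) powr p)" and v: "summable (\<lambda>n. norm (v n) powr q)"
      using that by (simp_all add: X_def Y_def)
    have hv: "summable (\<lambda>n. norm (head m v n) powr q)" "nrm Y (head m v) \<le> nrm Y v"
      unfolding Y_def by (intro head_ell pq v)+
    have nonneg: "0 \<le> nrm X u" "0 \<le> nrm Y v"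
      by (simp_all add: X_def Y_def nrm_ell_nonneg)
    have "norm (D (head m u) (head m v))
        \<le> (\<Sum>i<m. \<Sum>j<m. norm (u i * (v j * D (unit_seq i) (unit_seq j))))"
      unfolding form_head_sum[OF pq D[unfolded X_def Y_def] u v]
      by (intro sum_norm_le order.trans[OF norm_sum]) simp
    also have "\<dots> \<le> (\<Sum>i<m. \<Sum>j<m. nrm X u * (nrm Y v * norm (D (unit_seq i) (unit_seq j))))"
      using ell_coordinate_le[OF pq(1) u] ell_coordinate_le[OF pq(2) v] nonneg
      by (intro sum_mono) (auto simp: norm_mult X_def Y_def intro!: mult_mono)
    also have "\<dots> = nrm X u * nrm Y v * (\<Sum>i<m. \<Sum>j<m. norm (D (unit_seq i) (unit_seq j)))"
      by (simp add: sum_distrib_left mult.assoc)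
    also have "\<dots> \<le> nrm X u * nrm Y v * \<eta>"
      using n(2) nonneg by (intro mult_left_mono) (auto simp: D_def)
    finally have "norm (D (head m u) (head m v)) \<le> \<eta> * (nrm X u * nrm Y v)"
      by (simp add: mult.commute)
    moreover have "norm (D (tail m u) (head m v)) \<le> 2 * (\<eta> * (nrm X u * nrm Y v))"
    proof -
      have "norm (D (tail m u) (head m v)) \<le> norm (Bn n (tail m u) (head m v)) + norm (B (tail m u) (head m v))"
        unfolding D_def by (rule norm_triangle_ineq4)
      also have "\<dots> \<le> \<eta> * (nrm X u * nrm Y (head m v)) + \<eta> * (nrm X u * nrm Y (head m v))"
        by (intro add_mono tail_left Bn B n Bxy u hv)
      also have "\<dots> \<le> 2 * (\<eta> * (nrm X u * nrm Y v))"
        using hv(2) nonneg \<eta> by (simp add: mult_left_mono)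
      finally show ?thesis .
    qed
    moreover have "norm (D u (tail m v)) \<le> 2 * (\<eta> * (nrm X u * nrm Y v))"
    proof -
      have "norm (D u (tail m v)) \<le> norm (Bn n u (tail m v)) + norm (B u (tail m v))"
        unfolding D_def by (rule norm_triangle_ineq4)
      also have "\<dots> \<le> \<eta> * (nrm X u * nrm Y v) + \<eta> * (nrm X u * nrm Y v)"
        by (intro add_mono tail_right Bn B n Bxy u v)
      finally show ?thesis
        by simp
    qed
    moreover have "norm (D u v) \<le> norm (D (head m u) (head m v)) + norm (D (tail m u) (head m v))
        + norm (D u (tail m v))"
      using form_head_tail[OF pq D[unfolded X_def Y_def] u v, of m]
      by (simp add: norm_add_rule_thm)
    ultimately show ?thesis
      by (simp add: \<eta>_def)
  qed
  then have "D \<in> forms_le X Y e"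
    using D by (simp add: forms_le_def)
  then show ?thesis
    unfolding D_def by blast
qed

lemma scalar_pair_ell:
  assumes "scalar_unit (J :: 'k::{real_normed_field, euclidean_space})" "1 \<le> p" "1 \<le> q"
  shows "scalar_pair J (ell TYPE('k) p) (ell TYPE('k) q)"
  using assms(1) homogeneous_pair_ell[OF assms(2,3)] by (rule scalar_pair.intro)

theorem strongly_subdifferentiable_proj_tensor_ell:
  fixes p q :: real
  assumes J: "scalar_unit (J :: 'k::{real_normed_field, euclidean_space})"
    and p: "2 < p" and q: "2 < q"
  shows "strongly_subdifferentiable (proj_tensor (ell TYPE('k) (ereal p)) (ell TYPE('k) (ereal q)))"
proof -
  interpret scalar_pair J "ell TYPE('k) (ereal p)" "ell TYPE('k) (ereal q)"
    using scalar_pair_ell[OF J, of "ereal p" "ereal q"] p q by simp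
  show ?thesis
    unfolding strongly_subdifferentiable_def proj_tensor_def
  proof (intro ballI impI)
    fix P assume P: "P \<in> points (completion T)" "nrm (completion T) P = 1"
    from P(1) obtain s where s: "P = cauchy_class s" "s \<in> cauchy_seqs T"
      unfolding points_completion by (rule imageE)
    have s1: "lim_nrm s = 1"
      using P(2) nrm_cauchy_class[OF s(2)] s(1) by simp
    show "ssd_at (completion T) P"
      unfolding s(1)
    proof (rule ssd_at_if_norm_convergence[OF s(2) s1])
      show "\<exists>r B. strict_mono (r :: nat \<Rightarrow> nat) \<and>
          B \<in> forms_le (ell TYPE('k) (ereal p)) (ell TYPE('k) (ereal q)) 1 \<and>
          (\<forall>x\<in>points (ell TYPE('k) (ereal p)). \<forall>y\<in>points (ell TYPE('k) (ereal q)).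
            (\<lambda>n. Bn (r n) x y) \<longlonglongrightarrow> B x y)"
        if "\<And>n. Bn n \<in> forms_le (ell TYPE('k) (ereal p)) (ell TYPE('k) (ereal q)) 1" for Bn
        by (rule forms_le_sequentially_compact) (use that p q in auto)
    next
      fix Bn B and e :: real
      assume "\<And>n. Bn n \<in> forms_le (ell TYPE('k) (ereal p)) (ell TYPE('k) (ereal q)) 1"
        "B \<in> forms_le (ell TYPE('k) (ereal p)) (ell TYPE('k) (ereal q)) 1"
        "\<And>x y. x \<in> points (ell TYPE('k) (ereal p)) \<Longrightarrow> y \<in> points (ell TYPE('k) (ereal q)) \<Longrightarrow>
          (\<lambda>n. Bn n x y) \<longlonglongrightarrow> B x y"
        "\<And>c. 0 \<le> c \<Longrightarrow> B \<in> forms_le (ell TYPE('k) (ereal p)) (ell TYPE('k) (ereal q)) c \<Longrightarrow> 1 \<le> c"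
        "0 < e"
      then show "\<exists>n. (\<lambda>x y. Bn n x y - B x y) \<in> forms_le (ell TYPE('k) (ereal p)) (ell TYPE('k) (ereal q)) e"
        by (rule forms_norm_convergence[OF p q])
    qed
  qed
qed

section \<open>Failure of strong subdifferentiability\<close>

context seminormed_space
begin

text \<open>Uniform convergence would put both quotients within \<open>c / 2\<close> of the same
  value \<open>L h\<close> as soon as the steps are short.\<close>

lemma not_ssd_atI:
  assumes s: "s \<in> cauchy_seqs V" and c: "0 < c"
    and jump: "\<And>d. 0 < d \<Longrightarrow> \<exists>h t t'. h \<in> cauchy_seqs V \<and> lim_nrm h \<le> 1 \<and> 0 < t \<and> t < d \<and> 0 < t' \<and> t' < d \<and>
      c \<le> (lim_nrm (\<lambda>n. s n + t *\<^sub>R h n) - lim_nrm s) / t - (lim_nrm (\<lambda>n. s n + t' *\<^sub>R h n) - lim_nrm s) / t'"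
  shows "\<not> ssd_at (completion V) (cauchy_class s)"
proof
  assume "ssd_at (completion V) (cauchy_class s)"
  then obtain L where L: "\<forall>e>0. \<exists>d>0. \<forall>t. 0 < t \<and> t < d \<longrightarrow> (\<forall>h\<in>cauchy_seqs V. lim_nrm h \<le> 1 \<longrightarrow>
      \<bar>(lim_nrm (\<lambda>n. s n + t *\<^sub>R h n) - lim_nrm s) / t - L h\<bar> < e)"
    unfolding ssd_at_cauchy_class_iff[OF s] by (elim exE)
  have "0 < c / 2"
    using c by simp
  with L have "\<exists>d>0. \<forall>t. 0 < t \<and> t < d \<longrightarrow> (\<forall>h\<in>cauchy_seqs V. lim_nrm h \<le> 1 \<longrightarrow>
      \<bar>(lim_nrm (\<lambda>n. s n + t *\<^sub>R h n) - lim_nrm s) / t - L h\<bar> < c / 2)"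
    by (elim allE[of _ "c / 2"] impE)
  then obtain d where "0 < d" and d: "\<forall>t. 0 < t \<and> t < d \<longrightarrow> (\<forall>h\<in>cauchy_seqs V. lim_nrm h \<le> 1 \<longrightarrow>
      \<bar>(lim_nrm (\<lambda>n. s n + t *\<^sub>R h n) - lim_nrm s) / t - L h\<bar> < c / 2)"
    by (elim exE conjE)
  from jump[OF \<open>0 < d\<close>] obtain h t t' where h: "h \<in> cauchy_seqs V" "lim_nrm h \<le> 1"
    and t: "0 < t \<and> t < d" and t': "0 < t' \<and> t' < d"
    and "c \<le> (lim_nrm (\<lambda>n. s n + t *\<^sub>R h n) - lim_nrm s) / t - (lim_nrm (\<lambda>n. s n + t' *\<^sub>R h n) - lim_nrm s) / t'"
    by (elim exE conjE) (rule that; assumption | simp)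
  then show False
    using d[rule_format, OF t h] d[rule_format, OF t' h] by linarith
qed

lemma not_strongly_subdifferentiableI:
  assumes "s \<in> cauchy_seqs V" "lim_nrm s = 1" "\<not> ssd_at (completion V) (cauchy_class s)"
  shows "\<not> strongly_subdifferentiable (completion V)"
  using assms nrm_cauchy_class[OF assms(1)] unfolding strongly_subdifferentiable_def points_completion
  by auto

lemma lim_nrm_const: "lim_nrm (\<lambda>_. u) = nrm V u"
  by (rule lim_nrm_eqI) simp

text \<open>At \<open>x n = n / (n + 1)\<close> in the direction of the \<open>n\<close>-th unit vector, the difference quotients of the
  supremum norm are \<open>0\<close> at \<open>1 / (n + 1)\<close> but \<open>1 / 2\<close> at \<open>2 / (n + 1)\<close>.\<close>

lemma not_strongly_subdifferentiable_if_ell_infinity: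
  fixes j :: "(nat \<Rightarrow> 'k) \<Rightarrow> 'v"
  assumes pts: "\<And>x. bounded (range x) \<Longrightarrow> j x \<in> points V"
    and lin: "\<And>x y r. bounded (range x) \<Longrightarrow> bounded (range y) \<Longrightarrow>
      j (\<lambda>n. x n + of_real r * y n) = j x + r *\<^sub>R j y"
    and nrm: "\<And>x. bounded (range x) \<Longrightarrow> nrm V (j x) = (SUP n. norm (x n))"
  shows "\<not> strongly_subdifferentiable (completion V)"
proof -
  define x :: "nat \<Rightarrow> 'k" where "x k = of_real (real k / (real k + 1))" for k
  have nrmI: "nrm V (j z) = v" if z: "\<And>k. norm (z k) \<le> v" and v: "\<And>e. 0 < e \<Longrightarrow> \<exists>k. v - e < norm (z k)"
    for z v
  proof -
    have b: "bounded (range z)"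
      using z by (auto simp: bounded_iff)
    have "(SUP n. norm (z n)) = v"
    proof (rule antisym)
      show "(SUP n. norm (z n)) \<le> v"
        using z by (intro cSUP_least) auto
      show "v \<le> (SUP n. norm (z n))"
      proof (rule field_le_epsilon)
        fix e :: real assume "0 < e"
        then obtain k where "v - e < norm (z k)"
          using v by blast
        also have "norm (z k) \<le> (SUP n. norm (z n))"
          using b by (intro cSUP_upper bdd_above_norm_range) auto
        finally show "v \<le> (SUP n. norm (z n)) + e"
          by simp
      qed
    qed
    then show ?thesis
      by (simp add: nrm[OF b])
  qed
  have x_le: "real k / (real k + 1) = 1 - 1 / (real k + 1)" for k
    by (simp add: field_simps)
  have x_tail: "\<exists>k>m. 1 - e < real k / (real k + 1)" if "0 < e" for e :: real and m :: nat
  proof -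
    obtain k where k: "1 / e < real k"
      using reals_Archimedean2 by blast
    have "1 / e < real (k + Suc m) + 1"
      using k by simp
    then have "1 / (real (k + Suc m) + 1) < e"
      using that by (simp add: field_simps)
    then have "1 - e < real (k + Suc m) / (real (k + Suc m) + 1)"
      unfolding x_le by simp
    then show ?thesis
      by (intro exI[of _ "k + Suc m"]) simp
  qed
  have norm_x: "norm (x k) = real k / (real k + 1)" for k
    unfolding x_def norm_of_real by simp
  have xb: "bounded (range x)"
    by (auto simp: bounded_iff norm_x intro!: exI[of _ 1])
  have eb: "bounded (range (unit_seq n :: nat \<Rightarrow> 'k))" for n
    by (auto simp: bounded_iff unit_seq_def intro!: exI[of _ 1])
  have nx: "nrm V (j x) = 1"
  proof (rule nrmI)
    show "\<exists>k. 1 - e < norm (x k)" if "0 < e" for e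
      using x_tail[OF that, of 0] by (auto simp: norm_x)
  qed (simp add: norm_x)
  have ne: "nrm V (j (unit_seq n)) = 1" for n
  proof (rule nrmI)
    show "\<exists>k. 1 - e < norm (unit_seq n k :: 'k)" if "0 < e" for e
      using that by (intro exI[of _ n]) (simp add: unit_seq_def)
  qed (simp add: unit_seq_def)
  have norm_z: "norm (x k + of_real t * unit_seq n k) = real k / (real k + 1) + (if k = n then t else 0)"
    if "0 < t" for t n k
  proof -
    have "x k + of_real t * unit_seq n k = of_real (real k / (real k + 1) + (if k = n then t else 0))"
      by (simp add: x_def unit_seq_def)
    then show ?thesis
      using that by (simp only: norm_of_real) simp
  qed
  have n1: "nrm V (j x + (1 / (real n + 1)) *\<^sub>R j (unit_seq n)) = 1" for n
    unfolding lin[OF xb eb, symmetric]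
  proof (rule nrmI)
    show "norm (x k + of_real (1 / (real n + 1)) * unit_seq n k) \<le> 1" for k
      by (subst norm_z) (auto simp: x_le)
    show "\<exists>k. 1 - e < norm (x k + of_real (1 / (real n + 1)) * unit_seq n k)" if "0 < e" for e
    proof -
      \<comment> \<open>Coordinates beyond \<open>n\<close> are untouched by the perturbation and
        still approach 1.\<close>
      from x_tail[OF that] obtain k where "n < k" "1 - e < real k / (real k + 1)"
        by blast
      then show ?thesis
        by (intro exI[of _ k]) (subst norm_z; simp)
    qed
  qed
  have n2: "nrm V (j x + (2 / (real n + 1)) *\<^sub>R j (unit_seq n)) = 1 + 1 / (real n + 1)" for n
    unfolding lin[OF xb eb, symmetric]
  proof (rule nrmI)
    have two: "2 / (real n + 1) = 2 * (1 / (real n + 1))"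
      by simp
    have norm_k: "norm (x k + of_real (2 / (real n + 1)) * unit_seq n k)
        = 1 - 1 / (real k + 1) + (if k = n then 2 * (1 / (real n + 1)) else 0)" for k
      unfolding x_le[symmetric] two[symmetric] by (rule norm_z) simp
    show "norm (x k + of_real (2 / (real n + 1)) * unit_seq n k) \<le> 1 + 1 / (real n + 1)" for k
    proof (cases "k = n")
      case True
      then show ?thesis
        unfolding norm_k by simp
    next
      case False
      have "0 \<le> 1 / (real k + 1)" "0 \<le> 1 / (real n + 1)"
        by auto
      then show ?thesis
        unfolding norm_k if_not_P[OF False] by linarith
    qed
    show "\<exists>k. 1 + 1 / (real n + 1) - e < norm (x k + of_real (2 / (real n + 1)) * unit_seq n k)"
      if "0 < e" for e
      using that unfolding norm_k by (intro exI[of _ n]) simp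
  qed
  let ?s = "\<lambda>_ :: nat. j x"
  have s: "?s \<in> cauchy_seqs V"
    by (rule cauchy_seqs_const[OF pts[OF xb]])
  have "\<not> ssd_at (completion V) (cauchy_class ?s)"
  proof (rule not_ssd_atI[OF s, of "1 / 2"])
    fix d :: real assume d: "0 < d"
    obtain n where "2 / d < real n"
      using reals_Archimedean2 by blast
    then have n: "2 / (real n + 1) < d" "1 / (real n + 1) < d"
      using d by (auto simp: field_simps)
    show "\<exists>h t t'. h \<in> cauchy_seqs V \<and> lim_nrm h \<le> 1 \<and> 0 < t \<and> t < d \<and> 0 < t' \<and> t' < d \<and>
        1 / 2 \<le> (lim_nrm (\<lambda>n. ?s n + t *\<^sub>R h n) - lim_nrm ?s) / t
          - (lim_nrm (\<lambda>n. ?s n + t' *\<^sub>R h n) - lim_nrm ?s) / t'"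
      by (intro exI[of _ "\<lambda>_. j (unit_seq n)"] exI[of _ "2 / (real n + 1)"] exI[of _ "1 / (real n + 1)"])
        (use n in \<open>simp add: cauchy_seqs_const pts eb lim_nrm_const nx ne n1 n2\<close>)
  qed simp
  then show ?thesis
    by (rule not_strongly_subdifferentiableI[OF s, rotated]) (simp add: lim_nrm_const nx)
qed

end

section \<open>Copies of the bounded and of the absolutely summable sequences in the tensor
  product\<close>

lemma unit_seq_points:
  assumes "1 \<le> p"
  shows "(unit_seq i :: nat \<Rightarrow> 'k::real_normed_field) \<in> points (ell TYPE('k) p)"
    "nrm (ell TYPE('k) p) (unit_seq i) = 1"
proof -
  have "(unit_seq i :: nat \<Rightarrow> 'k) \<in> points (ell TYPE('k) p) \<and> nrm (ell TYPE('k) p) (unit_seq i) = 1"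
    using assms
  proof (cases rule: ell_exponent_cases)
    case (1 r)
    then show ?thesis
      using unit_seq_ell[of r i] by simp
  next
    case 2
    have "bounded (range (unit_seq i :: nat \<Rightarrow> 'k))"
      by (auto simp: bounded_iff unit_seq_def intro!: exI[of _ 1])
    moreover have "(SUP n. norm (unit_seq i n :: 'k)) = 1"
      by (rule cSup_eq_maximum) (auto simp: unit_seq_def image_iff)
    ultimately show ?thesis
      using 2 by simp
  qed
  then show "(unit_seq i :: nat \<Rightarrow> 'k) \<in> points (ell TYPE('k) p)" "nrm (ell TYPE('k) p) (unit_seq i) = 1"
    by auto
qed

lemma coordinate_le:
  fixes x :: "nat \<Rightarrow> 'k::real_normed_field"
  assumes "1 \<le> p" "x \<in> points (ell TYPE('k) p)"
  shows "norm (x n) \<le> nrm (ell TYPE('k) p) x"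
  using assms(1)
proof (cases rule: ell_exponent_cases)
  case (1 r)
  then show ?thesis
    using ell_coordinate_le[of r x n] assms by simp
next
  case 2
  then show ?thesis
    using assms by (auto intro!: cSUP_upper bdd_above_norm_range)
qed

text \<open>Tensoring with \<open>unit_seq 0\<close> is isometric: the cost of the elementary tensor
  bounds its norm from above, and the contractive forms \<open>x n * y 0\<close> bound it from
  below.\<close>

lemma not_strongly_subdifferentiable_ell_infinity_left:
  assumes q: "1 \<le> q"
  shows "\<not> strongly_subdifferentiable (proj_tensor (ell TYPE('k::real_normed_field) \<infinity>) (ell TYPE('k) q))"
proof -
  interpret homogeneous_pair "ell TYPE('k) \<infinity>" "ell TYPE('k) q"
    by (rule homogeneous_pair_ell) (use q in auto)
  let ?X = "ell TYPE('k) \<infinity>" and ?Y = "ell TYPE('k) q"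
  note e0 = unit_seq_points[where 'k = 'k, OF q, of 0]
  show ?thesis
    unfolding proj_tensor_def
  proof (rule not_strongly_subdifferentiable_if_ell_infinity[of "\<lambda>x. elem_tensor ?X ?Y x (unit_seq 0)"])
    fix x :: "nat \<Rightarrow> 'k" assume x: "bounded (range x)"
    then have px: "x \<in> points ?X"
      by simp
    show "elem_tensor ?X ?Y x (unit_seq 0) \<in> points T"
      by (rule elem_tensor_points[OF px e0(1)])
    show "nrm T (elem_tensor ?X ?Y x (unit_seq 0)) = (SUP n. norm (x n))"
    proof (rule antisym)
      show "nrm T (elem_tensor ?X ?Y x (unit_seq 0)) \<le> (SUP n. norm (x n))"
        using nrm_T_elem_le[OF px e0(1)] e0(2) by simp
      show "(SUP n. norm (x n)) \<le> nrm T (elem_tensor ?X ?Y x (unit_seq 0))"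
      proof (rule cSUP_least)
        fix n
        let ?B = "\<lambda>(x :: nat \<Rightarrow> 'k) (y :: nat \<Rightarrow> 'k). x n * y 0 :: 'k"
        have "?B \<in> bilinear_forms ?X ?Y"
          by (simp add: bilinear_forms_def algebra_simps)
        moreover have "norm (?B x y) \<le> nrm ?X x * nrm ?Y y" if "x \<in> points ?X" "y \<in> points ?Y" for x y
          unfolding norm_mult using coordinate_le[of "\<infinity>" x n] coordinate_le[OF q, of y 0] that
          by (intro mult_mono nrm_X_nonneg) simp_all
        ultimately have B: "?B \<in> forms_le ?X ?Y 1"
          by (simp add: forms_le_def)
        then have "elem_tensor ?X ?Y x (unit_seq 0) ?B = x n"
          by (simp add: elem_tensor_def forms_le_bilinear unit_seq_def)
        then show "norm (x n) \<le> nrm T (elem_tensor ?X ?Y x (unit_seq 0))"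
          using norm_point_le[OF elem_tensor_points[OF px e0(1)] B] by simp
      qed simp
    qed
    fix y :: "nat \<Rightarrow> 'k" and r :: real assume y: "bounded (range y)"
    have ry: "(\<lambda>n. of_real r * y n) \<in> points ?X"
      using smul_X[of y "of_real r"] y by simp
    show "elem_tensor ?X ?Y (\<lambda>n. x n + of_real r * y n) (unit_seq 0)
        = elem_tensor ?X ?Y x (unit_seq 0) + r *\<^sub>R elem_tensor ?X ?Y y (unit_seq 0)"
      using elem_tensor_vadd_left[OF px ry e0(1)] elem_tensor_smul_left[of y "unit_seq 0" "of_real r"] y e0(1)
      by (simp add: scaleR_eq_smul)
  qed
qed

lemma not_strongly_subdifferentiable_ell_infinity_right:
  assumes p: "1 \<le> p"
  shows "\<not> strongly_subdifferentiable (proj_tensor (ell TYPE('k::real_normed_field) p) (ell TYPE('k) \<infinity>))"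
proof -
  interpret homogeneous_pair "ell TYPE('k) p" "ell TYPE('k) \<infinity>"
    by (rule homogeneous_pair_ell) (use p in auto)
  let ?X = "ell TYPE('k) p" and ?Y = "ell TYPE('k) \<infinity>"
  note e0 = unit_seq_points[where 'k = 'k, OF p, of 0]
  show ?thesis
    unfolding proj_tensor_def
  proof (rule not_strongly_subdifferentiable_if_ell_infinity[of "\<lambda>y. elem_tensor ?X ?Y (unit_seq 0) y"])
    fix x :: "nat \<Rightarrow> 'k" assume x: "bounded (range x)"
    then have px: "x \<in> points ?Y"
      by simp
    show "elem_tensor ?X ?Y (unit_seq 0) x \<in> points T"
      by (rule elem_tensor_points[OF e0(1) px])
    show "nrm T (elem_tensor ?X ?Y (unit_seq 0) x) = (SUP n. norm (x n))"
    proof (rule antisym)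
      show "nrm T (elem_tensor ?X ?Y (unit_seq 0) x) \<le> (SUP n. norm (x n))"
        using nrm_T_elem_le[OF e0(1) px] e0(2) by simp
      show "(SUP n. norm (x n)) \<le> nrm T (elem_tensor ?X ?Y (unit_seq 0) x)"
      proof (rule cSUP_least)
        fix n
        let ?B = "\<lambda>(x :: nat \<Rightarrow> 'k) (y :: nat \<Rightarrow> 'k). x 0 * y n :: 'k"
        have "?B \<in> bilinear_forms ?X ?Y"
          by (simp add: bilinear_forms_def algebra_simps)
        moreover have "norm (?B x y) \<le> nrm ?X x * nrm ?Y y" if "x \<in> points ?X" "y \<in> points ?Y" for x y
          unfolding norm_mult using coordinate_le[of "\<infinity>" y n] coordinate_le[OF p, of x 0] that
          by (intro mult_mono nrm_X_nonneg) simp_all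
        ultimately have B: "?B \<in> forms_le ?X ?Y 1"
          by (simp add: forms_le_def)
        then have "elem_tensor ?X ?Y (unit_seq 0) x ?B = x n"
          by (simp add: elem_tensor_def forms_le_bilinear unit_seq_def)
        then show "norm (x n) \<le> nrm T (elem_tensor ?X ?Y (unit_seq 0) x)"
          using norm_point_le[OF elem_tensor_points[OF e0(1) px] B] by simp
      qed simp
    qed
    fix y :: "nat \<Rightarrow> 'k" and r :: real assume y: "bounded (range y)"
    have ry: "(\<lambda>n. of_real r * y n) \<in> points ?Y"
      using smul_ell_infinity(1)[OF y] by simp
    show "elem_tensor ?X ?Y (unit_seq 0) (\<lambda>n. x n + of_real r * y n)
        = elem_tensor ?X ?Y (unit_seq 0) x + r *\<^sub>R elem_tensor ?X ?Y (unit_seq 0) y"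
      using elem_tensor_vadd_right[OF e0(1) px ry] elem_tensor_smul_right[OF e0(1), of y "of_real r"] y
      by (simp add: scaleR_eq_smul)
  qed
qed

text \<open>These are the pairs for which the diagonal form summing \<open>x k * y k\<close> is
  bounded by the product of the norms. Exponent 1 stands apart because the other exponent may then
  be infinite and because Young's inequality is applied with exponents above 1.\<close>

definition Hoelder_exponents :: "ereal \<Rightarrow> ereal \<Rightarrow> bool" where
  "Hoelder_exponents p q \<longleftrightarrow> 1 \<le> p \<and> 1 \<le> q \<and>
     (p = 1 \<or> q = 1 \<or> (\<exists>r s. p = ereal r \<and> q = ereal s \<and> 1 < r \<and> 1 < s \<and> 1 \<le> 1 / r + 1 / s))"

lemma sum_norm_le_nrm_ell_one:
  fixes x :: "nat \<Rightarrow> 'k::real_normed_field"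
  assumes "x \<in> points (ell TYPE('k) 1)"
  shows "(\<Sum>k<N. norm (x k)) \<le> nrm (ell TYPE('k) 1) x"
proof -
  have x: "summable (\<lambda>n. norm (x n))"
    using assms by (simp add: one_ereal_def)
  then have "(\<Sum>k<N. norm (x k)) \<le> (\<Sum>k. norm (x k))"
    by (intro sum_le_suminf) auto
  then show ?thesis
    using x by (simp add: one_ereal_def nrm_ell suminf_nonneg)
qed

text \<open>With \<open>r'\<close> conjugate to \<open>r\<close>, the condition on the exponents
  says \<open>s \<le> r'\<close>. Normalised coordinates are at most 1, so their power
  \<open>r'\<close> is at most their power \<open>s\<close>; Young's inequality for \<open>r\<close>
  and \<open>r'\<close> therefore also covers reciprocals whose sum exceeds 1. For an exponent 1 the
  other factor is bounded coordinatewise by its norm.\<close>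

lemma Hoelder_ell:
  fixes x y :: "nat \<Rightarrow> 'k::real_normed_field"
  assumes pq: "Hoelder_exponents p q"
    and x: "x \<in> points (ell TYPE('k) p)" and y: "y \<in> points (ell TYPE('k) q)"
  shows "(\<Sum>k<N. norm (x k) * norm (y k)) \<le> nrm (ell TYPE('k) p) x * nrm (ell TYPE('k) q) y"
proof -
  have p: "1 \<le> p" and q: "1 \<le> q"
    using pq by (auto simp: Hoelder_exponents_def)
  define P Q where "P = nrm (ell TYPE('k) p) x" and "Q = nrm (ell TYPE('k) q) y"
  have xP: "norm (x k) \<le> P" and yQ: "norm (y k) \<le> Q" for k
    using coordinate_le[OF p x] coordinate_le[OF q y] by (auto simp: P_def Q_def)
  have nonneg: "0 \<le> P" "0 \<le> Q"
    using xP[of 0] yQ[of 0] order.trans[OF norm_ge_zero] by blast+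
  consider "p = 1" | "q = 1" | r s where "p = ereal r" "q = ereal s" "1 < r" "1 < s" "1 \<le> 1 / r + 1 / s"
    using pq unfolding Hoelder_exponents_def by blast
  then have "(\<Sum>k<N. norm (x k) * norm (y k)) \<le> P * Q"
  proof cases
    case 1
    have "(\<Sum>k<N. norm (x k) * norm (y k)) \<le> (\<Sum>k<N. norm (x k)) * Q"
      unfolding sum_distrib_right by (intro sum_mono mult_left_mono yQ) simp
    also have "\<dots> \<le> P * Q"
      using sum_norm_le_nrm_ell_one[of x N] x 1 nonneg by (intro mult_right_mono) (auto simp: P_def)
    finally show ?thesis .
  next
    case 2
    have "(\<Sum>k<N. norm (x k) * norm (y k)) \<le> P * (\<Sum>k<N. norm (y k))"
      unfolding sum_distrib_left by (intro sum_mono mult_right_mono xP) simp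
    also have "\<dots> \<le> P * Q"
      using sum_norm_le_nrm_ell_one[of y N] y 2 nonneg by (intro mult_left_mono) (auto simp: Q_def)
    finally show ?thesis .
  next
    case (3 r s)
    define r' where "r' = r / (r - 1)"
    have r': "1 < r'" "1 / r + 1 / r' = 1" "s \<le> r'"
    proof -
      show "1 < r'" "1 / r + 1 / r' = 1"
        using 3 by (auto simp: r'_def field_simps)
      then have "1 / r' \<le> 1 / s"
        using 3 by linarith
      then show "s \<le> r'"
        using \<open>1 < r'\<close> 3 by (simp add: field_simps)
    qed
    show ?thesis
    proof (cases "P = 0 \<or> Q = 0")
      case True
      then have "norm (x k) * norm (y k) = 0" for k
        using xP[of k] yQ[of k] by auto
      then have "(\<Sum>k<N. norm (x k) * norm (y k)) = 0"
        by (intro sum.neutral) blast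
      then show ?thesis
        using nonneg by simp
    next
      case False
      then have PQ: "0 < P" "0 < Q"
        using nonneg by auto
      have sum1: "(\<Sum>k<N. (norm (z k) / M) powr w) \<le> 1"
        if "summable (\<lambda>n. norm (z n) powr w)" "M = nrm (ell TYPE('k) (ereal w)) z" "0 < M" "1 < w"
        for z :: "nat \<Rightarrow> 'k" and M w
      proof -
        have "(\<Sum>k<N. (norm (z k) / M) powr w) = (\<Sum>k<N. norm (z k) powr w) / M powr w"
          by (simp add: powr_divide sum_divide_distrib)
        also have "\<dots> \<le> (\<Sum>k. norm (z k) powr w) / M powr w"
          using that by (intro divide_right_mono sum_le_suminf) auto
        also have "\<dots> = 1"
          using nrm_ell_powr[OF _ that(1)] that by auto
        finally show ?thesis .
      qed
      have "norm (x k) / P * (norm (y k) / Q) \<le> (norm (x k) / P) powr r / r + (norm (y k) / Q) powr s / r'" for k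
      proof -
        have "norm (x k) / P * (norm (y k) / Q) \<le> (norm (x k) / P) powr r / r + (norm (y k) / Q) powr r' / r'"
          using 3 r' PQ by (intro Youngs_inequality) auto
        also have "(norm (y k) / Q) powr r' \<le> (norm (y k) / Q) powr s"
          using yQ[of k] PQ r' by (intro powr_mono') auto
        finally show ?thesis
          using r' by (simp add: divide_right_mono)
      qed
      then have "(\<Sum>k<N. norm (x k) / P * (norm (y k) / Q))
          \<le> (\<Sum>k<N. (norm (x k) / P) powr r / r + (norm (y k) / Q) powr s / r')"
        by (intro sum_mono)
      also have "\<dots> = (\<Sum>k<N. (norm (x k) / P) powr r) / r + (\<Sum>k<N. (norm (y k) / Q) powr s) / r'"
        by (simp add: sum.distrib sum_divide_distrib)
      also have "\<dots> \<le> 1 / r + 1 / r'"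
        using 3 r' x y PQ by (intro add_mono divide_right_mono sum1) (auto simp: P_def Q_def)
      finally have "(\<Sum>k<N. norm (x k) * norm (y k)) / (P * Q) \<le> 1"
        using r' by (simp add: sum_divide_distrib)
      then show ?thesis
        using PQ by (simp add: field_simps)
    qed
  qed
  then show ?thesis
    by (simp add: P_def Q_def)
qed

text \<open>The diagonal of the tensor product is an isometric copy of \<open>\<ell>\<^sub>1\<close>, whose norm is not strongly
  subdifferentiable at the point with coordinates \<open>2 ^ - (n + 1)\<close>: in the direction of minus the
  \<open>n\<close>-th unit vector the difference quotients are \<open>-1\<close> at \<open>2 ^ - (n + 2)\<close> but \<open>0\<close> at \<open>2 ^ - n\<close>.\<close>

lemma not_strongly_subdifferentiable_diagonal:
  assumes pq: "Hoelder_exponents p q"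
  shows "\<not> strongly_subdifferentiable (proj_tensor (ell TYPE('k::real_normed_field) p) (ell TYPE('k) q))"
proof -
  have p: "1 \<le> p" and q: "1 \<le> q"
    using pq by (auto simp: Hoelder_exponents_def)
  interpret homogeneous_pair "ell TYPE('k) p" "ell TYPE('k) q"
    by (rule homogeneous_pair_ell[OF p q])
  let ?X = "ell TYPE('k) p" and ?Y = "ell TYPE('k) q"
  define E where "E k = elem_tensor ?X ?Y (unit_seq k) (unit_seq k)" for k
  \<comment> \<open>For summable coefficients the partial sums, as a function of \<open>N\<close>,
    are the Cauchy sequence representing the diagonal element.\<close>
  define dg where "dg c N = (\<Sum>k<N. c k *\<^sub>R E k)" for c :: "nat \<Rightarrow> real" and N :: nat
  note units = unit_seq_points[where 'k = 'k, OF p] unit_seq_points[where 'k = 'k, OF q]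
  have E: "E k \<in> points T" "nrm T (E k) \<le> 1" for k
    unfolding E_def using elem_tensor_points[OF units(1,3)] nrm_T_elem_le[OF units(1,3), of k k] units(2,4)[of k] by auto
  have dg_Suc: "dg c (Suc N) = dg c N + c N *\<^sub>R E N" for c N
    unfolding dg_def by (rule sum.lessThan_Suc)
  have dg: "dg c N \<in> points T \<and> nrm T (dg c N) \<le> (\<Sum>k<N. \<bar>c k\<bar>)" for c N
  proof (induction N)
    case 0
    have "dg c 0 = 0"
      unfolding dg_def lessThan_0 sum.empty ..
    then show ?case
      by (simp only: zero_points_T nrm_T_zero lessThan_0 sum.empty order_refl simp_thms)
  next
    case (Suc N)
    have "nrm T (dg c N + c N *\<^sub>R E N) \<le> nrm T (dg c N) + \<bar>c N\<bar> * nrm T (E N)"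
      using Suc E by (intro nrm_add_scaleR_le) auto
    moreover have "\<bar>c N\<bar> * nrm T (E N) \<le> \<bar>c N\<bar> * 1"
      using E(2)[of N] by (intro mult_left_mono) auto
    ultimately have "nrm T (dg c N + c N *\<^sub>R E N) \<le> (\<Sum>k<N. \<bar>c k\<bar>) + \<bar>c N\<bar>"
      using Suc by linarith
    moreover have "dg c N + c N *\<^sub>R E N \<in> points T"
      using Suc E by (intro points_add_scaleR) auto
    ultimately show ?case
      unfolding dg_Suc sum.lessThan_Suc by (rule conjI[rotated])
  qed
  have nrm_dg: "nrm T (dg c N) = (\<Sum>k<N. \<bar>c k\<bar>)" for c N
  proof (rule antisym)
    \<comment> \<open>Hoelder's inequality makes this form contractive, and its signs turn the value
      at the diagonal tensor into the sum of absolute values.\<close>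
    let ?B = "\<lambda>(x :: nat \<Rightarrow> 'k) (y :: nat \<Rightarrow> 'k). \<Sum>k<N. of_real (sgn (c k)) * (x k * y k) :: 'k"
    have "?B \<in> bilinear_forms ?X ?Y"
      by (simp add: bilinear_forms_def algebra_simps sum.distrib sum_distrib_left)
    moreover have "norm (?B x y) \<le> nrm ?X x * nrm ?Y y" if "x \<in> points ?X" "y \<in> points ?Y" for x y
    proof -
      have "norm (?B x y) \<le> (\<Sum>k<N. norm (x k) * norm (y k))"
        by (intro sum_norm_le) (auto simp: norm_mult abs_sgn_eq)
      then show ?thesis
        using Hoelder_ell[OF pq that, of N] by simp
    qed
    ultimately have B: "?B \<in> forms_le ?X ?Y 1"
      by (simp add: forms_le_def)
    have "E k ?B = of_real (sgn (c k))" if "k < N" for k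
    proof -
      have "E k ?B = (\<Sum>i<N. if i = k then of_real (sgn (c k)) else 0)"
        unfolding E_def using forms_le_bilinear[OF B]
        by (simp add: elem_tensor_def unit_seq_def if_distrib cong: if_cong)
      then show ?thesis
        using that by simp
    qed
    moreover have "dg c M ?B = (\<Sum>k<M. of_real (c k) * E k ?B)" for M
      by (induction M) (simp_all add: dg_def scaleR_conv_of_real)
    ultimately have "dg c N ?B = (\<Sum>k<N. of_real (c k) * of_real (sgn (c k)))"
      by simp
    also have "\<dots> = of_real (\<Sum>k<N. \<bar>c k\<bar>)"
      by (simp add: abs_sgn)
    finally have "dg c N ?B = of_real (\<Sum>k<N. \<bar>c k\<bar>)" .
    then have "norm (dg c N ?B) = (\<Sum>k<N. \<bar>c k\<bar>)"
      by (simp only: norm_of_real) (simp add: sum_nonneg)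
    then show "(\<Sum>k<N. \<bar>c k\<bar>) \<le> nrm T (dg c N)"
      using norm_point_le[OF _ B] dg[of c N] by fastforce
  qed (use dg in blast)
  define c where "c k = (1 / 2 :: real) ^ Suc k" for k
  have c_sum: "(\<Sum>k<N. c k) = 1 - (1 / 2) ^ N" for N
    by (induction N) (simp_all add: c_def)
  have c_pos: "0 < c k" for k
    by (simp add: c_def)
  have diff: "nrm T (dg c m - dg c n) \<le> (1 / 2) ^ n" if "n \<le> m" for m n
  proof -
    \<comment> \<open>A difference of partial sums is again a diagonal tensor, with the first
      \<open>n\<close> coefficients set to 0, so the norm formula applies to it.\<close>
    have "dg c m - dg c n = dg (\<lambda>k. if k < n then 0 else c k) m"
      using that
    proof (induction m rule: dec_induct)
      case base
      have "dg (\<lambda>k. if k < n then 0 else c k) n = 0"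
        by (simp add: dg_def)
      then show ?case
        by simp
    next
      case (step m)
      have "dg c (Suc m) - dg c n = dg c m - dg c n + c m *\<^sub>R E m"
        unfolding dg_Suc by (rule diff_add_eq[symmetric])
      also have "\<dots> = dg (\<lambda>k. if k < n then 0 else c k) (Suc m)"
        unfolding dg_Suc step.IH using step.hyps by simp
      finally show ?case .
    qed
    then have "nrm T (dg c m - dg c n) = (\<Sum>k<m. if k < n then 0 else c k)"
      using c_pos by (simp add: nrm_dg less_imp_le if_distrib cong: if_cong)
    also have "\<dots> = (\<Sum>k<m. c k) - (\<Sum>k<n. c k)"
    proof -
      have "(\<Sum>k<m. c k) - (\<Sum>k<n. c k) = (\<Sum>k\<in>{..<m} - {..<n}. c k)"
        using that by (intro sum_diff[symmetric]) auto
      also have "\<dots> = (\<Sum>k<m. if k < n then 0 else c k)"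
        by (rule sum.mono_neutral_cong_left) auto
      finally show ?thesis
        by simp
    qed
    also have "\<dots> \<le> (1 / 2) ^ n"
      by (simp add: c_sum)
    finally show ?thesis .
  qed
  have s: "dg c \<in> cauchy_seqs T"
    unfolding cauchy_seqs_iff
  proof (intro conjI allI impI)
    fix e :: real assume e: "0 < e"
    obtain N where N: "(1 / 2 :: real) ^ N < e"
      using real_arch_pow_inv[OF e, of "1 / 2"] by auto
    have "nrm T (dg c m - dg c n) < e" if "N \<le> m" "N \<le> n" for m n
    proof -
      have "nrm T (dg c m - dg c n) \<le> (1 / 2) ^ min m n"
      proof (cases "n \<le> m")
        case True
        then show ?thesis
          using diff[of n m] by (simp only: min_absorb2)
      next
        case False
        then have "m \<le> n"
          by simp
        then show ?thesis
          using diff[of m n] nrm_minus_commute[of "dg c m" "dg c n"] dg by (simp only: min_absorb1)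
      qed
      also have "\<dots> \<le> (1 / 2) ^ N"
        using that by (intro power_decreasing) auto
      finally show ?thesis
        using N by simp
    qed
    then show "\<exists>N. \<forall>m\<ge>N. \<forall>n\<ge>N. nrm T (dg c m - dg c n) < e"
      by blast
  qed (use dg in blast)
  have lim_sum: "(\<lambda>N. 1 - (1 / 2 :: real) ^ N + r) \<longlonglongrightarrow> 1 + r" for r
    using tendsto_add[OF tendsto_diff[OF tendsto_const[of 1] LIMSEQ_power_zero[of "1 / 2 :: real"]] tendsto_const[of r]]
    by simp
  have s1: "lim_nrm (dg c) = 1"
    unfolding lim_nrm_def nrm_dg using lim_sum[of 0] c_pos
    by (intro limI) (simp add: less_imp_le c_sum)
  have pert: "lim_nrm (\<lambda>N. dg c N + t *\<^sub>R ((- 1) *\<^sub>R E n)) = 1 - c n + \<bar>c n - t\<bar>" for t n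
    unfolding lim_nrm_def
  proof (rule limI, rule Lim_transform_eventually)
    show "(\<lambda>N. 1 - (1 / 2) ^ N + (\<bar>c n - t\<bar> - c n)) \<longlonglongrightarrow> 1 - c n + \<bar>c n - t\<bar>"
      using lim_sum[of "\<bar>c n - t\<bar> - c n"] by (simp add: algebra_simps)
    have "nrm T (dg c N + t *\<^sub>R ((- 1) *\<^sub>R E n)) = 1 - (1 / 2) ^ N + (\<bar>c n - t\<bar> - c n)" if "n < N" for N
    proof -
      \<comment> \<open>The perturbation is absorbed into the coefficient at \<open>n\<close> once
        the partial sum contains it; hence the equality of norms only from some index on.\<close>
      have "dg (c(n := c n - t)) M = dg c M + (if n < M then t *\<^sub>R ((- 1) *\<^sub>R E n) else 0)" for M
        by (induction M) (auto simp: dg_def less_Suc_eq scaleR_diff_left)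
      then have "nrm T (dg c N + t *\<^sub>R ((- 1) *\<^sub>R E n)) = (\<Sum>k<N. \<bar>(c(n := c n - t)) k\<bar>)"
        using that nrm_dg[of "c(n := c n - t)" N] by simp
      also have "\<dots> = \<bar>c n - t\<bar> + (\<Sum>k\<in>{..<N} - {n}. \<bar>(c(n := c n - t)) k\<bar>)"
        using that by (subst sum.remove[of _ n]) auto
      also have "(\<Sum>k\<in>{..<N} - {n}. \<bar>(c(n := c n - t)) k\<bar>) = (\<Sum>k\<in>{..<N} - {n}. c k)"
        using c_pos by (intro sum.cong) (auto simp: less_imp_le)
      also have "\<dots> = (\<Sum>k<N. c k) - c n"
        using that by (simp add: sum_diff1)
      finally show ?thesis
        unfolding c_sum by linarith
    qed
    then show "\<forall>\<^sub>F N in sequentially. 1 - (1 / 2) ^ N + (\<bar>c n - t\<bar> - c n)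
        = nrm T (dg c N + t *\<^sub>R ((- 1) *\<^sub>R E n))"
      by (intro eventually_sequentiallyI[of "Suc n"]) simp
  qed
  have "\<not> ssd_at (completion T) (cauchy_class (dg c))"
  proof (rule not_ssd_atI[OF s, of 1])
    fix d :: real assume d: "0 < d"
    obtain n where n: "(1 / 2 :: real) ^ n < d"
      using real_arch_pow_inv[OF d, of "1 / 2"] by auto
    \<comment> \<open>The exponent in \<open>c\<close> is shifted by one, so the longer step
      \<open>2 * c n\<close> is exactly \<open>(1 / 2) ^ n\<close>.\<close>
    have cn: "2 * c n < d" "c n / 2 < d" "0 < c n"
      using n d c_pos[of n] by (auto simp: c_def)
    have h: "(- 1) *\<^sub>R E n \<in> points T" "nrm T ((- 1) *\<^sub>R E n) \<le> 1"
      using E[of n] scaleR_points_T[of "E n" "- 1"] nrm_scaleR[of "E n" "- 1"] by auto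
    show "\<exists>h t t'. h \<in> cauchy_seqs T \<and> lim_nrm h \<le> 1 \<and> 0 < t \<and> t < d \<and> 0 < t' \<and> t' < d \<and>
        1 \<le> (lim_nrm (\<lambda>n. dg c n + t *\<^sub>R h n) - lim_nrm (dg c)) / t
          - (lim_nrm (\<lambda>n. dg c n + t' *\<^sub>R h n) - lim_nrm (dg c)) / t'"
    proof (intro exI conjI)
      show "(\<lambda>_. (- 1) *\<^sub>R E n) \<in> cauchy_seqs T" "lim_nrm (\<lambda>_. (- 1) *\<^sub>R E n) \<le> 1"
        unfolding lim_nrm_const using h by (auto intro: cauchy_seqs_const)
      show "1 \<le> (lim_nrm (\<lambda>N. dg c N + (2 * c n) *\<^sub>R ((- 1) *\<^sub>R E n)) - lim_nrm (dg c)) / (2 * c n)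
          - (lim_nrm (\<lambda>N. dg c N + (c n / 2) *\<^sub>R ((- 1) *\<^sub>R E n)) - lim_nrm (dg c)) / (c n / 2)"
        unfolding pert s1 using cn by (simp add: abs_if)
    qed (use cn in auto)
  qed simp
  then show ?thesis
    unfolding proj_tensor_def by (rule not_strongly_subdifferentiableI[OF s s1])
qed

section \<open>Both scalar fields and all exponents\<close>

lemma scalar_unit_real: "scalar_unit (0 :: real)"
  by standard auto

lemma scalar_unit_complex: "scalar_unit \<i>"
  by standard (auto simp: inner_complex_def intro: complex_eq)

text \<open>Infinite exponents are left to the copy of the bounded sequences. Finite ones are real,
  and the extended quotients become ordinary ones.\<close>

lemma Hoelder_exponentsI:
  assumes pq: "1 \<le> p" "1 \<le> q" "p \<noteq> \<infinity>" "q \<noteq> \<infinity>" and "1 / p + 1 / q \<ge> 1 \<or> p = 1 \<or> q = 1"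
  shows "Hoelder_exponents p q"
proof (cases "p = 1 \<or> q = 1")
  case False
  obtain r s where rs: "p = ereal r" "q = ereal s"
    using pq by (metis ell_exponent_cases)
  have "1 < r" "1 < s"
    using False pq rs by (auto simp: one_ereal_def)
  moreover from this have "1 \<le> 1 / r + 1 / s"
    using False assms(5) rs by (simp add: one_ereal_def)
  ultimately show ?thesis
    using pq rs by (auto simp: Hoelder_exponents_def)
qed (use pq in \<open>auto simp: Hoelder_exponents_def\<close>)

lemma not_strongly_subdifferentiable_proj_tensor_ell:
  assumes pq: "1 \<le> p" "1 \<le> q"
    and "1 / p + 1 / q \<ge> 1 \<or> p = 1 \<or> p = \<infinity> \<or> q = 1 \<or> q = \<infinity>"
  shows "\<not> strongly_subdifferentiable (proj_tensor (ell TYPE('k::real_normed_field) p) (ell TYPE('k) q))"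
proof -
  consider "p = \<infinity>" | "q = \<infinity>" | "Hoelder_exponents p q"
    using assms Hoelder_exponentsI by blast
  then show ?thesis
  proof cases
    case 1
    then show ?thesis
      using not_strongly_subdifferentiable_ell_infinity_left[OF pq(2)] by simp
  next
    case 2
    then show ?thesis
      using not_strongly_subdifferentiable_ell_infinity_right[OF pq(1)] by simp
  next
    case 3
    then show ?thesis
      by (rule not_strongly_subdifferentiable_diagonal)
  qed
qed

theorem corollary2p8:
  fixes p q :: ereal
  assumes "1 \<le> p" and "1 \<le> q"
  shows
    "(2 < p \<and> p < \<infinity> \<and> 2 < q \<and> q < \<infinity> \<longrightarrow>
        strongly_subdifferentiable (proj_tensor (ell TYPE(real) p) (ell TYPE(real) q)) \<and>
        strongly_subdifferentiable (proj_tensor (ell TYPE(complex) p) (ell TYPE(complex) q))) \<and>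
     (1 / p + 1 / q \<ge> 1 \<or> p = 1 \<or> p = \<infinity> \<or> q = 1 \<or> q = \<infinity> \<longrightarrow>
        \<not> strongly_subdifferentiable (proj_tensor (ell TYPE(real) p) (ell TYPE(real) q)) \<and>
        \<not> strongly_subdifferentiable (proj_tensor (ell TYPE(complex) p) (ell TYPE(complex) q)))"
proof (intro conjI impI)
  assume "2 < p \<and> p < \<infinity> \<and> 2 < q \<and> q < \<infinity>"
  then obtain r s where rs: "p = ereal r" "q = ereal s" "2 < r" "2 < s"
    by (cases p; cases q) auto
  show "strongly_subdifferentiable (proj_tensor (ell TYPE(real) p) (ell TYPE(real) q))"
    unfolding rs(1,2) by (rule strongly_subdifferentiable_proj_tensor_ell[OF scalar_unit_real rs(3,4)])
  show "strongly_subdifferentiable (proj_tensor (ell TYPE(complex) p) (ell TYPE(complex) q))"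
    unfolding rs(1,2) by (rule strongly_subdifferentiable_proj_tensor_ell[OF scalar_unit_complex rs(3,4)])
next
  assume *: "1 / p + 1 / q \<ge> 1 \<or> p = 1 \<or> p = \<infinity> \<or> q = 1 \<or> q = \<infinity>"
  show "\<not> strongly_subdifferentiable (proj_tensor (ell TYPE(real) p) (ell TYPE(real) q))"
    by (rule not_strongly_subdifferentiable_proj_tensor_ell[OF assms *])
  show "\<not> strongly_subdifferentiable (proj_tensor (ell TYPE(complex) p) (ell TYPE(complex) q))"
    by (rule not_strongly_subdifferentiable_proj_tensor_ell[OF assms *])
qed

end
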